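(* Let $S=\{1,\dots,n\}$ and let $\eta\in W_S\subset\mathcal{P}_{S\cup\{d\}}$. Then $\eta$ is convergent if and only if $\eta\in K_S=\langle\mathcal{W}_S\rangle$, the subspace spanned by the set $\mathcal{W}_S$ of special convergent $1n$-words and Lyndon insertion words.
   Context: Words and polygons. All words have pairwise distinct letters. The shuffle $A\,\text{ш}\,B$ of words with disjoint letters is the sum of all interleavings of $A$ and $B$ keeping each order. $\mathcal{P}_R$ is the $\mathbb{Q}$-vector space with basis the cyclic orderings (polygons) of the finite set $R$. For $S=\{1,\dots,n\}$, $V_S$ is the $\mathbb{Q}$-vector space with basis the $n!$ words using each letter of $S$ once; it is identified with $\mathcal{P}_{S\cup\{d\}}$ by $w\mapsto(w,d)$. For a finite set $T$ and an extra letter $e$, $I_T\subset\mathcal{P}_{T\cup\{e\}}$ is the span of the shuffles $(A\,\text{ш}\,B,e)$, $A,B$ nonempty words whose letter sets partition $T$. $W_S\subset V_S$ is the span of the $1n$-words, i.e. words in which $1$ is immediately followed by $n$. Convergence. For an interval $T=\{i,i+1,\dots,j\}\subset S$ with $2\le|T|\le n-1$, let $\mathrm{Res}^p_T:\mathcal{P}_{S\cup\{d\}}\to\mathcal{P}_{T\cup\{e\}}\otimes\mathcal{P}_{(S\setminus T)\cup\{d,e\}}$ be the linear map which sends a polygon to $0$ if $T$ is not a block of consecutive elements of it, and otherwise to $\eta_1\otimes\eta_2$, the two polygons obtained by cutting along the chord $e$ separating $T$ from its complement. An element $\eta$ is convergent if $\mathrm{Res}^p_T(\eta)\in I_T\otimes\mathcal{P}_{(S\setminus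 T)\cup\{d,e\}}$ for all such $T$. Lyndon shuffles. For a totally ordered alphabet, a Lyndon word is a word whose first letter is its smallest letter; a Lyndon shuffle on the alphabet is $A_1\,\text{ш}\cdots\text{ш}\,A_s$, $s\ge2$, with $A_i$ Lyndon words whose letter sets partition the alphabet. It is a convergent Lyndon shuffle if no $A_i$ contains a string of at least two adjacent letters whose underlying set is an interval of the ordered alphabet. Sets $\mathcal{L}_D$ (Lyndon insertion shuffles). For $S=\{1,\dots,m\}$ define $\mathcal{L}_S$ recursively: $\mathcal{L}_{\{1\}}=\emptyset$, $\mathcal{L}_{\{1,2\}}=\{1\,\text{ш}\,2\}$; for an ordered alphabet $D$ of $m$ letters, $\mathcal{L}_D$ is the image of $\mathcal{L}_{\{1,\dots,m\}}$ under the order-preserving bijection. For $m>2$, elements of $\mathcal{L}_S$ are obtained as follows. Choose $3\le k\le m$, an alphabet $a_1<\dots<a_k$, a convergent Lyndon shuffle $\gamma$ on it, and integers $v_1,\dots,v_k\ge1$ with $\sum v_i=m$ and $v_l=1$ whenever $a_l$ is the first letter of one of the Lyndon factors of $\gamma$. Let $D_i=\{b^i_1<\dots<b^i_{v_i}\}$. If $v_i=1$ replace $a_i$ by $b^i_1$; if $v_i>1$ choose $V_i\in\mathcal{L}_{D_i}$ and replace $a_i$ by $V_i$ (expanding linearly). Order $\bigcup D_i$ by $D_1<\dots<D_k$ and the orders inside each $D_i$, and renumber as $1,\dots,m$. $\mathcal{L}_S$ is the set of all results. Set $\mathcal{W}_S$. Let $S=\{1,\dots,n\}$. A word $w$ using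 every letter of $S$ once is special convergent if no subset of $S\cup\{d\}$ of cardinality between $2$ and $n-1$ is a block of consecutive elements in both cyclic orderings $(w,d)$ and $(1,\dots,n,d)$. $\mathcal{W}_S$ consists of the special convergent $1n$-words together with the Lyndon insertion words: take an alphabet $a_1<\dots<a_k$, $k<n$, and a special convergent word $w'$ on it in which $a_1$ is immediately followed by $a_k$; choose positive integers $v_1,\dots,v_k$ with $v_1=v_k=1$, $\sum v_i=n$; let $D_i=\{b^i_1<\dots<b^i_{v_i}\}$; replace $a_i$ in $w'$ by $b^i_1$ if $v_i=1$ and by an element of $\mathcal{L}_{D_i}$ if $v_i>1$; renumber $\bigcup D_i$ (ordered by $D_1<\dots<D_k$ and the orders inside each $D_i$) as $1,\dots,n$. *)

theory Defs
  imports Complex_Main "HOL-Library.Poly_Mapping"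
begin

section \<open>Free vector spaces over the rationals\<close>

text \<open>
  The rational vector space with basis a set \<open>B\<close> of elements of \<open>'b\<close> is realised as the span
  of the basis vectors \<open>bvec b\<close>, \<open>b \<in> B\<close>, inside the space of all finitely supported
  functions on \<open>'b\<close>.
\<close>

type_synonym 'b lc = "'b \<Rightarrow>\<^sub>0 rat"

definition lc_scale :: "rat \<Rightarrow> 'b lc \<Rightarrow> 'b lc" where
  "lc_scale c x = Poly_Mapping.map ((*) c) x"

lemma lookup_lc_scale [simp]:
  "Poly_Mapping.lookup (lc_scale c x) b = c * Poly_Mapping.lookup x b"
  unfolding lc_scale_def by transfer (simp add: when_def)

global_interpretation lc: vector_space lc_scale
  by unfold_locales
    (auto intro!: poly_mapping_eqI simp: lookup_add algebra_simps)

definition bvec :: "'b \<Rightarrow> 'b lc" where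
  "bvec b = Poly_Mapping.single b 1"

definition free_on :: "'b set \<Rightarrow> 'b lc set" where
  "free_on B = lc.span (bvec ` B)"

definition lin_ext :: "('b \<Rightarrow> 'c lc) \<Rightarrow> 'b lc \<Rightarrow> 'c lc" where
  "lin_ext f x = (\<Sum>b\<in>Poly_Mapping.keys x. lc_scale (Poly_Mapping.lookup x b) (f b))"

definition bilin_ext :: "('a \<Rightarrow> 'b \<Rightarrow> 'c lc) \<Rightarrow> 'a lc \<Rightarrow> 'b lc \<Rightarrow> 'c lc" where
  "bilin_ext f x y = lin_ext (\<lambda>a. lin_ext (f a) y) x"

text \<open>
  The tensor product of the free spaces on \<open>'a\<close> and \<open>'b\<close> is the free space on \<open>'a \<times> 'b\<close>;
  \<open>tensor_sub U W\<close> is \<open>U \<otimes> W\<close> as a subspace of it.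
\<close>

definition tensor :: "'a lc \<Rightarrow> 'b lc \<Rightarrow> ('a \<times> 'b) lc" where
  "tensor = bilin_ext (\<lambda>a b. bvec (a, b))"

definition tensor_sub :: "'a lc set \<Rightarrow> 'b lc set \<Rightarrow> ('a \<times> 'b) lc set" where
  "tensor_sub U W = lc.span {tensor x y | x y. x \<in> U \<and> y \<in> W}"

lemma lin_ext_bvec [simp]: "lin_ext f (bvec b) = f b"
  by (simp add: lin_ext_def bvec_def)

lemma bilin_ext_bvec [simp]: "bilin_ext f (bvec a) (bvec b) = f a b"
  by (simp add: bilin_ext_def)


section \<open>Words and shuffles\<close>

text \<open>For words with disjoint letters all interleavings are different words, so that the
  set \<open>shuffles u v\<close> indexes them without loss of multiplicity.\<close>

definition shuffle_word :: "'a list \<Rightarrow> 'a list \<Rightarrow> 'a list lc" where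
  "shuffle_word u v = (\<Sum>w\<in>shuffles u v. bvec w)"

definition shuffle :: "'a list lc \<Rightarrow> 'a list lc \<Rightarrow> 'a list lc" where
  "shuffle = bilin_ext shuffle_word"

definition shuffle_list :: "'a list lc list \<Rightarrow> 'a list lc" where
  "shuffle_list xs = foldr shuffle xs (bvec [])"

definition conc :: "'a list lc \<Rightarrow> 'a list lc \<Rightarrow> 'a list lc" where
  "conc = bilin_ext (\<lambda>u v. bvec (u @ v))"

definition subst_word :: "('a \<Rightarrow> 'b list lc) \<Rightarrow> 'a list \<Rightarrow> 'b list lc" where
  "subst_word \<sigma> w = foldr (\<lambda>a x. conc (\<sigma> a) x) w (bvec [])"

definition rename :: "('a \<Rightarrow> 'b) \<Rightarrow> 'a list lc \<Rightarrow> 'b list lc" where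
  "rename f = lin_ext (\<lambda>w. bvec (map f w))"

definition words_on :: "'a set \<Rightarrow> 'a list set" where
  "words_on R = {w. distinct w \<and> set w = R}"


section \<open>Polygons\<close>

text \<open>A polygon is a cyclic ordering (with orientation), represented by the set of all the
  linear words obtained by opening it at some place.\<close>

type_synonym 'a polygon = "'a list set"

definition cyc :: "'a list \<Rightarrow> 'a polygon" where
  "cyc w = {rotate k w | k. True}"

definition polygons :: "'a set \<Rightarrow> 'a polygon set" where
  "polygons R = cyc ` words_on R"

definition is_block :: "'a set \<Rightarrow> 'a polygon \<Rightarrow> bool" where
  "is_block T p \<longleftrightarrow> (\<exists>A B. A @ B \<in> p \<and> set A = T)"

text \<open>The letters \<open>1, 2, \<dots>\<close> together with the two extra letters \<open>d\<close> and \<open>e\<close>.\<close>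

datatype letter = Num nat | Ltr_d | Ltr_e

definition close_d :: "nat list \<Rightarrow> letter polygon" where
  "close_d w = cyc (map Num w @ [Ltr_d])"

text \<open>The identification of \<open>V\<^sub>S\<close> with the polygons on \<open>S \<union> {d}\<close>.\<close>

definition polygon_of :: "nat list lc \<Rightarrow> letter polygon lc" where
  "polygon_of = lin_ext (\<lambda>w. bvec (close_d w))"


section \<open>Convergence\<close>

definition shuffle_space :: "letter set \<Rightarrow> letter polygon lc set" where
  "shuffle_space T = lc.span
     {lin_ext (\<lambda>w. bvec (cyc (w @ [Ltr_e]))) (shuffle_word A B) | A B.
        A \<noteq> [] \<and> B \<noteq> [] \<and> A @ B \<in> words_on T}"

text \<open>If \<open>T\<close> is a nonempty proper block of the polygon \<open>p\<close>, then \<open>p\<close> has exactly one opening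
  \<open>A @ B\<close> with \<open>set A = T\<close>; cutting along the chord \<open>e\<close> yields \<open>(A,e)\<close> and \<open>(B,e)\<close>.\<close>

definition res_polygon ::
    "letter set \<Rightarrow> letter polygon \<Rightarrow> (letter polygon \<times> letter polygon) lc" where
  "res_polygon T p =
     (if is_block T p
      then (let (A, B) = (THE (A, B). A @ B \<in> p \<and> set A = T)
            in tensor (bvec (cyc (A @ [Ltr_e]))) (bvec (cyc (B @ [Ltr_e]))))
      else 0)"

lemma res_polygon_cyc:
  assumes "distinct (A @ B)" and "A \<noteq> []" and "B \<noteq> []"
  shows "res_polygon (set A) (cyc (A @ B)) = bvec (cyc (A @ [Ltr_e]), cyc (B @ [Ltr_e]))"
proof -
  have mem: "A @ B \<in> cyc (A @ B)"
    unfolding cyc_def by (auto intro: exI[of _ 0])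
  have uniq: "A' = A \<and> B' = B" if h: "A' @ B' \<in> cyc (A @ B)" "set A' = set A" for A' B'
  proof -
    let ?w = "A @ B"
    obtain k where k: "A' @ B' = rotate k ?w" using h unfolding cyc_def by auto
    define m where "m = k mod length ?w"
    have ml: "m < length ?w" using assms unfolding m_def by simp
    have r: "A' @ B' = drop m ?w @ take m ?w"
      unfolding k m_def by (rule rotate_drop_take)
    have dA': "distinct (A' @ B')" unfolding k using assms by simp
    have lA: "length A' = length A"
      using dA' h(2) assms(1) by (metis distinct_append distinct_card)
    have "m = 0"
    proof (rule ccontr)
      assume m0: "m \<noteq> 0"
      show False
      proof (cases "m < length A")
        case True
        \<comment> \<open>then the first letter after \<open>A\<close> belongs to \<open>A'\<close>\<close>
        have "(A' @ B') ! (length A - m) = ?w ! length A"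
          unfolding r using True ml assms by (simp add: nth_append)
        moreover have "(A' @ B') ! (length A - m) \<in> set A'"
          using True m0 lA assms by (simp add: nth_append)
        ultimately have "B ! 0 \<in> set A" using h(2) by (simp add: nth_append)
        then show False using assms by (metis disjoint_iff distinct_append length_greater_0_conv nth_mem)
      next
        case False
        have "(A' @ B') ! 0 = ?w ! m"
          unfolding r using ml by (simp add: nth_append)
        moreover have "(A' @ B') ! 0 \<in> set A'"
          using lA assms by (simp add: nth_append)
        moreover have "?w ! m \<in> set B"
          using False ml by (simp add: nth_append)
        ultimately show False using h(2) assms(1) by auto
      qed
    qed
    with r have "A' @ B' = A @ B" by simp
    with lA show ?thesis by simp
  qed
  have the: "(THE (A', B'). A' @ B' \<in> cyc (A @ B) \<and> set A' = set A) = (A, B)"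
    by (rule the_equality) (use mem uniq in auto)
  have "is_block (set A) (cyc (A @ B))"
    using mem unfolding is_block_def by blast
  then show ?thesis unfolding res_polygon_def the by (simp add: tensor_def)
qed

definition res ::
    "letter set \<Rightarrow> letter polygon lc \<Rightarrow> (letter polygon \<times> letter polygon) lc" where
  "res T = lin_ext (res_polygon T)"

definition convergent_polygon :: "nat \<Rightarrow> letter polygon lc \<Rightarrow> bool" where
  "convergent_polygon n \<eta> \<longleftrightarrow>
     (\<forall>i j. 1 \<le> i \<and> j \<le> n \<and> 2 \<le> card {i..j} \<and> card {i..j} \<le> n - 1 \<longrightarrow>
        res (Num ` {i..j}) \<eta>
          \<in> tensor_sub (shuffle_space (Num ` {i..j}))
               (free_on (polygons (Num ` ({1..n} - {i..j}) \<union> {Ltr_d, Ltr_e}))))"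


section \<open>Lyndon insertion shuffles\<close>

text \<open>A shuffle \<open>A\<^sub>1 \<squnion> \<dots> \<squnion> A\<^sub>s\<close> is represented by the list of its factors.\<close>

definition lyndon_shuffle :: "nat \<Rightarrow> nat list list \<Rightarrow> bool" where
  "lyndon_shuffle k As \<longleftrightarrow>
     2 \<le> length As \<and> concat As \<in> words_on {1..k} \<and>
     (\<forall>A\<in>set As. A \<noteq> [] \<and> hd A = Min (set A))"

definition convergent_lyndon_shuffle :: "nat \<Rightarrow> nat list list \<Rightarrow> bool" where
  "convergent_lyndon_shuffle k As \<longleftrightarrow>
     lyndon_shuffle k As \<and>
     (\<forall>A\<in>set As. \<not> (\<exists>us B vs i j. A = us @ B @ vs \<and> 2 \<le> length B \<and> set B = {i..j}))"

text \<open>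
  Ordering \<open>D\<^sub>1 < D\<^sub>2 < \<dots>\<close> with \<open>card D\<^sub>i = v i\<close> and renumbering turns \<open>D\<^sub>i\<close> into the integers
  from \<open>offset v i + 1\<close> to \<open>offset v i + v i\<close>, so the order-preserving bijection from
  \<open>{1..v i}\<close> to \<open>D\<^sub>i\<close> becomes the addition of \<open>offset v i\<close>. \<open>replacement v V i\<close> is what replaces
  the letter \<open>a\<^sub>i\<close>, where \<open>V i\<close> is given in the letters \<open>{1..v i}\<close>.
\<close>

definition offset :: "(nat \<Rightarrow> nat) \<Rightarrow> nat \<Rightarrow> nat" where
  "offset v i = (\<Sum>j\<in>{1..<i}. v j)"

definition replacement :: "(nat \<Rightarrow> nat) \<Rightarrow> (nat \<Rightarrow> nat list lc) \<Rightarrow> nat \<Rightarrow> nat list lc" where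
  "replacement v V i =
     (if v i = 1 then bvec [offset v i + 1] else rename (\<lambda>a. a + offset v i) (V i))"

text \<open>
  The replacement takes place in the factors of the formal expression \<open>A\<^sub>1 \<squnion> \<dots> \<squnion> A\<^sub>s\<close>, and the
  result is expanded afterwards: for instance replacing \<open>3\<close> in \<open>13 \<squnion> 2\<close> gives \<open>1(3 \<squnion> 4) \<squnion> 2\<close>,
  in which \<open>2\<close> may also come between \<open>3\<close> and \<open>4\<close>.
\<close>

inductive_set lyndon_insertions :: "(nat \<times> nat list lc) set" where
  two: "(2, shuffle_word [1] [2]) \<in> lyndon_insertions"
| insertion:
    "3 \<le> k \<Longrightarrow>
     convergent_lyndon_shuffle k As \<Longrightarrow>
     \<forall>i\<in>{1..k}. 1 \<le> v i \<Longrightarrow>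
     (\<Sum>i\<in>{1..k}. v i) = m \<Longrightarrow>
     \<forall>A\<in>set As. v (hd A) = 1 \<Longrightarrow>
     \<forall>i\<in>{1..k}. 1 < v i \<longrightarrow> (v i, V i) \<in> lyndon_insertions \<Longrightarrow>
     (m, shuffle_list (map (subst_word (replacement v V)) As)) \<in> lyndon_insertions"

definition Lset :: "nat \<Rightarrow> nat list lc set" where
  "Lset m = {x. (m, x) \<in> lyndon_insertions}"


section \<open>The space of 1n-words and the convergent insertion words\<close>

definition one_n_words :: "nat \<Rightarrow> nat list set" where
  "one_n_words n = {w \<in> words_on {1..n}. \<exists>us vs. w = us @ [1, n] @ vs}"

definition Wspace :: "nat \<Rightarrow> nat list lc set" where
  "Wspace n = free_on (one_n_words n)"

definition special_convergent :: "nat \<Rightarrow> nat list \<Rightarrow> bool" where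
  "special_convergent n w \<longleftrightarrow>
     w \<in> words_on {1..n} \<and>
     \<not> (\<exists>R \<subseteq> Num ` {1..n} \<union> {Ltr_d}. 2 \<le> card R \<and> card R \<le> n - 1 \<and>
          is_block R (close_d w) \<and> is_block R (close_d [1..<n+1]))"

definition insertion_words :: "nat \<Rightarrow> nat list lc set" where
  "insertion_words n =
     {subst_word (replacement v V) w | k v V w.
        k < n \<and> w \<in> one_n_words k \<and> special_convergent k w \<and>
        (\<forall>i\<in>{1..k}. 1 \<le> v i) \<and> v 1 = 1 \<and> v k = 1 \<and> (\<Sum>i\<in>{1..k}. v i) = n \<and>
        (\<forall>i\<in>{1..k}. 1 < v i \<longrightarrow> V i \<in> Lset (v i))}"

definition Wset :: "nat \<Rightarrow> nat list lc set" where
  "Wset n = bvec ` {w \<in> one_n_words n. special_convergent n w} \<union> insertion_words n"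

definition Kspace :: "nat \<Rightarrow> nat list lc set" where
  "Kspace n = lc.span (Wset n)"

end

theory Submission
  imports Defs "HOL-Library.FuncSet" "HOL-Library.List_Lexorder"
begin

text \<open>
  An element of the shuffle subspace is recognised by the functionals that kill all shuffles. Convergence
  of \<open>\<eta>\<close> along an interval \<open>T\<close> therefore means: for every such functional \<open>f\<close> on the words on \<open>T\<close>, and
  every context \<open>u \<dots> w\<close>, the sum of \<open>f B\<close> times the coefficient of \<open>u B w\<close>, over all words \<open>B\<close> on
  \<open>T\<close>, is \<open>0\<close> (\<open>convergent_polygon_iff\<close>). Among these functionals are the coefficients
  of words in iterated commutators; they show that the words on \<open>T\<close> which begin with a given letter are
  linearly independent modulo shuffles, and so are those which end with a given letter.

  Let \<open>\<eta>\<close> be a convergent combination of 1n-words. In a word of \<open>\<eta>\<close> a proper interval which is a block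
  and contains \<open>1\<close> has \<open>1\<close> as its last letter, whatever the order of its letters, so by independence
  there is none; similarly for \<open>n\<close> (\<open>no_block_at_1n\<close>). Hence a word of \<open>\<eta>\<close> arises from a special
  convergent word by substituting words on disjoint intervals for its inner letters
  (\<open>insertion_decomposition\<close>), and every proper interval that is a block lies in one of
  these intervals (\<open>block_in_slot\<close>). So convergence does not relate words from different substitution schemes, and for
  one scheme it says that, in the words substituted for each letter separately, the combination lies
  in the space \<open>C\<close> of those elements that converge along all intervals of their alphabet, including the
  alphabet itself. By linear algebra the combination is then a sum of substitutions of elements of \<open>C\<close>
  (\<open>tensor_of_slices\<close>, \<open>convergent_family_span\<close>); conversely all of these converge
  (\<open>insert_lc_convergent\<close>).

  It remains to see that \<open>C\<close> is spanned by the Lyndon insertion shuffles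
  (\<open>convergent_shuffles_eq_span_Lset\<close>). The Lyndon shuffles with any number \<open>s \<ge> 1\<close> of factors form a
  basis of all combinations of words. Cutting a Lyndon shuffle along \<open>T\<close> gives shuffles, unless \<open>T\<close> is a
  block of one factor; in this case it gives that block together with the Lyndon shuffle in which
  the block is contracted to one letter. As contracted Lyndon shuffles are again linearly
  independent, convergence of a combination of Lyndon shuffles is the same condition as before, with lists
  of words in place of words (\<open>word_converges_of_converges\<close>, \<open>converges_of_word_converges\<close>). Now the
  first letters of the factors play the role of \<open>1\<close> and \<open>n\<close>: a block at the beginning of a factor begins
  with its smallest letter, so that there is none. In particular no Lyndon shuffle with only one factor
  occurs. The same argument as for 1n-words then describes \<open>C\<close> by the recursion that defines Lyndon insertion
  shuffles.
\<close>

section \<open>Free vector spaces: coordinates, functionals and multilinear maps\<close>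

abbreviation coeff :: "'b lc \<Rightarrow> 'b \<Rightarrow> rat" where
  "coeff \<equiv> Poly_Mapping.lookup"

abbreviation supp :: "'b lc \<Rightarrow> 'b set" where
  "supp \<equiv> Poly_Mapping.keys"

abbreviation lin :: "('b lc \<Rightarrow> 'c lc) \<Rightarrow> bool" where
  "lin \<equiv> Vector_Spaces.linear lc_scale lc_scale"

interpretation lc_pair: vector_space_pair "lc_scale :: rat \<Rightarrow> 'b lc \<Rightarrow> 'b lc" "lc_scale :: rat \<Rightarrow> 'c lc \<Rightarrow> 'c lc"
  by unfold_locales

lemma linI:
  assumes "\<And>x y. f (x + y) = f x + f y" and "\<And>c x. f (lc_scale c x) = lc_scale c (f x)"
  shows "lin f"
  unfolding Vector_Spaces.linear_iff by (simp add: assms lc.vector_space_axioms)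

lemma lin_add: "lin f \<Longrightarrow> f (x + y) = f x + f y"
  and lin_scale: "lin f \<Longrightarrow> f (lc_scale c x) = lc_scale c (f x)"
  and lin_sum: "lin f \<Longrightarrow> f (sum g A) = (\<Sum>a\<in>A. f (g a))"
  by (simp_all add: lc_pair.linear_add lc_pair.linear_scale lc_pair.linear_sum)

lemma lin_compose: "lin f \<Longrightarrow> lin g \<Longrightarrow> lin (\<lambda>x. g (f x))"
  by (auto intro!: linI simp: lin_add lin_scale)

lemma lin_id: "lin (\<lambda>x. x)"
  by (rule linI) auto

lemma lin_span:
  assumes "lin f" and "x \<in> lc.span S"
  shows "f x \<in> lc.span (f ` S)"
  using lc_pair.linear_span_image[OF assms(1)] assms(2) by blast

lemma lin_span_into:
  assumes "lin f" and "x \<in> lc.span S" and "\<And>s. s \<in> S \<Longrightarrow> f s \<in> lc.span R"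
  shows "f x \<in> lc.span R"
  using lin_span[OF assms(1,2)] lc.span_mono[of "f ` S" "lc.span R"] assms(3)
  by (auto simp: lc.span_span)

lemma coeff_sum: "coeff (sum f A) b = (\<Sum>a\<in>A. coeff (f a) b)"
  by (induction A rule: infinite_finite_induct) (auto simp: lookup_add)

lemma coeff_bvec: "coeff (bvec b) b' = (if b = b' then 1 else 0)"
  by (simp add: bvec_def lookup_single when_def)

lemma keys_bvec [simp]: "supp (bvec b) = {b}"
  by (simp add: bvec_def)

lemma lc_expand:
  assumes "finite X" and "supp x \<subseteq> X"
  shows "x = (\<Sum>b\<in>X. lc_scale (coeff x b) (bvec b))"
proof (rule poly_mapping_eqI)
  fix k
  show "coeff x k = coeff (\<Sum>b\<in>X. lc_scale (coeff x b) (bvec b)) k"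
    using assms by (auto simp: coeff_sum coeff_bvec if_distrib[of "\<lambda>z. _ * z"] sum.delta' in_keys_iff cong: if_cong)
qed

lemma coeff_sum_scale_bvec:
  assumes "finite X"
  shows "coeff (\<Sum>b\<in>X. lc_scale (g b) (bvec b)) a = (if a \<in> X then g a else 0)"
proof -
  have "coeff (\<Sum>b\<in>X. lc_scale (g b) (bvec b)) a = (\<Sum>b\<in>X. if b = a then g b else 0)"
    unfolding coeff_sum by (intro sum.cong refl) (simp add: coeff_bvec)
  then show ?thesis using assms by (simp add: sum.delta)
qed

lemma coeff_lin_ext: "coeff (lin_ext g c) w = (\<Sum>b\<in>supp c. coeff c b * coeff (g b) w)"
  by (simp add: lin_ext_def coeff_sum)

lemma keys_lin_ext:
  assumes "w \<in> supp (lin_ext g c)"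
  obtains b where "b \<in> supp c" and "coeff (g b) w \<noteq> 0"
proof -
  have "(\<Sum>b\<in>supp c. coeff c b * coeff (g b) w) \<noteq> 0"
    using assms by (simp add: in_keys_iff coeff_lin_ext)
  then show ?thesis using that by (metis (mono_tags, lifting) mult_zero_right sum.neutral)
qed

lemma lin_ext_superset:
  assumes "finite X" and "supp x \<subseteq> X"
  shows "lin_ext f x = (\<Sum>b\<in>X. lc_scale (coeff x b) (f b))"
  unfolding lin_ext_def using assms
  by (intro sum.mono_neutral_left) (auto simp: in_keys_iff)

lemma lin_lin_ext: "lin (lin_ext f)"
proof (rule linI)
  fix x y :: "'a lc"
  let ?X = "supp x \<union> supp y"
  have "supp (x + y) \<subseteq> ?X" by (rule Poly_Mapping.keys_add)
  then show "lin_ext f (x + y) = lin_ext f x + lin_ext f y"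
    using lin_ext_superset[of ?X x f] lin_ext_superset[of ?X y f] lin_ext_superset[of ?X "x + y" f]
    by (simp add: lookup_add lc.scale_left_distrib sum.distrib)
next
  fix c and x :: "'a lc"
  let ?X = "supp x"
  have "supp (lc_scale c x) \<subseteq> ?X" by (auto simp: in_keys_iff)
  then show "lin_ext f (lc_scale c x) = lc_scale c (lin_ext f x)"
    using lin_ext_superset[of ?X x f] lin_ext_superset[of ?X "lc_scale c x" f]
    by (simp add: lc.scale_sum_right)
qed

lemma lin_ext_unique:
  assumes "lin F"
  shows "F x = lin_ext (\<lambda>b. F (bvec b)) x"
proof -
  have "F x = F (\<Sum>b\<in>supp x. lc_scale (coeff x b) (bvec b))"
    using lc_expand[of "supp x" x] by simp
  then show ?thesis by (simp add: lin_sum[OF assms] lin_scale[OF assms] lin_ext_def)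
qed

lemma lin_bilin_ext_left: "lin (\<lambda>x. bilin_ext f x y)"
  unfolding bilin_ext_def by (rule lin_lin_ext)

lemma lin_bilin_ext_right: "lin (bilin_ext f x)"
proof (rule linI)
  fix y z
  show "bilin_ext f x (y + z) = bilin_ext f x y + bilin_ext f x z"
    by (simp add: bilin_ext_def lin_ext_def[of _ x] lin_add[OF lin_lin_ext]
        lc.scale_right_distrib sum.distrib)
next
  fix c y
  show "bilin_ext f x (lc_scale c y) = lc_scale c (bilin_ext f x y)"
    by (simp add: bilin_ext_def lin_ext_def[of _ x] lin_scale[OF lin_lin_ext]
        lc.scale_sum_right mult.commute)
qed

lemma free_on_iff: "x \<in> free_on B \<longleftrightarrow> supp x \<subseteq> B"
proof
  have sub: "lc.subspace {x. supp x \<subseteq> B}"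
    unfolding lc.subspace_def by (auto simp: in_keys_iff lookup_add subset_iff; metis add_0)
  show "supp x \<subseteq> B" if "x \<in> free_on B"
  proof -
    have "bvec ` B \<subseteq> {x. supp x \<subseteq> B}" by auto
    from lc.span_minimal[OF this sub] that show ?thesis unfolding free_on_def by blast
  qed
next
  assume a: "supp x \<subseteq> B"
  have "(\<Sum>b\<in>supp x. lc_scale (coeff x b) (bvec b)) \<in> free_on B"
    unfolding free_on_def using a by (intro lc.span_sum lc.span_scale lc.span_base) auto
  then show "x \<in> free_on B" using lc_expand[of "supp x" x] by simp
qed

lemma projection_onto_subspace:
  assumes "lc.subspace U"
  obtains P where "lin P" and "\<And>x. P x \<in> U" and "\<And>x. x \<in> U \<Longrightarrow> P x = x"
  using lc_pair.linear_exists_left_inverse_on[OF lin_id assms] by fastforce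

text \<open>
  Compose the complementary projection with a coordinate in which \<open>x\<close> has a nonzero component.
\<close>

lemma subspace_separation:
  fixes S :: "'b lc set"
  assumes "x \<notin> lc.span S"
  obtains f :: "'b \<Rightarrow> rat"
    where "\<And>s. s \<in> S \<Longrightarrow> (\<Sum>b\<in>supp s. coeff s b * f b) = 0"
      and "(\<Sum>b\<in>supp x. coeff x b * f b) \<noteq> 0"
proof -
  obtain P where P: "lin P" "\<And>x. P x \<in> lc.span S" "\<And>x. x \<in> lc.span S \<Longrightarrow> P x = x"
    using projection_onto_subspace[OF lc.subspace_span[of S]] by blast
  have "x - P x \<noteq> 0" using P(2)[of x] assms by auto
  then obtain b where b: "coeff (x - P x) b \<noteq> 0" by (metis poly_mapping_eqI lookup_zero)
  define f where "f = (\<lambda>a. coeff (bvec a - P (bvec a)) b)"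
  have val: "(\<Sum>a\<in>supp y. coeff y a * f a) = coeff (y - P y) b" for y
  proof -
    have "lin (\<lambda>y. y - P y)"
      by (rule linI) (simp_all add: lin_add[OF P(1)] lin_scale[OF P(1)] lc.scale_right_diff_distrib)
    from lin_ext_unique[OF this, of y] show ?thesis
      by (simp add: lin_ext_def coeff_sum f_def)
  qed
  show ?thesis
    by (rule that[of f]) (use b P(3) in \<open>auto simp: val lc.span_base\<close>)
qed

lemma sum_PiE_insert:
  assumes "finite K" and "i \<notin> K"
  shows "(\<Sum>p\<in>PiE (insert i K) X. g p) = (\<Sum>q\<in>PiE K X. \<Sum>b\<in>X i. g (q(i := b)))"
proof -
  have "(\<Sum>p\<in>PiE (insert i K) X. g p) = (\<Sum>(b, q)\<in>X i \<times> PiE K X. g (q(i := b)))"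
    unfolding PiE_insert_eq
    by (subst sum.reindex) (use inj_combinator[OF assms(2)] in \<open>auto simp: case_prod_unfold comp_def\<close>)
  also have "\<dots> = (\<Sum>q\<in>PiE K X. \<Sum>b\<in>X i. g (q(i := b)))"
    by (subst sum.cartesian_product[symmetric]) (rule sum.swap)
  finally show ?thesis .
qed

definition multilinear_on :: "nat set \<Rightarrow> ((nat \<Rightarrow> 'b lc) \<Rightarrow> 'c lc) \<Rightarrow> bool" where
  "multilinear_on K M \<longleftrightarrow>
     (\<forall>\<sigma> \<tau>. (\<forall>i\<in>K. \<sigma> i = \<tau> i) \<longrightarrow> M \<sigma> = M \<tau>) \<and> (\<forall>\<sigma>. \<forall>i\<in>K. lin (\<lambda>x. M (\<sigma>(i := x))))"

lemma multilinear_cong: "multilinear_on K M \<Longrightarrow> (\<And>i. i \<in> K \<Longrightarrow> \<sigma> i = \<tau> i) \<Longrightarrow> M \<sigma> = M \<tau>"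
  unfolding multilinear_on_def by blast

lemma multilinear_lin: "multilinear_on K M \<Longrightarrow> i \<in> K \<Longrightarrow> lin (\<lambda>x. M (\<sigma>(i := x)))"
  unfolding multilinear_on_def by blast

text \<open>
  This is used to compare two multilinear expressions: it suffices that they agree on basis vectors.
\<close>

lemma multilinear_expand:
  fixes M :: "(nat \<Rightarrow> 'b lc) \<Rightarrow> 'c lc"
  assumes "finite K" and M: "multilinear_on K M"
    and X: "\<And>i. i \<in> K \<Longrightarrow> finite (X i)" "\<And>i. i \<in> K \<Longrightarrow> supp (\<sigma> i) \<subseteq> X i"
  shows "M \<sigma> = (\<Sum>p\<in>PiE K X. lc_scale (\<Prod>i\<in>K. coeff (\<sigma> i) (p i)) (M (\<lambda>i. bvec (p i))))"
proof -
  \<comment> \<open>expand one slot after the other; \<open>J\<close> is the set of slots already expanded\<close>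
  have "M \<sigma> = (\<Sum>p\<in>PiE J X. lc_scale (\<Prod>i\<in>J. coeff (\<sigma> i) (p i))
                 (M (\<lambda>i. if i \<in> J then bvec (p i) else \<sigma> i)))"
    if "finite J" "J \<subseteq> K" for J using that
  proof (induction J)
    case empty
    then show ?case by simp
  next
    case (insert j J)
    have j: "j \<in> K" "finite (X j)" using insert X by auto
    have step: "M (\<lambda>i. if i \<in> J then bvec (p i) else \<sigma> i) =
        (\<Sum>b\<in>X j. lc_scale (coeff (\<sigma> j) b)
          (M (\<lambda>i. if i \<in> insert j J then bvec ((p(j := b)) i) else \<sigma> i)))" for p
    proof -
      let ?\<tau> = "\<lambda>i. if i \<in> J then bvec (p i) else \<sigma> i"
      have "M ?\<tau> = M (?\<tau>(j := \<sigma> j))"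
        using insert(2) by (intro arg_cong[of _ _ M]) auto
      also have "\<sigma> j = (\<Sum>b\<in>X j. lc_scale (coeff (\<sigma> j) b) (bvec b))"
        using lc_expand j X by blast
      also have "M (?\<tau>(j := \<dots>)) = (\<Sum>b\<in>X j. lc_scale (coeff (\<sigma> j) b) (M (?\<tau>(j := bvec b))))"
        by (simp only: lin_sum[OF multilinear_lin[OF M j(1)]] lin_scale[OF multilinear_lin[OF M j(1)]])
      also have "\<dots> = (\<Sum>b\<in>X j. lc_scale (coeff (\<sigma> j) b)
          (M (\<lambda>i. if i \<in> insert j J then bvec ((p(j := b)) i) else \<sigma> i)))"
        by (intro sum.cong refl arg_cong[of _ _ "lc_scale _"] arg_cong[of _ _ M]) (auto simp: insert(2))
      finally show ?thesis .
    qed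
    have pr: "(\<Prod>i\<in>J. coeff (\<sigma> i) (if i = j then b else q i)) = (\<Prod>i\<in>J. coeff (\<sigma> i) (q i))" for q b
      using insert(2) by (intro prod.cong) auto
    show ?case
      using insert by (subst sum_PiE_insert) (simp_all add: step pr lc.scale_sum_right mult.commute fun_upd_def cong: if_cong)
  qed
  from this[of K] assms(1) have "M \<sigma> = (\<Sum>p\<in>PiE K X. lc_scale (\<Prod>i\<in>K. coeff (\<sigma> i) (p i))
                 (M (\<lambda>i. if i \<in> K then bvec (p i) else \<sigma> i)))" by simp
  also have "\<dots> = (\<Sum>p\<in>PiE K X. lc_scale (\<Prod>i\<in>K. coeff (\<sigma> i) (p i)) (M (\<lambda>i. bvec (p i))))"
    by (intro sum.cong refl arg_cong[of _ _ "lc_scale _"] multilinear_cong[OF M]) auto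
  finally show ?thesis .
qed

lemma multilinear_span:
  fixes M :: "(nat \<Rightarrow> 'b lc) \<Rightarrow> 'c lc"
  assumes "finite K" and M: "multilinear_on K M" and "\<And>i. i \<in> K \<Longrightarrow> \<sigma> i \<in> lc.span (G i)"
  shows "M \<sigma> \<in> lc.span {M \<tau> | \<tau>. \<forall>i\<in>K. \<tau> i \<in> G i}"
proof -
  have "M \<sigma> \<in> lc.span {M \<tau> | \<tau>. \<forall>i\<in>K. \<tau> i \<in> G i}"
    if "finite J" "J \<subseteq> K" "\<forall>i\<in>K - J. \<sigma> i \<in> G i" "\<forall>i\<in>K. \<sigma> i \<in> lc.span (G i)" for J \<sigma>
    using that
  proof (induction J arbitrary: \<sigma>)
    case empty
    then show ?case by (intro lc.span_base) auto
  next
    case (insert j J)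
    have "M (\<sigma>(j := \<sigma> j)) \<in> lc.span {M \<tau> | \<tau>. \<forall>i\<in>K. \<tau> i \<in> G i}"
    proof (rule lin_span_into[OF multilinear_lin[OF M, of j \<sigma>]])
      show "j \<in> K" using insert by auto
      show "\<sigma> j \<in> lc.span (G j)" using insert by auto
      fix s assume s: "s \<in> G j"
      show "M (\<sigma>(j := s)) \<in> lc.span {M \<tau> | \<tau>. \<forall>i\<in>K. \<tau> i \<in> G i}"
        using insert.prems s by (intro insert.IH) (auto intro: lc.span_base)
    qed
    then show ?case by simp
  qed
  from this[of K \<sigma>] assms show ?thesis by auto
qed

text \<open>
  An element of a tensor product of free spaces all of whose slices in the \<open>i\<close>-th direction lie in
  a subspace \<open>U i\<close>, for every \<open>i\<close>, belongs to the tensor product of the \<open>U i\<close>: applying to each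
  slot a projection onto \<open>U i\<close> does not change it, but turns the basis tensors into tensors of
  elements of the \<open>U i\<close>.
\<close>

lemma tensor_of_slices:
  fixes M :: "(nat \<Rightarrow> 'b lc) \<Rightarrow> 'c lc"
  assumes K: "finite K" and M: "multilinear_on K M"
    and X: "\<And>i. i \<in> K \<Longrightarrow> finite (X i)"
    and slices: "\<And>i p. i \<in> K \<Longrightarrow> p \<in> PiE K X \<Longrightarrow>
       (\<Sum>b\<in>X i. lc_scale (F (p(i := b))) (bvec b)) \<in> lc.span (G i)"
  shows "(\<Sum>p\<in>PiE K X. lc_scale (F p) (M (\<lambda>i. bvec (p i))))
           \<in> lc.span {M \<tau> | \<tau>. \<forall>i\<in>K. \<tau> i \<in> G i}"
proof -
  have "\<forall>i. \<exists>P. lin P \<and> (\<forall>x. P x \<in> lc.span (G i)) \<and> (\<forall>x\<in>lc.span (G i). P x = x)"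
    using projection_onto_subspace[OF lc.subspace_span] by metis
  then obtain P where P: "\<And>i. lin (P i)" "\<And>i x. P i x \<in> lc.span (G i)"
      "\<And>i x. x \<in> lc.span (G i) \<Longrightarrow> P i x = x" by metis
  have "(\<Sum>p\<in>PiE K X. lc_scale (F p) (M (\<lambda>i. bvec (p i)))) =
      (\<Sum>p\<in>PiE K X. lc_scale (F p) (M (\<lambda>i. if i \<in> J then P i (bvec (p i)) else bvec (p i))))"
    if "finite J" "J \<subseteq> K" for J using that
  proof (induction J)
    case empty
    then show ?case by simp
  next
    case (insert j J)
    let ?L = "K - {j}"
    have KL: "K = insert j ?L" "finite ?L" "j \<notin> ?L" "j \<in> K" using insert K by auto
    let ?m = "\<lambda>J p i. if i \<in> J then P i (bvec (p i)) else bvec (p i)"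
    have inner: "(\<Sum>b\<in>X j. lc_scale (F (q(j := b))) (M (?m J (q(j := b))))) =
        (\<Sum>b\<in>X j. lc_scale (F (q(j := b))) (M (?m (insert j J) (q(j := b)))))"
      if q: "q \<in> PiE ?L X" for q
    proof (cases "X j = {}")
      case False
      then obtain b0 where b0: "b0 \<in> X j" by auto
      have qK: "q(j := b0) \<in> PiE K X"
        using q b0 KL by (subst KL(1)) (auto simp: PiE_iff extensional_def)
      let ?z = "\<Sum>b\<in>X j. lc_scale (F (q(j := b))) (bvec b)"
      have z: "P j ?z = ?z" using P(3) slices[OF KL(4) qK] by simp
      let ?N = "\<lambda>x. M ((?m J q)(j := x))"
      have N: "lin ?N" by (rule multilinear_lin[OF M KL(4)])
      have e1: "?m J (q(j := b)) = (?m J q)(j := bvec b)" for b using insert(2) by auto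
      have e2: "?m (insert j J) (q(j := b)) = (?m J q)(j := P j (bvec b))" for b using insert(2) by auto
      have "(\<Sum>b\<in>X j. lc_scale (F (q(j := b))) (?N (bvec b))) = ?N ?z"
        by (simp add: lin_sum[OF N] lin_scale[OF N])
      also have "\<dots> = ?N (P j ?z)" by (simp add: z)
      also have "\<dots> = (\<Sum>b\<in>X j. lc_scale (F (q(j := b))) (?N (P j (bvec b))))"
        by (simp add: lin_sum[OF N] lin_scale[OF N] lin_sum[OF P(1)] lin_scale[OF P(1)])
      finally show ?thesis by (simp only: e1 e2)
    qed simp
    have "(\<Sum>p\<in>PiE K X. lc_scale (F p) (M (?m J p))) = (\<Sum>p\<in>PiE K X. lc_scale (F p) (M (?m (insert j J) p)))"
      by (subst (1 2) KL(1), subst (1 2) sum_PiE_insert[OF KL(2,3)]) (intro sum.cong refl inner)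
    then show ?case using insert by simp
  qed
  from this[of K] K
  have "(\<Sum>p\<in>PiE K X. lc_scale (F p) (M (\<lambda>i. bvec (p i)))) =
      (\<Sum>p\<in>PiE K X. lc_scale (F p) (M (\<lambda>i. if i \<in> K then P i (bvec (p i)) else bvec (p i))))" by simp
  also have "\<dots> \<in> lc.span {M \<tau> | \<tau>. \<forall>i\<in>K. \<tau> i \<in> G i}"
    by (intro lc.span_sum lc.span_scale multilinear_span[OF K M]) (simp add: P(2))
  finally show ?thesis .
qed

section \<open>Functionals that vanish on shuffles\<close>

lemma finite_words_on [simp]: "finite R \<Longrightarrow> finite (words_on R)"
  unfolding words_on_def by (rule finite_subset[OF _ finite_subset_distinct]) auto

lemma mem_shuffles_iff_filter:
  assumes "set A \<inter> set B = {}"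
  shows "w \<in> shuffles A B \<longleftrightarrow>
     set w \<subseteq> set A \<union> set B \<and> filter (\<lambda>x. x \<in> set A) w = A \<and> filter (\<lambda>x. x \<in> set B) w = B"
proof
  assume w: "w \<in> shuffles A B"
  show "set w \<subseteq> set A \<union> set B \<and> filter (\<lambda>x. x \<in> set A) w = A \<and> filter (\<lambda>x. x \<in> set B) w = B"
    using set_shuffles[OF w] filter_shuffles_disjoint1[OF assms w] filter_shuffles_disjoint2[OF assms w]
    by simp
next
  assume h: "set w \<subseteq> set A \<union> set B \<and> filter (\<lambda>x. x \<in> set A) w = A \<and> filter (\<lambda>x. x \<in> set B) w = B"
  then have "filter (\<lambda>x. \<not> x \<in> set A) w = filter (\<lambda>x. x \<in> set B) w"
    using assms by (intro filter_cong refl) auto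
  with h show "w \<in> shuffles A B"
    using partition_in_shuffles[of w "\<lambda>x. x \<in> set A"] by simp
qed

lemma shuffles_words_on:
  assumes "A @ B \<in> words_on T" and "w \<in> shuffles A B"
  shows "w \<in> words_on T"
  using assms distinct_disjoint_shuffles[of A B w] set_shuffles[of w A B] by (auto simp: words_on_def)

definition kills_shuffles :: "'a set \<Rightarrow> ('a list \<Rightarrow> rat) \<Rightarrow> bool" where
  "kills_shuffles T f \<longleftrightarrow>
     (\<forall>A B. A \<noteq> [] \<and> B \<noteq> [] \<and> A @ B \<in> words_on T \<longrightarrow> (\<Sum>w\<in>shuffles A B. f w) = 0)"

definition shuffle_span :: "'a set \<Rightarrow> 'a list lc set" where
  "shuffle_span T = lc.span {shuffle_word A B | A B. A \<noteq> [] \<and> B \<noteq> [] \<and> A @ B \<in> words_on T}"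

lemma coeff_sum_bvec:
  assumes "finite X"
  shows "coeff (\<Sum>w\<in>X. bvec w) b = (if b \<in> X then 1 else 0)"
  using assms by (simp add: coeff_sum coeff_bvec sum.delta')

lemma keys_sum_bvec:
  assumes "finite X"
  shows "supp (\<Sum>w\<in>X. bvec w) = X"
  by (intro set_eqI) (simp add: in_keys_iff coeff_sum_bvec[OF assms])

lemma keys_shuffle_word: "supp (shuffle_word A B) = shuffles A B"
  unfolding shuffle_word_def by (rule keys_sum_bvec) simp

text \<open>
  Membership in the span of the shuffles becomes a family of numerical equations, which is the form
  in which convergence is used from here on.
\<close>

lemma mem_shuffle_span_iff:
  assumes T: "finite T" and x: "supp x \<subseteq> words_on T"
  shows "x \<in> shuffle_span T \<longleftrightarrow>
     (\<forall>f. kills_shuffles T f \<longrightarrow> (\<Sum>w\<in>words_on T. coeff x w * f w) = 0)"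
proof
  assume "x \<in> shuffle_span T"
  show "\<forall>f. kills_shuffles T f \<longrightarrow> (\<Sum>w\<in>words_on T. coeff x w * f w) = 0"
  proof (intro allI impI)
    fix f assume f: "kills_shuffles T f"
    let ?Z = "{z. (\<Sum>w\<in>words_on T. coeff z w * f w) = 0}"
    have "lc.subspace ?Z"
      unfolding lc.subspace_def
      by (auto simp: lookup_add sum.distrib distrib_right mult.assoc simp flip: sum_distrib_left)
    moreover have "{shuffle_word A B | A B. A \<noteq> [] \<and> B \<noteq> [] \<and> A @ B \<in> words_on T} \<subseteq> ?Z"
    proof clarify
      fix A B :: "'a list" assume AB: "A \<noteq> []" "B \<noteq> []" "A @ B \<in> words_on T"
      have "(\<Sum>w\<in>words_on T. coeff (shuffle_word A B) w * f w) = (\<Sum>w\<in>shuffles A B. f w)"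
        using shuffles_words_on[OF AB(3)] T
        by (intro sum.mono_neutral_cong_right) (auto simp: shuffle_word_def coeff_sum_bvec)
      then show "(\<Sum>w\<in>words_on T. coeff (shuffle_word A B) w * f w) = 0"
        using f AB unfolding kills_shuffles_def by simp
    qed
    ultimately have "shuffle_span T \<subseteq> ?Z" unfolding shuffle_span_def by (intro lc.span_minimal)
    with \<open>x \<in> shuffle_span T\<close> show "(\<Sum>w\<in>words_on T. coeff x w * f w) = 0" by auto
  qed
next
  assume all: "\<forall>f. kills_shuffles T f \<longrightarrow> (\<Sum>w\<in>words_on T. coeff x w * f w) = 0"
  show "x \<in> shuffle_span T"
  proof (rule ccontr)
    assume "x \<notin> shuffle_span T"
    then obtain f where
      f: "\<And>s. s \<in> {shuffle_word A B | A B. A \<noteq> [] \<and> B \<noteq> [] \<and> A @ B \<in> words_on T} \<Longrightarrow>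
            (\<Sum>b\<in>supp s. coeff s b * f b) = 0"
      and fx: "(\<Sum>b\<in>supp x. coeff x b * f b) \<noteq> 0"
      unfolding shuffle_span_def by (rule subspace_separation) blast
    have "kills_shuffles T f" unfolding kills_shuffles_def
    proof (intro allI impI)
      fix A B :: "'a list" assume AB: "A \<noteq> [] \<and> B \<noteq> [] \<and> A @ B \<in> words_on T"
      then have "(\<Sum>b\<in>supp (shuffle_word A B). coeff (shuffle_word A B) b * f b) = 0"
        by (intro f) auto
      then show "(\<Sum>w\<in>shuffles A B. f w) = 0"
        unfolding keys_shuffle_word by (simp add: shuffle_word_def coeff_sum_bvec)
    qed
    with all have "(\<Sum>w\<in>words_on T. coeff x w * f w) = 0" by blast
    moreover have "(\<Sum>w\<in>words_on T. coeff x w * f w) = (\<Sum>b\<in>supp x. coeff x b * f b)"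
      using x T by (intro sum.mono_neutral_right) (auto simp: in_keys_iff)
    ultimately show False using fx by simp
  qed
qed

text \<open>
  \<open>bracket_coeff [u\<^sub>k, \<dots>, u\<^sub>1] w\<close> is the coefficient of \<open>w\<close> in the iterated commutator
  \<open>[\<dots>[[u\<^sub>1, u\<^sub>2], u\<^sub>3], \<dots>, u\<^sub>k]\<close>.
\<close>

fun bracket_coeff :: "'a list \<Rightarrow> 'a list \<Rightarrow> rat" where
  "bracket_coeff [] w = 0"
| "bracket_coeff [a] w = (if w = [a] then 1 else 0)"
| "bracket_coeff (x # y # u) w =
     (if w \<noteq> [] \<and> last w = x then bracket_coeff (y # u) (butlast w) else 0)
     - (if w \<noteq> [] \<and> hd w = x then bracket_coeff (y # u) (tl w) else 0)"

lemma snoc_shuffles_iff: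
  assumes "distinct (A @ B)" and "x \<in> set A"
  shows "w @ [x] \<in> shuffles A B \<longleftrightarrow> last A = x \<and> w \<in> shuffles (butlast A) B"
proof -
  have d: "set A \<inter> set B = {}" "x \<notin> set B" using assms by auto
  obtain A' a where A: "A = A' @ [a]" using assms(2) by (cases A rule: rev_cases) auto
  have d': "set A' \<inter> set B = {}" "a \<notin> set A'" "a \<notin> set B" using assms(1) A by auto
  have eq: "filter (\<lambda>y. y \<in> set A) w = filter (\<lambda>y. y \<in> set A') w" if "a \<notin> set w"
    using A that by (intro filter_cong refl) auto
  show ?thesis
  proof
    assume l: "w @ [x] \<in> shuffles A B"
    then have f0: "set (w @ [x]) \<subseteq> set A \<union> set B" "filter (\<lambda>y. y \<in> set A) (w @ [x]) = A"
        "filter (\<lambda>y. y \<in> set B) (w @ [x]) = B"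
      unfolding mem_shuffles_iff_filter[OF d(1)] by blast+
    have f: "set w \<subseteq> set A \<union> set B" "filter (\<lambda>y. y \<in> set B) w = B"
      using f0(1,3) d(2) by simp_all
    have "filter (\<lambda>y. y \<in> set A) w @ [x] = A' @ [a]"
      using f0(2) assms(2) unfolding A[symmetric] by simp
    then have x: "x = a" and w: "filter (\<lambda>y. y \<in> set A) w = A'" by simp_all
    have "a \<in> set A" using A by simp
    have "a \<notin> set w"
    proof
      assume "a \<in> set w"
      then have "a \<in> set (filter (\<lambda>y. y \<in> set A) w)" using \<open>a \<in> set A\<close> by simp
      then show False using w d'(2) by simp
    qed
    then have "set w \<subseteq> set A' \<union> set B" using f(1) A by auto
    then show "last A = x \<and> w \<in> shuffles (butlast A) B"
      using f(2) eq[OF \<open>a \<notin> set w\<close>] w x A by (simp add: mem_shuffles_iff_filter[OF d'(1)])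
  next
    assume r: "last A = x \<and> w \<in> shuffles (butlast A) B"
    then have x: "x = a" and w: "w \<in> shuffles A' B" using A by simp_all
    then have f: "set w \<subseteq> set A' \<union> set B" "filter (\<lambda>y. y \<in> set A') w = A'"
        "filter (\<lambda>y. y \<in> set B) w = B"
      unfolding mem_shuffles_iff_filter[OF d'(1)] by blast+
    then have "a \<notin> set w" using d' by auto
    have "set (w @ [x]) \<subseteq> set A \<union> set B" using f(1) A x by auto
    moreover have "filter (\<lambda>y. y \<in> set A) (w @ [x]) = A"
      unfolding filter_append eq[OF \<open>a \<notin> set w\<close>] f(2) using A x by simp
    moreover have "filter (\<lambda>y. y \<in> set B) (w @ [x]) = B"
      unfolding filter_append f(3) using d(2) by simp
    ultimately show "w @ [x] \<in> shuffles A B" unfolding mem_shuffles_iff_filter[OF d(1)] by blast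
  qed
qed

lemma Cons_shuffles_iff:
  assumes "distinct (A @ B)" and "x \<in> set A"
  shows "x # w \<in> shuffles A B \<longleftrightarrow> hd A = x \<and> w \<in> shuffles (tl A) B"
  using assms by (auto simp: Cons_in_shuffles_iff)

lemma sum_shuffles_last:
  assumes "distinct (A @ B)" and "x \<in> set A"
  shows "(\<Sum>w\<in>shuffles A B. if w \<noteq> [] \<and> last w = x then g (butlast w) else 0) =
         (if last A = x then \<Sum>w\<in>shuffles (butlast A) B. g w else (0::rat))"
proof -
  have "(\<Sum>w\<in>shuffles A B. if w \<noteq> [] \<and> last w = x then g (butlast w) else 0) =
        (\<Sum>w\<in>{w\<in>shuffles A B. w \<noteq> [] \<and> last w = x}. g (butlast w))"
    by (simp add: sum.inter_filter)
  also have "{w\<in>shuffles A B. w \<noteq> [] \<and> last w = x} =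
        (\<lambda>w. w @ [x]) ` (if last A = x then shuffles (butlast A) B else {})"
  proof (intro set_eqI)
    fix w
    show "w \<in> {w\<in>shuffles A B. w \<noteq> [] \<and> last w = x} \<longleftrightarrow>
       w \<in> (\<lambda>w. w @ [x]) ` (if last A = x then shuffles (butlast A) B else {})"
      using snoc_shuffles_iff[OF assms] by (cases w rule: rev_cases) auto
  qed
  also have "(\<Sum>w\<in>\<dots>. g (butlast w)) = (if last A = x then \<Sum>w\<in>shuffles (butlast A) B. g w else 0)"
    by (subst sum.reindex) (auto intro: inj_onI)
  finally show ?thesis .
qed

lemma sum_shuffles_hd:
  assumes "distinct (A @ B)" and "x \<in> set A"
  shows "(\<Sum>w\<in>shuffles A B. if w \<noteq> [] \<and> hd w = x then g (tl w) else 0) =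
         (if hd A = x then \<Sum>w\<in>shuffles (tl A) B. g w else (0::rat))"
proof -
  have "(\<Sum>w\<in>shuffles A B. if w \<noteq> [] \<and> hd w = x then g (tl w) else 0) =
        (\<Sum>w\<in>{w\<in>shuffles A B. w \<noteq> [] \<and> hd w = x}. g (tl w))"
    by (simp add: sum.inter_filter)
  also have "{w\<in>shuffles A B. w \<noteq> [] \<and> hd w = x} =
        (\<lambda>w. x # w) ` (if hd A = x then shuffles (tl A) B else {})"
  proof (intro set_eqI)
    fix w
    show "w \<in> {w\<in>shuffles A B. w \<noteq> [] \<and> hd w = x} \<longleftrightarrow>
       w \<in> (\<lambda>w. x # w) ` (if hd A = x then shuffles (tl A) B else {})"
      using Cons_shuffles_iff[OF assms] by (cases w) auto
  qed
  also have "(\<Sum>w\<in>\<dots>. g (tl w)) = (if hd A = x then \<Sum>w\<in>shuffles (tl A) B. g w else 0)"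
    by (subst sum.reindex) auto
  finally show ?thesis .
qed

text \<open>
  Commutators are Lie elements, and Lie elements are orthogonal to proper shuffles (Ree). For
  iterated commutators this is an induction on their length: the outermost letter \<open>x\<close> occurs in
  one of the two factors, say \<open>A\<close>, and only shuffles in which \<open>x\<close> comes last or first contribute.
  Removing \<open>x\<close> leaves shuffles of \<open>B\<close> with a shorter \<open>A\<close>; if nothing remains of \<open>A\<close>, then the two
  contributions cancel.
\<close>

lemma bracket_coeff_shuffles:
  assumes "distinct (A @ B)" and "set (A @ B) = set u" and "A \<noteq> []" and "B \<noteq> []"
    and "distinct u"
  shows "(\<Sum>w\<in>shuffles A B. bracket_coeff u w) = 0"
  using assms
proof (induction u arbitrary: A B)
  case Nil
  then show ?case by simp
next
  case (Cons x v)
  show ?case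
  proof (cases v)
    case Nil
    then have "length A + length B = 1"
      using distinct_card[OF Cons.prems(1)] Cons.prems(2) by simp
    then show ?thesis using Cons.prems(3,4) by (cases A; cases B) simp_all
  next
    case v: (Cons y u)
  have main: "(\<Sum>w\<in>shuffles A B. bracket_coeff (x # y # u) w) = 0"
    if AB: "distinct (A @ B)" "set (A @ B) = set (x # y # u)" "A \<noteq> []" "B \<noteq> []" "x \<in> set A" for A B
  proof -
    have sum: "(\<Sum>w\<in>shuffles A B. bracket_coeff (x # y # u) w) =
        (if last A = x then \<Sum>w\<in>shuffles (butlast A) B. bracket_coeff (y # u) w else 0)
        - (if hd A = x then \<Sum>w\<in>shuffles (tl A) B. bracket_coeff (y # u) w else 0)"
      by (simp only: bracket_coeff.simps(3) sum_subtractf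
        sum_shuffles_last[OF AB(1,5), of "bracket_coeff (y # u)"]
        sum_shuffles_hd[OF AB(1,5), of "bracket_coeff (y # u)"])
    show ?thesis
  proof (cases "A = [x]")
    case True
    then show ?thesis unfolding sum by simp
  next
    case False
    have xyu: "x \<notin> set (y # u)" "distinct (y # u)" using Cons.prems(5) v by simp_all
    have l: "(\<Sum>w\<in>shuffles (butlast A) B. bracket_coeff (y # u) w) = 0" if lA: "last A = x"
    proof (rule Cons.IH[unfolded v])
      obtain A' where A': "A = A' @ [x]" using append_butlast_last_id[OF AB(3)] lA by metis
      show "butlast A \<noteq> []" using False A' by auto
      show "distinct (butlast A @ B)" using AB(1) A' by auto
      have "insert x (set (A' @ B)) = insert x (set (y # u))" "x \<notin> set (A' @ B)"
        using AB(1,2) A' by simp_all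
      then show "set (butlast A @ B) = set (y # u)"
        using xyu(1) A' insert_ident[of x "set (A' @ B)" "set (y # u)"] by simp
    qed (use AB(4) xyu(2) in blast)+
    have h: "(\<Sum>w\<in>shuffles (tl A) B. bracket_coeff (y # u) w) = 0" if hA: "hd A = x"
    proof (rule Cons.IH[unfolded v])
      obtain A' where A': "A = x # A'" using AB(3) hA by (cases A) auto
      show "tl A \<noteq> []" using False A' by auto
      show "distinct (tl A @ B)" using AB(1) A' by auto
      have "insert x (set (A' @ B)) = insert x (set (y # u))" "x \<notin> set (A' @ B)"
        using AB(1,2) A' by simp_all
      then show "set (tl A @ B) = set (y # u)"
        using xyu(1) A' insert_ident[of x "set (A' @ B)" "set (y # u)"] by simp
    qed (use AB(4) xyu(2) in blast)+
    show ?thesis unfolding sum using l h by simp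
  qed
  qed
  show ?thesis
  proof (cases "x \<in> set A")
    case True
    then show ?thesis unfolding v by (intro main) (use Cons.prems(1-4) v in simp_all)
  next
    case False
    then have "x \<in> set B" using Cons.prems by auto
    then have "(\<Sum>w\<in>shuffles B A. bracket_coeff (x # y # u) w) = 0"
      by (intro main) (use Cons.prems(1-4) v in \<open>simp_all add: Un_commute Int_commute\<close>)
    then show ?thesis using v shuffles_commutes[of A B] by simp
  qed
  qed
qed

lemma bracket_coeff_kills: "distinct u \<Longrightarrow> kills_shuffles (set u) (bracket_coeff u)"
  unfolding kills_shuffles_def words_on_def using bracket_coeff_shuffles by blast

lemma bracket_coeff_hd:
  assumes "distinct u" and "distinct w" and "set w = set u" and "u \<noteq> []" and "hd w = last u"
  shows "bracket_coeff u w = (if w = rev u then 1 else 0)"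
  using assms
proof (induction u w rule: bracket_coeff.induct)
  case (2 a w)
  then have "length w = 1" by (metis distinct_card length_Cons list.size(3) One_nat_def)
  then show ?case using 2 by (cases w) auto
next
  case (3 x y u w)
  have "hd w \<noteq> x" using 3(3,7) by (auto split: if_splits)
  show ?case
  proof (cases "w \<noteq> [] \<and> last w = x")
    case True
    then obtain w' where w': "w = w' @ [x]" by (metis append_butlast_last_id)
    have "w' \<noteq> []" using w' \<open>hd w \<noteq> x\<close> by auto
    have ins: "insert x (set w') = insert x (set (y # u))" "x \<notin> set w'" "x \<notin> set (y # u)"
      using 3(3-5) w' by simp_all
    then have "set w' = set (y # u)" by (rule insert_ident[THEN iffD1, rotated 2])
    then have "bracket_coeff (y # u) w' = (if w' = rev (y # u) then 1 else 0)"
      using 3(1)[OF True] 3(3,4,7) w' \<open>set w' = set (y # u)\<close> \<open>w' \<noteq> []\<close> by simp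
    then show ?thesis using w' \<open>hd w \<noteq> x\<close> by simp
  next
    case False
    then have "w \<noteq> rev (x # y # u)" by auto
    then show ?thesis using False \<open>hd w \<noteq> x\<close> by auto
  qed
qed simp

lemma bracket_coeff_last:
  assumes "distinct u" and "distinct w" and "set w = set u" and "u \<noteq> []" and "last w = last u"
  shows "bracket_coeff u w = (if w = u then (- 1) ^ (length u - 1) else 0)"
  using assms
proof (induction u w rule: bracket_coeff.induct)
  case (2 a w)
  then have "length w = 1" by (metis distinct_card length_Cons list.size(3) One_nat_def)
  then show ?case using 2 by (cases w) auto
next
  case (3 x y u w)
  have "last w \<noteq> x" using 3(3,7) by (auto split: if_splits)
  show ?case
  proof (cases "w \<noteq> [] \<and> hd w = x")
    case True
    then obtain w' where w': "w = x # w'" by (cases w) auto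
    have "w' \<noteq> []" using w' \<open>last w \<noteq> x\<close> by auto
    have ins: "insert x (set w') = insert x (set (y # u))" "x \<notin> set w'" "x \<notin> set (y # u)"
      using 3(3-5) w' by simp_all
    then have "set w' = set (y # u)" by (rule insert_ident[THEN iffD1, rotated 2])
    then have "bracket_coeff (y # u) w' = (if w' = y # u then (- 1) ^ (length (y # u) - 1) else 0)"
      using 3(2)[OF True] 3(3,4,7) w' \<open>set w' = set (y # u)\<close> \<open>w' \<noteq> []\<close> by simp
    then show ?thesis using w' \<open>last w \<noteq> x\<close> by simp
  next
    case False
    then have "w \<noteq> x # y # u" by auto
    then show ?thesis using False \<open>last w \<noteq> x\<close> by auto
  qed
qed simp

text \<open>
  Consequently the words that begin (or end) with a given letter are linearly independent modulo
  shuffles.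
\<close>

lemma functional_isolating_hd:
  assumes "B \<in> words_on T" and "B \<noteq> []"
  obtains f where "kills_shuffles T f" and "f B \<noteq> 0"
    and "\<And>B'. B' \<in> words_on T \<Longrightarrow> hd B' = hd B \<Longrightarrow> B' \<noteq> B \<Longrightarrow> f B' = 0"
proof
  show "kills_shuffles T (bracket_coeff (rev B))"
    using bracket_coeff_kills[of "rev B"] assms by (simp add: words_on_def)
  show "bracket_coeff (rev B) B \<noteq> 0"
    using bracket_coeff_hd[of "rev B" B] assms by (simp add: words_on_def last_rev)
  show "bracket_coeff (rev B) B' = 0" if "B' \<in> words_on T" "hd B' = hd B" "B' \<noteq> B" for B'
    using bracket_coeff_hd[of "rev B" B'] assms that by (simp add: words_on_def last_rev)
qed

lemma functional_isolating_last:
  assumes "B \<in> words_on T" and "B \<noteq> []"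
  obtains f where "kills_shuffles T f" and "f B \<noteq> 0"
    and "\<And>B'. B' \<in> words_on T \<Longrightarrow> last B' = last B \<Longrightarrow> B' \<noteq> B \<Longrightarrow> f B' = 0"
proof
  show "kills_shuffles T (bracket_coeff B)"
    using bracket_coeff_kills[of B] assms by (simp add: words_on_def)
  show "bracket_coeff B B \<noteq> 0"
    using bracket_coeff_last[of B B] assms by (simp add: words_on_def)
  show "bracket_coeff B B' = 0" if "B' \<in> words_on T" "last B' = last B" "B' \<noteq> B" for B'
    using bracket_coeff_last[of B B'] assms that by (simp add: words_on_def)
qed

section \<open>Substitution of words for letters, and intervals\<close>

text \<open>
  A shuffle is represented, as in the definition of Lyndon shuffles, by the list of its factors, and
  a word by the list with one entry. Both kinds of insertion elements are then obtained by
  substituting words for letters in lists of words.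
\<close>

definition subst_letters :: "('a \<Rightarrow> 'b list) \<Rightarrow> 'a list list \<Rightarrow> 'b list list" where
  "subst_letters p y = map (\<lambda>A. concat (map p A)) y"

definition factor_block :: "'a set \<Rightarrow> 'a list list \<Rightarrow> bool" where
  "factor_block T x \<longleftrightarrow> (\<exists>A\<in>set x. \<exists>u B v. A = u @ B @ v \<and> set B = T)"

definition proper_interval :: "nat \<Rightarrow> nat set \<Rightarrow> bool" where
  "proper_interval n T \<longleftrightarrow> (\<exists>i j. 1 \<le> i \<and> i < j \<and> j \<le> n \<and> T = {i..j} \<and> T \<noteq> {1..n})"

text \<open>The set \<open>D\<^sub>i\<close> in the definition of Lyndon insertion shuffles, after renumbering.\<close>

definition slot :: "(nat \<Rightarrow> nat) \<Rightarrow> nat \<Rightarrow> nat set" where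
  "slot v i = {offset v i + 1..offset v i + v i}"

lemma offset_Suc: "1 \<le> i \<Longrightarrow> offset v (Suc i) = offset v i + v i"
  unfolding offset_def by simp

lemma offset_1 [simp]: "offset v (Suc 0) = 0"
  unfolding offset_def by simp

lemma offset_Suc_eq_sum: "offset v (Suc k) = (\<Sum>i\<in>{1..k}. v i)"
  unfolding offset_def by (simp add: atLeastLessThanSuc_atLeastAtMost)

lemma offset_mono:
  assumes "1 \<le> i" and "i < j"
  shows "offset v i + v i \<le> offset v j"
  using assms(2)
proof (induction j)
  case (Suc j)
  then show ?case using assms(1) by (cases "i = j") (simp_all add: offset_Suc)
qed simp

lemma slot_less:
  assumes "1 \<le> i" and "i < j" and "a \<in> slot v i" and "b \<in> slot v j"
  shows "a < b"
  using offset_mono[OF assms(1,2), of v] assms(3,4) unfolding slot_def by auto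

lemma slot_disjoint:
  assumes "1 \<le> i" and "1 \<le> j" and "a \<in> slot v i" and "a \<in> slot v j"
  shows "i = j"
  using slot_less[OF assms(1) _ assms(3), of j a] slot_less[OF assms(2) _ assms(4), of i a] assms(3,4)
  by (meson less_irrefl linorder_neqE_nat)

lemma slot_UN: "(\<Union>i\<in>{1..k}. slot v i) = {1..\<Sum>i\<in>{1..k}. v i}"
proof (induction k)
  case (Suc k)
  have "{1..Suc k} = insert (Suc k) {1..k}" by auto
  then show ?case using Suc offset_Suc_eq_sum[of v k] by (auto simp: slot_def)
qed simp

lemma slot_nonempty: "1 \<le> v i \<Longrightarrow> slot v i \<noteq> {}"
  by (simp add: slot_def)

lemma finite_slot [simp]: "finite (slot v i)"
  by (simp add: slot_def)

text \<open>
  The data of an insertion: \<open>k\<close> letters, \<open>v i\<close> of which replace the letter \<open>i\<close>, and a list of words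
  \<open>y\<close> without proper interval blocks. The last condition excludes that a proper
  interval of the final letters meets all the letters of \<open>y\<close> and is nevertheless a block.
\<close>

definition insertion_scheme :: "nat \<Rightarrow> nat \<Rightarrow> (nat \<Rightarrow> nat) \<Rightarrow> nat list list \<Rightarrow> bool" where
  "insertion_scheme n k v y \<longleftrightarrow>
     2 \<le> k \<and> concat y \<in> words_on {1..k} \<and> (\<forall>i\<in>{1..k}. 1 \<le> v i) \<and> (\<Sum>i\<in>{1..k}. v i) = n \<and>
     (\<forall>T. proper_interval k T \<longrightarrow> \<not> factor_block T y) \<and>
     ((\<forall>A\<in>set y. set A \<noteq> {1..k}) \<or> v 1 = 1 \<and> v k = 1)"

abbreviation fillings :: "nat \<Rightarrow> (nat \<Rightarrow> nat) \<Rightarrow> (nat \<Rightarrow> nat list) set" where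
  "fillings k v \<equiv> PiE {1..k} (\<lambda>i. words_on (slot v i))"

lemma fillings_set: "p \<in> fillings k v \<Longrightarrow> i \<in> {1..k} \<Longrightarrow> set (p i) = slot v i \<and> distinct (p i)"
  by (auto simp: PiE_iff words_on_def)

lemma finite_fillings [simp]: "finite (fillings k v)"
  by (intro finite_PiE) auto

lemma distinct_concat_filling:
  assumes p: "p \<in> fillings k v" and "set L \<subseteq> {1..k}" "distinct L"
  shows "distinct (concat (map p L))"
  using assms(2,3)
proof (induction L)
  case (Cons a L)
  have "set (p a) \<inter> set (p l) = {}" if "l \<in> set L" for l
  proof -
    have "a \<in> {1..k}" "l \<in> {1..k}" "a \<noteq> l" using Cons.prems that by auto
    then show ?thesis using fillings_set[OF p] slot_disjoint[of a l _ v] by fastforce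
  qed
  then show ?case using Cons fillings_set[OF p, of a] by auto
qed simp

lemma append_eq_append_longer:
  assumes "a @ b = c @ d" and "length a \<le> length c"
  obtains z where "c = a @ z" and "b = z @ d"
proof -
  from assms(1) consider z where "a = c @ z" "z @ b = d" | z where "a @ z = c" "b = z @ d"
    unfolding append_eq_append_conv2 by blast
  then show ?thesis using assms(2) that by cases auto
qed

text \<open>
  \<open>C\<close> consists of the letters of \<open>A\<close> whose words meet \<open>B\<close>; these words follow each other.
\<close>

lemma concat_block_split:
  assumes "concat (map p A) = u @ B @ v" and "B \<noteq> []" and "\<And>l. l \<in> set A \<Longrightarrow> p l \<noteq> []"
  obtains A1 C A2 where "A = A1 @ C @ A2" and "\<And>l. l \<in> set C \<Longrightarrow> set (p l) \<inter> set B \<noteq> {}"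
    and "set B \<subseteq> (\<Union>l\<in>set C. set (p l))"
proof -
  have pre: "\<exists>C A2. A = C @ A2 \<and> (\<forall>l\<in>set C. set (p l) \<inter> set B \<noteq> {}) \<and> set B \<subseteq> (\<Union>l\<in>set C. set (p l))"
    if "concat (map p A) = B @ v" "\<forall>l\<in>set A. p l \<noteq> []" for A B
    using that
  proof (induction A arbitrary: B)
    case Nil
    then show ?case by simp
  next
    case (Cons a A)
    show ?case
    proof (cases "length B \<le> length (p a)")
      case True
      then obtain z where z: "p a = B @ z"
        using append_eq_append_longer[OF Cons.prems(1)[symmetric, simplified]] by blast
      show ?thesis
      proof (cases "B = []")
        case True
        then show ?thesis by (intro exI[of _ "[]"] exI[of _ "a # A"]) simp
      next
        case False
        then have "set B \<noteq> {}" by simp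
        then show ?thesis using z by (intro exI[of _ "[a]"] exI[of _ A]) auto
      qed
    next
      case False
      then obtain z where z: "B = p a @ z" "concat (map p A) = z @ v"
        using append_eq_append_longer[OF Cons.prems(1)[simplified]] by auto
      obtain C A2 where C: "A = C @ A2"
        "\<forall>l\<in>set C. set (p l) \<inter> set z \<noteq> {}" "set z \<subseteq> (\<Union>l\<in>set C. set (p l))"
        using Cons.IH[OF z(2)] Cons.prems(2) by auto
      have "set (p a) \<noteq> {}" using Cons.prems(2) by simp
      then have "\<forall>l\<in>set (a # C). set (p l) \<inter> set B \<noteq> {}" using C(2) z(1) by auto
      moreover have "set B \<subseteq> (\<Union>l\<in>set (a # C). set (p l))" using C(3) z(1) by auto
      ultimately show ?thesis using C(1) by (intro exI[of _ "a # C"] exI[of _ A2]) simp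
    qed
  qed
  have "\<exists>A1 C A2. A = A1 @ C @ A2 \<and> (\<forall>l\<in>set C. set (p l) \<inter> set B \<noteq> {}) \<and> set B \<subseteq> (\<Union>l\<in>set C. set (p l))"
    using assms
  proof (induction A arbitrary: u)
    case Nil
    then show ?case by simp
  next
    case (Cons a A)
    show ?case
    proof (cases "length (p a) \<le> length u")
      case True
      then obtain z where z: "concat (map p A) = z @ B @ v"
        using append_eq_append_longer[OF Cons.prems(1)[simplified]] by blast
      obtain A1 C A2 where
        "A = A1 @ C @ A2" "\<forall>l\<in>set C. set (p l) \<inter> set B \<noteq> {}" "set B \<subseteq> (\<Union>l\<in>set C. set (p l))"
        using Cons.IH[OF z Cons.prems(2)] Cons.prems(3) by auto
      then show ?thesis by (intro exI[of _ "a # A1"] exI[of _ C] exI[of _ A2]) auto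
    next
      case False
      then obtain z where z: "p a = u @ z" "B @ v = z @ concat (map p A)"
        using append_eq_append_longer[OF Cons.prems(1)[symmetric, simplified]] by auto
      have "z \<noteq> []" using False z(1) by auto
      show ?thesis
      proof (cases "length B \<le> length z")
        case True
        then obtain z' where "z = B @ z'" using append_eq_append_longer[OF z(2)] by blast
        then have "set B \<subseteq> set (p a)" using z(1) by auto
        then have "set (p a) \<inter> set B = set B" by (rule Int_absorb1)
        then have "set (p a) \<inter> set B \<noteq> {}" using Cons.prems(2) by simp
        then show ?thesis using \<open>set B \<subseteq> set (p a)\<close>
          by (intro exI[of _ "[]"] exI[of _ "[a]"] exI[of _ A]) simp
      next
        case False
        then obtain B' where B': "B = z @ B'" "concat (map p A) = B' @ v"
          using append_eq_append_longer[OF z(2)[symmetric]] by auto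
        obtain C A2 where C: "A = C @ A2"
          "\<forall>l\<in>set C. set (p l) \<inter> set B' \<noteq> {}" "set B' \<subseteq> (\<Union>l\<in>set C. set (p l))"
          using pre[OF B'(2)] Cons.prems(3) by auto
        have "hd z \<in> set (p a) \<inter> set B" using \<open>z \<noteq> []\<close> z(1) B'(1) by simp
        then have "\<forall>l\<in>set (a # C). set (p l) \<inter> set B \<noteq> {}" using C(2) B'(1) by auto
        moreover have "set B \<subseteq> (\<Union>l\<in>set (a # C). set (p l))" using C(3) z(1) B'(1) by auto
        ultimately show ?thesis using C(1)
          by (intro exI[of _ "[]"] exI[of _ "a # C"] exI[of _ A2]) simp
      qed
    qed
  qed
  then show ?thesis using that by blast
qed

text \<open>
  A proper interval block of the result of a substitution lies inside one of the substituted words.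
  Otherwise the letters of \<open>y\<close> that it meets would themselves form an interval block of \<open>y\<close>.
\<close>

lemma block_in_slot:
  assumes y: "insertion_scheme n k v y" and p: "p \<in> fillings k v"
    and T: "proper_interval n T" and B: "subst_letters p y = Xs @ (u @ B @ w) # Ys" "set B = T"
  obtains i where "i \<in> {1..k}" and "T \<subseteq> slot v i"
proof -
  have yk: "concat y \<in> words_on {1..k}" "\<forall>i\<in>{1..k}. 1 \<le> v i" "(\<Sum>i\<in>{1..k}. v i) = n"
    using y unfolding insertion_scheme_def by auto
  obtain a b where ab: "1 \<le> a" "a < b" "b \<le> n" "T = {a..b}" "T \<noteq> {1..n}"
    using T unfolding proper_interval_def by auto
  have "u @ B @ w \<in> set (subst_letters p y)" using B by simp
  then obtain A where A: "A \<in> set y" "concat (map p A) = u @ B @ w"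
    unfolding subst_letters_def by auto
  have Ak: "set A \<subseteq> {1..k}" using A(1) yk(1) unfolding words_on_def by auto
  have pne: "p l \<noteq> []" if "l \<in> set A" for l
  proof -
    have l: "l \<in> {1..k}" using that Ak by blast
    then have "set (p l) \<noteq> {}" using fillings_set[OF p l] slot_nonempty[of v l] yk(2) by auto
    then show ?thesis by auto
  qed
  have "B \<noteq> []" using B(2) ab by auto
  from concat_block_split[OF A(2) this pne] obtain A1 C A2 where C: "A = A1 @ C @ A2"
    "\<And>l. l \<in> set C \<Longrightarrow> set (p l) \<inter> set B \<noteq> {}" "set B \<subseteq> (\<Union>l\<in>set C. set (p l))" by metis
  have Ck: "set C \<subseteq> {1..k}" using Ak C(1) by auto
  have C2: "slot v l \<inter> T \<noteq> {}" if "l \<in> set C" for l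
  proof -
    have "l \<in> {1..k}" using that Ck by blast
    then show ?thesis using C(2)[OF that] fillings_set[OF p] B(2) by simp
  qed
  have C3: "T \<subseteq> (\<Union>l\<in>set C. slot v l)"
  proof
    fix t assume "t \<in> T"
    then obtain l where l: "l \<in> set C" "t \<in> set (p l)" using C(3) B(2) by blast
    then have "l \<in> {1..k}" using Ck by blast
    then show "t \<in> (\<Union>l\<in>set C. slot v l)" using l fillings_set[OF p] by blast
  qed
  have meets: "l \<in> set C" if l: "l \<in> {1..k}" "slot v l \<inter> T \<noteq> {}" for l
  proof -
    obtain t where t: "t \<in> slot v l" "t \<in> T" using l by auto
    then obtain l' where "l' \<in> set C" "t \<in> slot v l'" using C3 by auto
    then show ?thesis using slot_disjoint[of l l' t v] t l Ck by auto
  qed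
  have Cne: "set C \<noteq> {}" using C3 ab by auto
  \<comment> \<open>The letters met by an interval form an interval, since every slot in between lies inside \<open>T\<close>.\<close>
  define i j where "i = Min (set C)" and "j = Max (set C)"
  have ij: "i \<in> set C" "j \<in> set C" "\<And>l. l \<in> set C \<Longrightarrow> i \<le> l \<and> l \<le> j"
    unfolding i_def j_def using Cne by auto
  show ?thesis
  proof (cases "i = j")
    case True
    then have "set C = {i}" using ij by fastforce
    then show ?thesis using that[of i] C3 Ck by auto
  next
    case False
    then have less: "i < j" using ij by force
    have "set C = {i..j}"
    proof
      show "set C \<subseteq> {i..j}" using ij by auto
      show "{i..j} \<subseteq> set C"
      proof
        fix l assume l: "l \<in> {i..j}"
        show "l \<in> set C"
        proof (cases "l = i \<or> l = j")
          case True
          then show ?thesis using ij by auto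
        next
          case False
          have lk: "l \<in> {1..k}" using l ij(1,2) Ck by auto
          obtain t where t: "t \<in> slot v l" using slot_nonempty[of v l] yk(2) lk by auto
          obtain r where r: "r \<in> slot v i" "r \<in> T" using C2[OF ij(1)] by auto
          obtain s where s: "s \<in> slot v j" "s \<in> T" using C2[OF ij(2)] by auto
          have "r < t" using slot_less[OF _ _ r(1) t] False l ij(1) Ck by auto
          moreover have "t < s" using slot_less[OF _ _ t s(1)] False l lk by auto
          ultimately have "t \<in> T" using r(2) s(2) ab(4) by auto
          then show ?thesis using meets[OF lk] t by auto
        qed
      qed
    qed
    moreover have "factor_block (set C) y"
      unfolding factor_block_def using A(1) C(1) by blast
    moreover have "1 \<le> i" "j \<le> k" using ij(1,2) Ck by auto
    ultimately have Call: "{i..j} = {1..k}"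
      using y less unfolding insertion_scheme_def proper_interval_def by metis
    then have "set A = {1..k}" using \<open>set C = {i..j}\<close> C(1) Ak by auto
    then have v1: "v 1 = 1" "v k = 1" using y A(1) unfolding insertion_scheme_def by auto
    have "1 \<in> set C" "k \<in> set C" using Call \<open>set C = {i..j}\<close> less by auto
    then have "slot v 1 \<inter> T \<noteq> {}" "slot v k \<inter> T \<noteq> {}" using C2 by auto
    moreover have "slot v 1 = {1}" using v1 by (simp add: slot_def)
    moreover have "slot v k = {n}"
    proof -
      have "1 \<le> k" using \<open>k \<in> set C\<close> Ck by auto
      then show ?thesis using offset_Suc[of k v] offset_Suc_eq_sum[of v k] yk(3) v1 by (simp add: slot_def)
    qed
    ultimately have "1 \<in> T" "n \<in> T" by auto
    then have "T = {1..n}" using ab by auto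
    then show ?thesis using ab by simp
  qed
qed

text \<open>
  Distinctness forces the first letter of \<open>B\<close> not to lie in \<open>a\<close> and the last one not to lie in \<open>b\<close>.
\<close>

lemma append_middle_cancel:
  assumes "a @ P @ b = u @ B @ v" and "distinct (a @ P @ b)" and "set B \<subseteq> set P" and "B \<noteq> []"
  obtains u' v' where "P = u' @ B @ v'" and "u = a @ u'" and "v = v' @ b"
proof -
  have "length a \<le> length u"
  proof (rule ccontr)
    assume "\<not> length a \<le> length u"
    then obtain c where c: "a = u @ c" "B @ v = c @ P @ b"
      using append_eq_append_longer[OF assms(1)[symmetric]] by auto
    have "c \<noteq> []" using c(1) \<open>\<not> length a \<le> length u\<close> by auto
    then have "hd c = hd B" using assms(4) c(2) by (metis hd_append2)
    then have "hd c \<in> set P" using assms(3,4) by (metis hd_in_set subsetD)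
    moreover have "hd c \<in> set a" using c(1) \<open>c \<noteq> []\<close> by simp
    ultimately show False using assms(2) by auto
  qed
  then obtain u' where u': "u = a @ u'" "P @ b = u' @ B @ v"
    using append_eq_append_longer[OF assms(1)] by metis
  have e: "P @ b = (u' @ B) @ v" using u'(2) by simp
  have "length b \<le> length v"
  proof (rule ccontr)
    assume "\<not> length b \<le> length v"
    moreover have "length (P @ b) = length (u' @ B @ v)" using u'(2) by (rule arg_cong)
    ultimately have "length P \<le> length (u' @ B)" by simp
    then obtain c where c: "u' @ B = P @ c" "b = c @ v"
      by (rule append_eq_append_longer[OF e])
    have "c \<noteq> []" using c(2) \<open>\<not> length b \<le> length v\<close> by auto
    then have "last c = last B" using c(1) assms(4) by (metis last_appendR)
    then have "last c \<in> set P" using assms(3,4) by (metis last_in_set subsetD)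
    moreover have "last c \<in> set b" using c(2) \<open>c \<noteq> []\<close> by simp
    ultimately show False using assms(2) by auto
  qed
  moreover have "length (P @ b) = length ((u' @ B) @ v)" using e by (rule arg_cong)
  ultimately have "length (u' @ B) \<le> length P" by simp
  then obtain v' where "P = (u' @ B) @ v'" "v = v' @ b"
    by (rule append_eq_append_longer[OF e[symmetric]])
  then show ?thesis using that u'(1) by simp
qed

text \<open>The letters of \<open>B\<close> occur in the word substituted for \<open>i\<close> and nowhere else.\<close>

lemma rearrange_in_slot:
  assumes y: "concat y \<in> words_on {1..k}" and p: "p \<in> fillings k v"
    and i: "i \<in> {1..k}" and B: "subst_letters p y = Xs @ (u @ B @ w) # Ys" "set B \<subseteq> slot v i" "B \<noteq> []"
  obtains u' w' where "p i = u' @ B @ w'"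
    and "\<And>B'. subst_letters (p(i := u' @ B' @ w')) y = Xs @ (u @ B' @ w) # Ys"
proof -
  obtain ys A zs where A: "y = ys @ A # zs" "map (\<lambda>A. concat (map p A)) ys = Xs"
    "concat (map p A) = u @ B @ w" "map (\<lambda>A. concat (map p A)) zs = Ys"
    using B(1) unfolding subst_letters_def map_eq_append_conv map_eq_Cons_conv by auto
  have dy: "distinct (concat ys @ A @ concat zs)" "set A \<subseteq> {1..k}"
    using y A(1) unfolding words_on_def by auto
  obtain b where b: "b \<in> set B" using B(3) by (cases B) auto
  then have "b \<in> set (concat (map p A))" using A(3) by simp
  then obtain l where l: "l \<in> set A" "b \<in> set (p l)" by auto
  then have "l \<in> {1..k}" "b \<in> slot v l" using dy fillings_set[OF p] by auto
  then have "l = i" using slot_disjoint[of l i b v] b B(2) i by auto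
  with l(1) obtain A1 A2 where A12: "A = A1 @ i # A2" by (meson split_list)
  have notin: "i \<notin> set (concat ys)" "i \<notin> set (concat zs)" "i \<notin> set A1" "i \<notin> set A2"
    using dy A12 by auto
  have dA: "distinct (concat (map p A))" using distinct_concat_filling[OF p dy(2)] dy(1) by auto
  have pi: "set (p i) = slot v i" using fillings_set[OF p i] by simp
  obtain u' w' where uw: "p i = u' @ B @ w'" "u = concat (map p A1) @ u'" "w = w' @ concat (map p A2)"
    using append_middle_cancel[of "concat (map p A1)" "p i" "concat (map p A2)" u B w]
      A(3) A12 dA B(2,3) pi by auto
  have "subst_letters (p(i := u' @ B' @ w')) y = Xs @ (u @ B' @ w) # Ys" for B'
  proof -
    let ?q = "p(i := u' @ B' @ w')"
    have "map ?q L = map p L" if "i \<notin> set L" for L using that by auto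
    then have e: "concat (map ?q L) = concat (map p L)" if "i \<notin> set L" for L using that by metis
    have "map (\<lambda>A. concat (map ?q A)) ys = Xs" "map (\<lambda>A. concat (map ?q A)) zs = Ys"
      unfolding A(2,4)[symmetric] using notin(1,2) by (intro map_cong refl e; auto)+
    moreover have "concat (map ?q A) = u @ B' @ w"
      using e[OF notin(3)] e[OF notin(4)] uw(2,3) unfolding A12 by simp
    ultimately show ?thesis unfolding subst_letters_def A(1) by simp
  qed
  with uw(1) show ?thesis by (rule that)
qed

section \<open>Collapsing maximal blocks\<close>

lemma distinct_of_distinct_concat_map:
  "distinct (concat (map p L)) \<Longrightarrow> (\<And>l. l \<in> set L \<Longrightarrow> p l \<noteq> []) \<Longrightarrow> distinct L"
proof (induction L)
  case (Cons a L)
  have "set (p a) \<inter> set (concat (map p L)) = {}" using Cons.prems(1) by simp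
  moreover have "p a \<noteq> []" using Cons.prems(2) by simp
  ultimately have "a \<notin> set L" by (cases "p a") auto
  then show ?case using Cons by simp
qed simp

text \<open>
  The blocks are the fibres of \<open>h\<close>, and they are split off from the beginning of the word: the block of
  the first letter is an initial segment.
\<close>

lemma word_as_concat_of_blocks:
  assumes "distinct A" and "\<And>a. a \<in> set A \<Longrightarrow> a \<in> set (p (h a)) \<and> (\<exists>u w. A = u @ p (h a) @ w)"
    and "\<And>a b. a \<in> set A \<Longrightarrow> b \<in> set (p (h a)) \<Longrightarrow> h b = h a"
  shows "\<exists>L. A = concat (map p L) \<and> set L = h ` set A"
  using assms
proof (induction "length A" arbitrary: A rule: less_induct)
  case less
  show ?case
  proof (cases A)
    case Nil
    then show ?thesis by (intro exI[of _ "[]"]) simp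
  next
    case (Cons a A')
    then obtain u w where uw: "A = u @ p (h a) @ w" "a \<in> set (p (h a))"
      using less.prems(2)[of a] by auto
    have "u = []"
    proof (rule ccontr)
      assume "u \<noteq> []"
      then have "a \<in> set u" using uw(1) Cons by (cases u) auto
      then show False using uw less.prems(1) by auto
    qed
    then have A: "A = p (h a) @ w" using uw(1) by simp
    have hb: "h b \<noteq> h a" if b: "b \<in> set w" for b
    proof
      assume "h b = h a"
      then have "b \<in> set (p (h a))" using less.prems(2)[of b] b A by auto
      then show False using b less.prems(1) A by auto
    qed
    have "\<exists>L. w = concat (map p L) \<and> set L = h ` set w"
    proof (rule less.hyps)
      show "length w < length A" using A uw(2) by (cases "p (h a)") auto
      show "distinct w" using A less.prems(1) by simp
      show "h c = h b" if "b \<in> set w" "c \<in> set (p (h b))" for b c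
      proof -
        have "b \<in> set A" using that(1) A by simp
        then show ?thesis using less.prems(3) that(2) by blast
      qed
      show "b \<in> set (p (h b)) \<and> (\<exists>u v. w = u @ p (h b) @ v)" if b: "b \<in> set w" for b
      proof -
        have bA: "b \<in> set A" using b A by simp
        then obtain u' w' where u': "A = u' @ p (h b) @ w'" "b \<in> set (p (h b))"
          using less.prems(2) by blast
        have sub: "set (p (h b)) \<subseteq> set w"
        proof
          fix c assume c: "c \<in> set (p (h b))"
          then have "h c = h b" using less.prems(3) bA by blast
          moreover have "a \<in> set A" using A uw(2) by simp
          ultimately have "c \<notin> set (p (h a))" using less.prems(3) hb[OF b] by metis
          moreover have "c \<in> set A" using c u' by simp
          ultimately show "c \<in> set w" using A by simp
        qed
        have "p (h b) \<noteq> []" using u'(2) by auto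
        obtain u'' w'' where "w = u'' @ p (h b) @ w''"
          by (rule append_middle_cancel[of "p (h a)" w "[]" u' "p (h b)" w'])
            (use A u'(1) less.prems(1) sub \<open>p (h b) \<noteq> []\<close> in auto)
        then show ?thesis using u'(2) by blast
      qed
    qed
    then obtain L where "w = concat (map p L)" "set L = h ` set w" by blast
    moreover have "h ` set (p (h a)) = {h a}"
    proof -
      have "a \<in> set A" using A uw(2) by simp
      from less.prems(3)[OF this] have "h ` set (p (h a)) \<subseteq> {h a}" by (metis image_subsetI singletonI)
      moreover have "h a \<in> h ` set (p (h a))" using uw(2) by (rule imageI)
      ultimately show ?thesis by (metis empty_iff subset_singletonD)
    qed
    ultimately show ?thesis using A by (intro exI[of _ "h a # L"]) (simp add: image_Un)
  qed
qed

lemma downset_eq_atLeastAtMost: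
  assumes "finite S" and "0 \<notin> S" and "\<And>a b. a \<in> S \<Longrightarrow> 1 \<le> b \<Longrightarrow> b \<le> a \<Longrightarrow> b \<in> S"
  shows "S = {1..card S}"
proof (cases "S = {}")
  case False
  have "S = {1..Max S}"
  proof
    show "S \<subseteq> {1..Max S}" using assms(1,2) by (auto simp: Suc_le_eq intro: gr0I)
    show "{1..Max S} \<subseteq> S" using assms(3)[OF Max_in[OF assms(1) False]] by auto
  qed
  then show ?thesis by (metis card_atLeastAtMost diff_Suc_1)
qed simp

text \<open>
  A monotone map onto \<open>{1..k}\<close> encodes a division of \<open>{1..n}\<close> into \<open>k\<close> consecutive intervals, its fibres.
  At least two of them are required, so that each fibre is a proper interval or a single letter.
\<close>

definition collapses :: "nat list list \<Rightarrow> nat \<Rightarrow> nat \<Rightarrow> (nat \<Rightarrow> nat) \<Rightarrow> bool" where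
  "collapses x n k h \<longleftrightarrow> 2 \<le> k \<and> (\<forall>a\<in>{1..n}. \<forall>b\<in>{1..n}. a \<le> b \<longrightarrow> h a \<le> h b) \<and> h ` {1..n} = {1..k} \<and>
     (\<forall>i\<in>{1..k}. factor_block {a\<in>{1..n}. h a = i} x)"

text \<open>
  Contraction of the interval \<open>{i..j}\<close> to the letter \<open>i\<close>.
\<close>

lemma collapses_compose:
  assumes "collapses x n k h" and T: "proper_interval k {i..j}"
    and blk: "factor_block {a\<in>{1..n}. h a \<in> {i..j}} x" and ij: "1 \<le> i" "i < j" "j \<le> k"
  shows "\<exists>k' h'. k' < k \<and> collapses x n k' h'"
proof -
  have h: "\<And>a b. a \<in> {1..n} \<Longrightarrow> b \<in> {1..n} \<Longrightarrow> a \<le> b \<Longrightarrow> h a \<le> h b" "h ` {1..n} = {1..k}"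
    "\<And>i. i \<in> {1..k} \<Longrightarrow> factor_block {a\<in>{1..n}. h a = i} x"
    using assms(1) unfolding collapses_def by blast+
  define g where "g l = (if l \<le> i then l else if l \<le> j then i else l - (j - i))" for l
  define k' where "k' = k - (j - i)"
  have "j - i + 2 \<le> k"
  proof -
    have "{i..j} \<noteq> {1..k}" using T unfolding proper_interval_def by auto
    then have "i \<noteq> 1 \<or> j \<noteq> k" by auto
    then show ?thesis using ij by auto
  qed
  then have k': "2 \<le> k'" "k' < k" using ij unfolding k'_def by auto
  have "collapses x n k' (g \<circ> h)"
    unfolding collapses_def
  proof (intro conjI ballI impI)
    show "2 \<le> k'" by (rule k')
    fix a b assume "a \<in> {1..n}" "b \<in> {1..n}" "a \<le> b"
    then have "h a \<le> h b" by (rule h(1))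
    then show "(g \<circ> h) a \<le> (g \<circ> h) b" unfolding g_def using ij by auto
  next
    have "g ` {1..k} = {1..k'}"
    proof
      show "g ` {1..k} \<subseteq> {1..k'}" unfolding g_def k'_def using ij by auto
      show "{1..k'} \<subseteq> g ` {1..k}"
      proof
        fix l assume l: "l \<in> {1..k'}"
        show "l \<in> g ` {1..k}"
        proof (cases "l \<le> i")
          case True
          then show ?thesis using l k' by (intro image_eqI[of _ _ l]) (auto simp: g_def)
        next
          case False
          then show ?thesis using l k' ij
            by (intro image_eqI[of _ _ "l + (j - i)"]) (auto simp: g_def k'_def)
        qed
      qed
    qed
    then show "(g \<circ> h) ` {1..n} = {1..k'}" using h(2) by (metis image_comp)
  next
    fix l assume l: "l \<in> {1..k'}"
    consider "l < i" | "l = i" | "i < l" by linarith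
    then show "factor_block {a\<in>{1..n}. (g \<circ> h) a = l} x"
    proof cases
      case 1
      then have "g b = l \<longleftrightarrow> b = l" for b unfolding g_def using ij by auto
      moreover have "l \<in> {1..k}" using l k' by auto
      ultimately show ?thesis using h(3)[of l] by simp
    next
      case 2
      then have "g b = l \<longleftrightarrow> b \<in> {i..j}" if "b \<in> {1..k}" for b unfolding g_def using ij that by auto
      moreover have "h a \<in> {1..k}" if "a \<in> {1..n}" for a using h(2) that by blast
      ultimately have "{a\<in>{1..n}. (g \<circ> h) a = l} = {a\<in>{1..n}. h a \<in> {i..j}}" by auto
      then show ?thesis using blk by simp
    next
      case 3
      then have "g b = l \<longleftrightarrow> b = l + (j - i)" for b unfolding g_def using ij by auto
      moreover have "l + (j - i) \<in> {1..k}" using l k' unfolding k'_def by auto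
      ultimately show ?thesis using h(3)[of "l + (j - i)"] by simp
    qed
  qed
  with k' show ?thesis by blast
qed

text \<open>
  Every list of words arises from one without proper interval blocks by substituting, for
  some letters, words that are blocks: take a monotone map onto \<open>{1..k}\<close>, with \<open>k \<ge> 2\<close> as small as
  possible, whose fibres are single letters or blocks. A block of the quotient would allow to
  compose it with the contraction of this block.
\<close>

lemma insertion_decomposition:
  assumes x: "concat x \<in> words_on {1..n}" and n: "2 \<le> n"
  obtains k v y p where "2 \<le> k" and "concat y \<in> words_on {1..k}" and "\<forall>i\<in>{1..k}. 1 \<le> v i"
    and "(\<Sum>i\<in>{1..k}. v i) = n" and "\<And>T. proper_interval k T \<Longrightarrow> \<not> factor_block T y"
    and "p \<in> fillings k v" and "x = subst_letters p y"
    and "\<And>i. i \<in> {1..k} \<Longrightarrow> 1 < v i \<Longrightarrow> proper_interval n (slot v i) \<and> factor_block (slot v i) x"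
proof -
  have dx: "distinct (concat x)" "set (concat x) = {1..n}" using x unfolding words_on_def by auto
  have "collapses x n n id"
    unfolding collapses_def
  proof (intro conjI ballI)
    fix i assume i: "i \<in> {1..n}"
    then have "i \<in> set (concat x)" using dx(2) by simp
    then obtain A where A: "A \<in> set x" "i \<in> set A" by auto
    then obtain u w where "A = u @ [i] @ w" by (metis append_Cons append_Nil split_list)
    moreover have "{a\<in>{1..n}. id a = i} = set [i]" using i by auto
    ultimately show "factor_block {a\<in>{1..n}. id a = i} x" unfolding factor_block_def using A by blast
  qed (use n in auto)
  then have ex: "\<exists>k. \<exists>h. collapses x n k h" by blast
  define k where "k = (LEAST k. \<exists>h. collapses x n k h)"
  obtain h where h: "collapses x n k h" using LeastI_ex[OF ex] unfolding k_def by blast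
  have least: "\<not> collapses x n k' h'" if "k' < k" for k' h'
    using not_less_Least[OF that[unfolded k_def]] by blast
  have h': "2 \<le> k" "\<And>a b. a \<in> {1..n} \<Longrightarrow> b \<in> {1..n} \<Longrightarrow> a \<le> b \<Longrightarrow> h a \<le> h b" "h ` {1..n} = {1..k}"
    "\<And>i. i \<in> {1..k} \<Longrightarrow> factor_block {a\<in>{1..n}. h a = i} x"
    using h unfolding collapses_def by blast+
  have hk: "h a \<in> {1..k}" if "a \<in> {1..n}" for a using h'(3) that by blast
  have "\<forall>i\<in>{1..k}. \<exists>B. \<exists>A\<in>set x. \<exists>u w. A = u @ B @ w \<and> set B = {a\<in>{1..n}. h a = i}"
  proof
    fix i assume "i \<in> {1..k}"
    from h'(4)[OF this] obtain A u B w where "A \<in> set x" "A = u @ B @ w" "set B = {a\<in>{1..n}. h a = i}"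
      unfolding factor_block_def by metis
    then show "\<exists>B. \<exists>A\<in>set x. \<exists>u w. A = u @ B @ w \<and> set B = {a\<in>{1..n}. h a = i}" by blast
  qed
  from bchoice[OF this]
  obtain p0 where p0: "\<forall>i\<in>{1..k}. \<exists>A\<in>set x. \<exists>u w. A = u @ p0 i @ w \<and> set (p0 i) = {a\<in>{1..n}. h a = i}"
    ..
  define p where "p = restrict p0 {1..k}"
  have p: "\<exists>A\<in>set x. \<exists>u w. A = u @ p i @ w" "set (p i) = {a\<in>{1..n}. h a = i}" if "i \<in> {1..k}" for i
    using bspec[OF p0 that] that unfolding p_def by auto
  have pne: "p i \<noteq> []" if i: "i \<in> {1..k}" for i
  proof -
    have "i \<in> h ` {1..n}" using h'(3) i by simp
    then obtain a where "a \<in> {1..n}" "h a = i" by auto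
    then have "a \<in> set (p i)" using p(2)[OF i] by simp
    then show ?thesis by auto
  qed
  have "\<exists>L. A = concat (map p L) \<and> set L = h ` set A" if A: "A \<in> set x" for A
  proof (rule word_as_concat_of_blocks)
    show "distinct A" using dx(1) A by (simp add: distinct_concat_iff)
    have An: "set A \<subseteq> {1..n}" using A dx(2) by auto
    show "h b = h a" if "a \<in> set A" "b \<in> set (p (h a))" for a b
      using p(2)[OF hk] that An by blast
    show "a \<in> set (p (h a)) \<and> (\<exists>u w. A = u @ p (h a) @ w)" if a: "a \<in> set A" for a
    proof
      have an: "a \<in> {1..n}" using An a by blast
      show ap: "a \<in> set (p (h a))" using p(2)[OF hk[OF an]] an by simp
      obtain A' u w where A': "A' \<in> set x" "A' = u @ p (h a) @ w" using p(1)[OF hk[OF an]] by blast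
      then have "a \<in> set A'" using ap by simp
      have "A' = A"
      proof (rule ccontr)
        assume "A' \<noteq> A"
        then have "set A' \<inter> set A = {}" using dx(1) A A'(1) by (simp add: distinct_concat_iff)
        then show False using a \<open>a \<in> set A'\<close> by auto
      qed
      then show "\<exists>u w. A = u @ p (h a) @ w" using A' by blast
    qed
  qed
  then obtain L where L: "\<And>A. A \<in> set x \<Longrightarrow> A = concat (map p (L A)) \<and> set (L A) = h ` set A" by metis
  define y where "y = map L x"
  have xy: "x = subst_letters p y"
    unfolding subst_letters_def y_def map_map comp_def using L by (simp add: map_idI)
  have sy: "set (concat y) = {1..k}"
  proof -
    have "set (concat y) = (\<Union>A\<in>set x. h ` set A)" unfolding y_def using L by auto
    also have "\<dots> = h ` set (concat x)" by auto
    finally show ?thesis using dx(2) h'(3) by simp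
  qed
  have cxy: "concat x = concat (map p (concat y))"
    unfolding xy subst_letters_def by (induction y) auto
  have "distinct (concat y)"
  proof (rule distinct_of_distinct_concat_map)
    show "distinct (concat (map p (concat y)))" using dx(1) cxy by metis
    show "p l \<noteq> []" if "l \<in> set (concat y)" for l using pne that unfolding sy .
  qed
  with sy have yk: "concat y \<in> words_on {1..k}" unfolding words_on_def by simp
  \<comment> \<open>The fibres of a monotone map are the slots for their cardinalities.\<close>
  define v where "v i = card {a\<in>{1..n}. h a = i}" for i
  have low: "{a\<in>{1..n}. h a \<le> i} = {1..\<Sum>j\<in>{1..i}. v j}" for i
  proof -
    have "{a\<in>{1..n}. h a \<le> i} = {1..card {a\<in>{1..n}. h a \<le> i}}"
    proof (rule downset_eq_atLeastAtMost)
      fix a b assume ab: "a \<in> {a\<in>{1..n}. h a \<le> i}" "1 \<le> b" "b \<le> a"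
      then have "h b \<le> h a" by (intro h'(2)) auto
      then show "b \<in> {a\<in>{1..n}. h a \<le> i}" using ab by auto
    qed auto
    also have "card {a\<in>{1..n}. h a \<le> i} = card (\<Union>j\<in>{1..i}. {a\<in>{1..n}. h a = j})"
      by (rule arg_cong[of _ _ card]) (use hk in fastforce)
    also have "\<dots> = (\<Sum>j\<in>{1..i}. v j)"
      unfolding v_def by (rule card_UN_disjoint) auto
    finally show ?thesis .
  qed
  have slot: "slot v i = {a\<in>{1..n}. h a = i}" if i: "i \<in> {1..k}" for i
  proof -
    obtain i' where i': "i = Suc i'" using i by (cases i) auto
    have "{a\<in>{1..n}. h a = i} = {a\<in>{1..n}. h a \<le> i} - {a\<in>{1..n}. h a \<le> i'}" using i' by auto
    also have "\<dots> = {1..offset v i + v i} - {1..offset v i}"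
      unfolding low i' offset_Suc_eq_sum by simp
    also have "\<dots> = slot v i" unfolding slot_def by auto
    finally show ?thesis ..
  qed
  have vpos: "\<forall>i\<in>{1..k}. 1 \<le> v i"
  proof
    fix i assume i: "i \<in> {1..k}"
    have "set (p i) \<noteq> {}" using pne[OF i] by simp
    then have "{a\<in>{1..n}. h a = i} \<noteq> {}" using p(2)[OF i] by simp
    then show "1 \<le> v i" unfolding v_def by (simp add: Suc_le_eq card_gt_0_iff)
  qed
  have vsum: "(\<Sum>i\<in>{1..k}. v i) = n"
  proof -
    have "{a\<in>{1..n}. h a \<le> k} = {1..n}" using hk by auto
    with low[of k] have "{1..\<Sum>i\<in>{1..k}. v i} = {1..n}" by simp
    from arg_cong[OF this, of card] show ?thesis by simp
  qed
  have pfill: "p \<in> fillings k v"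
  proof -
    have "distinct (p i)" if i: "i \<in> {1..k}" for i
    proof -
      obtain A u w where "A \<in> set x" "A = u @ p i @ w" using p(1)[OF i] by blast
      moreover have "distinct A" using dx(1) \<open>A \<in> set x\<close> by (simp add: distinct_concat_iff)
      ultimately show ?thesis by simp
    qed
    then show ?thesis using p(2) slot unfolding words_on_def p_def by (auto simp: PiE_iff)
  qed
  have noblk: "\<not> factor_block T y" if T: "proper_interval k T" for T
  proof
    assume blk: "factor_block T y"
    obtain i j where ij: "1 \<le> i" "i < j" "j \<le> k" "T = {i..j}" using T unfolding proper_interval_def by auto
    obtain A u B w where A: "A \<in> set y" "A = u @ B @ w" "set B = T"
      using blk unfolding factor_block_def by blast
    have "concat (map p A) \<in> set x" using A(1) unfolding xy subst_letters_def by simp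
    moreover have "concat (map p A) = concat (map p u) @ concat (map p B) @ concat (map p w)"
      using A(2) by simp
    moreover have "set (concat (map p B)) = {a\<in>{1..n}. h a \<in> {i..j}}"
    proof -
      have "set (concat (map p B)) = (\<Union>l\<in>T. set (p l))" using A(3) by auto
      also have "\<dots> = (\<Union>l\<in>T. {a\<in>{1..n}. h a = l})" using p(2) ij by auto
      finally show ?thesis using ij by auto
    qed
    ultimately have "factor_block {a\<in>{1..n}. h a \<in> {i..j}} x" unfolding factor_block_def by blast
    from collapses_compose[OF h T[unfolded ij(4)] this ij(1-3)] least show False by blast
  qed
  have slot_block: "proper_interval n (slot v i) \<and> factor_block (slot v i) x" if i: "i \<in> {1..k}" "1 < v i" for i
  proof
    show "factor_block (slot v i) x" using slot[OF i(1)] h'(4)[OF i(1)] by simp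
    have sub: "slot v i \<subseteq> {1..n}" using slot[OF i(1)] by auto
    define l where "l = (if i = 1 then 2 else 1 :: nat)"
    have "l \<in> {1..k}" "l \<noteq> i" using h'(1) unfolding l_def by auto
    then have "l \<in> h ` {1..n}" using h'(3) by simp
    then obtain a where "a \<in> {1..n}" "h a = l" by auto
    then have "a \<notin> slot v i" "a \<in> {1..n}" using slot[OF i(1)] \<open>l \<noteq> i\<close> by auto
    then have "slot v i \<noteq> {1..n}" by metis
    moreover have "offset v i + v i \<le> n" using sub i(2) unfolding slot_def by auto
    ultimately show "proper_interval n (slot v i)"
      using i unfolding proper_interval_def slot_def
      by (intro exI[of _ "offset v i + 1"] exI[of _ "offset v i + v i"]) auto
  qed
  show ?thesis
    by (rule that[OF h'(1) yk vpos vsum noblk pfill xy slot_block])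
qed

section \<open>Convergent families of coefficients\<close>

text \<open>
  In each context \<open>Xs, u, w, Ys\<close> the coefficients define a combination of words on \<open>T\<close>. Convergence along
  \<open>T\<close> requires that it lie in the span of the shuffles, that is, that it be killed by every functional
  that kills shuffles.
\<close>

definition converges_along :: "nat set \<Rightarrow> nat list list lc \<Rightarrow> bool" where
  "converges_along T c \<longleftrightarrow> (\<forall>f Xs u w Ys. kills_shuffles T f \<longrightarrow>
     (\<Sum>B\<in>words_on T. coeff c (Xs @ (u @ B @ w) # Ys) * f B) = 0)"

definition convergent_family :: "nat \<Rightarrow> nat list list lc \<Rightarrow> bool" where
  "convergent_family n c \<longleftrightarrow> (\<forall>T. proper_interval n T \<longrightarrow> converges_along T c)"

definition word_converges_along :: "nat set \<Rightarrow> nat list lc \<Rightarrow> bool" where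
  "word_converges_along T x \<longleftrightarrow> (\<forall>f u w. kills_shuffles T f \<longrightarrow>
     (\<Sum>B\<in>words_on T. coeff x (u @ B @ w) * f B) = 0)"

text \<open>
  If \<open>D\<close> is an interval with at least two letters, then the test along \<open>D\<close> itself is included, which
  makes these elements combinations of shuffles.
\<close>

definition convergent_shuffles :: "nat set \<Rightarrow> nat list lc set" where
  "convergent_shuffles D = {x. supp x \<subseteq> words_on D \<and>
     (\<forall>i j. i < j \<longrightarrow> {i..j} \<subseteq> D \<longrightarrow> word_converges_along {i..j} x)}"

lemma subspace_convergent_family: "lc.subspace {c. convergent_family n c}"
  unfolding lc.subspace_def convergent_family_def converges_along_def
  by (auto simp: lookup_add distrib_right sum.distrib mult.assoc simp flip: sum_distrib_left)

lemma subspace_convergent_shuffles: "lc.subspace (convergent_shuffles D)"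
proof -
  have "lc.subspace {x. supp x \<subseteq> words_on D}"
    using lc.subspace_span[of "bvec ` words_on D"] unfolding free_on_def[symmetric]
    by (simp only: set_eqI[of "free_on (words_on D)" "{x. supp x \<subseteq> words_on D}"] free_on_iff mem_Collect_eq)
  moreover have "lc.subspace {x. \<forall>i j. i < j \<longrightarrow> {i..j} \<subseteq> D \<longrightarrow> word_converges_along {i..j} x}"
    unfolding lc.subspace_def word_converges_along_def
    by (auto simp: lookup_add distrib_right sum.distrib mult.assoc simp flip: sum_distrib_left)
  ultimately have "lc.subspace ({x. supp x \<subseteq> words_on D} \<inter>
      {x. \<forall>i j. i < j \<longrightarrow> {i..j} \<subseteq> D \<longrightarrow> word_converges_along {i..j} x})"
    by (rule lc.subspace_inter)
  then show ?thesis unfolding convergent_shuffles_def by (simp only: Collect_conj_eq)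
qed

text \<open>
  The extension of the substitution of words to combinations of words, multilinear in the slots.
\<close>

definition insert_lc :: "nat \<Rightarrow> (nat \<Rightarrow> nat) \<Rightarrow> nat list list \<Rightarrow> (nat \<Rightarrow> nat list lc) \<Rightarrow> nat list list lc" where
  "insert_lc k v y \<sigma> = (\<Sum>p\<in>fillings k v.
     lc_scale (\<Prod>i\<in>{1..k}. coeff (\<sigma> i) (p i)) (bvec (subst_letters p y)))"

lemma concat_subst_letters: "concat (subst_letters p y) = concat (map p (concat y))"
  unfolding subst_letters_def by (induction y) auto

lemma subst_letters_inj:
  assumes y: "concat y \<in> words_on {1..k}"
  shows "inj_on (\<lambda>p. subst_letters p y) (fillings k v)"
proof (rule inj_onI)
  fix p q assume p: "p \<in> fillings k v" and q: "q \<in> fillings k v"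
    and eq: "subst_letters p y = subst_letters q y"
  have sy: "set (concat y) = {1..k}" using y unfolding words_on_def by simp
  have len: "length (p i) = length (q i)" if "i \<in> {1..k}" for i
    using fillings_set[OF p that] fillings_set[OF q that] by (metis distinct_card)
  have "map p (concat y) = map q (concat y)"
  proof (rule concat_injective)
    show "concat (map p (concat y)) = concat (map q (concat y))"
      using eq by (simp only: concat_subst_letters[symmetric])
    show "length (map p (concat y)) = length (map q (concat y))" by simp
    show "\<forall>(x, y)\<in>set (zip (map p (concat y)) (map q (concat y))). length x = length y"
    proof clarify
      fix A B assume "(A, B) \<in> set (zip (map p (concat y)) (map q (concat y)))"
      then obtain j where "j < length (concat y)" "A = p (concat y ! j)" "B = q (concat y ! j)"
        by (auto simp: set_zip)
      moreover have "concat y ! j \<in> {1..k}" if "j < length (concat y)" for j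
        using nth_mem[OF that] unfolding sy .
      ultimately show "length A = length B" using len by metis
    qed
  qed
  then have "p i = q i" if "i \<in> {1..k}" for i using that sy by (metis map_eq_conv)
  then show "p = q" using p q by (intro PiE_ext) auto
qed

lemma coeff_insert_lc:
  assumes y: "concat y \<in> words_on {1..k}" and p: "p \<in> fillings k v"
  shows "coeff (insert_lc k v y \<sigma>) (subst_letters p y) = (\<Prod>i\<in>{1..k}. coeff (\<sigma> i) (p i))"
proof -
  have "coeff (insert_lc k v y \<sigma>) (subst_letters p y) =
      (\<Sum>q\<in>fillings k v. if q = p then (\<Prod>i\<in>{1..k}. coeff (\<sigma> i) (q i)) else 0)"
    unfolding insert_lc_def coeff_sum
    by (intro sum.cong refl) (use inj_onD[OF subst_letters_inj[OF y] _ _ p] in \<open>auto simp: coeff_bvec\<close>)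
  then show ?thesis using p by (simp only: sum.delta[OF finite_fillings] if_True)
qed

lemma coeff_insert_lc_0:
  assumes "x \<notin> (\<lambda>p. subst_letters p y) ` fillings k v"
  shows "coeff (insert_lc k v y \<sigma>) x = 0"
  unfolding insert_lc_def coeff_sum using assms by (intro sum.neutral) (auto simp: coeff_bvec)

text \<open>
  The two halves of the description of convergent families rest on the same observation: in a
  context that admits some \<open>subst_letters p y\<close>, a proper interval \<open>T\<close> is contained in
  one slot, and all words on \<open>T\<close> may be put in its place.
\<close>

lemma context_of_filling:
  assumes y: "insertion_scheme n k v y" and T: "proper_interval n T"
    and p: "p \<in> fillings k v" and x: "subst_letters p y = Xs @ (u @ B @ w) # Ys" and B: "B \<in> words_on T"
  obtains i u' w' where "i \<in> {1..k}" and "T \<subseteq> slot v i"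
    and "\<And>B'. B' \<in> words_on T \<Longrightarrow> p(i := u' @ B' @ w') \<in> fillings k v"
    and "\<And>B'. subst_letters (p(i := u' @ B' @ w')) y = Xs @ (u @ B' @ w) # Ys"
proof -
  have sB: "set B = T" "distinct B" using B unfolding words_on_def by auto
  obtain a b where "T = {a..b}" "a < b" using T unfolding proper_interval_def by blast
  then have "a \<in> set B" using sB(1) by simp
  then have Bne: "B \<noteq> []" by auto
  obtain i where i: "i \<in> {1..k}" "T \<subseteq> slot v i" by (rule block_in_slot[OF y p T x sB(1)])
  have yk: "concat y \<in> words_on {1..k}" using y unfolding insertion_scheme_def by simp
  obtain u' w' where uw: "p i = u' @ B @ w'"
    "\<And>B'. subst_letters (p(i := u' @ B' @ w')) y = Xs @ (u @ B' @ w) # Ys"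
    by (rule rearrange_in_slot[OF yk p i(1) x]) (use sB i Bne in auto)
  have "p(i := u' @ B' @ w') \<in> fillings k v" if "B' \<in> words_on T" for B'
  proof -
    have "u' @ B @ w' \<in> words_on (slot v i)" using PiE_mem[OF p i(1)] uw(1) by simp
    then have "u' @ B' @ w' \<in> words_on (slot v i)"
      using that sB unfolding words_on_def by auto
    then show ?thesis using p i(1) by (auto simp: PiE_iff extensional_def)
  qed
  from that[OF i this uw(2)] show ?thesis by blast
qed

text \<open>
  By \<open>context_of_filling\<close> only one slot varies in each test, and there the inserted element converges.
\<close>

lemma insert_lc_convergent:
  assumes y: "insertion_scheme n k v y"
    and \<sigma>: "\<And>i. i \<in> {1..k} \<Longrightarrow> \<sigma> i \<in> convergent_shuffles (slot v i)"
  shows "convergent_family n (insert_lc k v y \<sigma>)"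
  unfolding convergent_family_def converges_along_def
proof (intro allI impI)
  fix T f Xs u w Ys assume T: "proper_interval n T" and f: "kills_shuffles T f"
  have yk: "concat y \<in> words_on {1..k}" using y unfolding insertion_scheme_def by simp
  let ?c = "coeff (insert_lc k v y \<sigma>)"
  show "(\<Sum>B\<in>words_on T. ?c (Xs @ (u @ B @ w) # Ys) * f B) = 0"
  proof (cases "\<exists>p\<in>fillings k v. \<exists>B\<in>words_on T. subst_letters p y = Xs @ (u @ B @ w) # Ys")
    case False
    have "?c (Xs @ (u @ B @ w) # Ys) = 0" if B: "B \<in> words_on T" for B
    proof (rule coeff_insert_lc_0, rule notI)
      assume "Xs @ (u @ B @ w) # Ys \<in> (\<lambda>p. subst_letters p y) ` fillings k v"
      then obtain p where "Xs @ (u @ B @ w) # Ys = subst_letters p y" "p \<in> fillings k v" by (rule imageE)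
      with False B show False by metis
    qed
    then show ?thesis by simp
  next
    case True
    then obtain p B where p: "p \<in> fillings k v" "B \<in> words_on T" "subst_letters p y = Xs @ (u @ B @ w) # Ys"
      by blast
    obtain i u' w' where i: "i \<in> {1..k}" "T \<subseteq> slot v i"
      "\<And>B'. B' \<in> words_on T \<Longrightarrow> p(i := u' @ B' @ w') \<in> fillings k v"
      "\<And>B'. subst_letters (p(i := u' @ B' @ w')) y = Xs @ (u @ B' @ w) # Ys"
      using context_of_filling[OF y T p(1,3,2)] by blast
    let ?r = "\<Prod>l\<in>{1..k} - {i}. coeff (\<sigma> l) (p l)"
    have c: "?c (Xs @ (u @ B @ w) # Ys) = ?r * coeff (\<sigma> i) (u' @ B @ w')" if B: "B \<in> words_on T" for B
    proof -
      have "?c (Xs @ (u @ B @ w) # Ys) = (\<Prod>l\<in>{1..k}. coeff (\<sigma> l) ((p(i := u' @ B @ w')) l))"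
        unfolding i(4)[symmetric] by (rule coeff_insert_lc[OF yk i(3)[OF B]])
      also have "\<dots> = coeff (\<sigma> i) (u' @ B @ w') * (\<Prod>l\<in>{1..k} - {i}. coeff (\<sigma> l) ((p(i := u' @ B @ w')) l))"
        by (subst prod.remove[of _ i]) (use i(1) in auto)
      also have "(\<Prod>l\<in>{1..k} - {i}. coeff (\<sigma> l) ((p(i := u' @ B @ w')) l)) = ?r"
        by (rule prod.cong) auto
      finally show ?thesis by simp
    qed
    obtain a b where ab: "T = {a..b}" "a < b" using T unfolding proper_interval_def by auto
    have "word_converges_along T (\<sigma> i)"
      using \<sigma>[OF i(1)] ab i(2) unfolding convergent_shuffles_def by auto
    then have "(\<Sum>B\<in>words_on T. coeff (\<sigma> i) (u' @ B @ w') * f B) = 0"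
      using f unfolding word_converges_along_def by blast
    moreover have "(\<Sum>B\<in>words_on T. ?c (Xs @ (u @ B @ w) # Ys) * f B) =
        ?r * (\<Sum>B\<in>words_on T. coeff (\<sigma> i) (u' @ B @ w') * f B)"
      unfolding sum_distrib_left by (intro sum.cong refl) (simp add: c mult.assoc)
    ultimately show ?thesis by simp
  qed
qed

definition restrict_lc :: "'b set \<Rightarrow> 'b lc \<Rightarrow> 'b lc" where
  "restrict_lc X c = (\<Sum>b\<in>supp c \<inter> X. lc_scale (coeff c b) (bvec b))"

lemma coeff_restrict_lc: "coeff (restrict_lc X c) b = (if b \<in> X then coeff c b else 0)"
  unfolding restrict_lc_def by (subst coeff_sum_scale_bvec) (auto simp: in_keys_iff)

lemma multilinear_insert_lc: "multilinear_on {1..k} (insert_lc k v y)"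
  unfolding multilinear_on_def
proof (intro conjI allI impI ballI)
  fix \<sigma> \<tau> :: "nat \<Rightarrow> nat list lc" assume "\<forall>i\<in>{1..k}. \<sigma> i = \<tau> i"
  then show "insert_lc k v y \<sigma> = insert_lc k v y \<tau>"
    unfolding insert_lc_def by (intro sum.cong refl arg_cong2[of _ _ _ _ lc_scale] prod.cong) simp_all
next
  fix \<sigma> :: "nat \<Rightarrow> nat list lc" and i assume i: "i \<in> {1..k}"
  have split: "(\<Prod>l\<in>{1..k}. coeff ((\<sigma>(i := x)) l) (p l)) = coeff x (p i) * (\<Prod>l\<in>{1..k} - {i}. coeff (\<sigma> l) (p l))"
    for x p
    by (subst prod.remove[of _ i]) (use i in \<open>auto intro!: prod.cong\<close>)
  show "lin (\<lambda>x. insert_lc k v y (\<sigma>(i := x)))"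
    by (rule linI; unfold insert_lc_def split)
      (simp_all add: lookup_add distrib_right sum.distrib lc.scale_left_distrib lc.scale_sum_right mult.assoc)
qed

lemma insert_lc_bvec:
  assumes p: "p \<in> fillings k v"
  shows "insert_lc k v y (\<lambda>i. bvec (p i)) = bvec (subst_letters p y)"
proof -
  have "insert_lc k v y (\<lambda>i. bvec (p i)) =
      (\<Sum>q\<in>fillings k v. if q = p then bvec (subst_letters q y) else 0)"
    unfolding insert_lc_def
  proof (intro sum.cong refl)
    fix q assume q: "q \<in> fillings k v"
    show "lc_scale (\<Prod>i\<in>{1..k}. coeff (bvec (p i)) (q i)) (bvec (subst_letters q y)) =
      (if q = p then bvec (subst_letters q y) else 0)"
    proof (cases "q = p")
      case False
      then obtain i where "i \<in> {1..k}" "p i \<noteq> q i" using PiE_ext[OF p q] by metis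
      then have "(\<Prod>i\<in>{1..k}. coeff (bvec (p i)) (q i)) = 0"
        by (intro prod_zero) (auto simp: coeff_bvec)
      then show ?thesis using False by simp
    qed (simp add: coeff_bvec)
  qed
  then show ?thesis using p by (simp only: sum.delta[OF finite_fillings] if_True)
qed

text \<open>
  In a given context the words on \<open>T\<close> lead either all or none of them to fillings of the scheme.
\<close>

lemma convergent_family_restrict:
  assumes c: "convergent_family n c" and y: "insertion_scheme n k v y"
  shows "convergent_family n (restrict_lc ((\<lambda>p. subst_letters p y) ` fillings k v) c)"
    (is "convergent_family n (restrict_lc ?Y c)")
  unfolding convergent_family_def converges_along_def
proof (intro allI impI)
  fix T f Xs u w Ys assume T: "proper_interval n T" and f: "kills_shuffles T f"
  show "(\<Sum>B\<in>words_on T. coeff (restrict_lc ?Y c) (Xs @ (u @ B @ w) # Ys) * f B) = 0"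
  proof (cases "\<exists>p\<in>fillings k v. \<exists>B\<in>words_on T. subst_letters p y = Xs @ (u @ B @ w) # Ys")
    case False
    then have "coeff (restrict_lc ?Y c) (Xs @ (u @ B @ w) # Ys) = 0" if B: "B \<in> words_on T" for B
    proof -
      have "Xs @ (u @ B @ w) # Ys \<notin> ?Y"
      proof
        assume "Xs @ (u @ B @ w) # Ys \<in> ?Y"
        then obtain p where "Xs @ (u @ B @ w) # Ys = subst_letters p y" "p \<in> fillings k v" by (rule imageE)
        with False B show False by metis
      qed
      then show ?thesis by (simp only: coeff_restrict_lc if_False)
    qed
    then show ?thesis by simp
  next
    case True
    then obtain p B where p: "p \<in> fillings k v" "B \<in> words_on T" "subst_letters p y = Xs @ (u @ B @ w) # Ys"
      by blast
    obtain i u' w' where i: "i \<in> {1..k}" "T \<subseteq> slot v i"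
      "\<And>B'. B' \<in> words_on T \<Longrightarrow> p(i := u' @ B' @ w') \<in> fillings k v"
      "\<And>B'. subst_letters (p(i := u' @ B' @ w')) y = Xs @ (u @ B' @ w) # Ys"
      using context_of_filling[OF y T p(1,3,2)] by blast
    have "Xs @ (u @ B @ w) # Ys \<in> ?Y" if "B \<in> words_on T" for B
      using imageI[OF i(3)[OF that], of "\<lambda>p. subst_letters p y"] unfolding i(4) .
    then have "(\<Sum>B\<in>words_on T. coeff (restrict_lc ?Y c) (Xs @ (u @ B @ w) # Ys) * f B) =
        (\<Sum>B\<in>words_on T. coeff c (Xs @ (u @ B @ w) # Ys) * f B)"
      by (intro sum.cong refl) (simp only: coeff_restrict_lc if_True)
    then show ?thesis using c T f unfolding convergent_family_def converges_along_def by simp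
  qed
qed

lemma slot_subset: "insertion_scheme n k v y \<Longrightarrow> i \<in> {1..k} \<Longrightarrow> slot v i \<subseteq> {1..n}"
  using slot_UN[of v k] unfolding insertion_scheme_def by blast

lemma interval_in_slot_proper:
  assumes y: "insertion_scheme n k v y" and i: "i \<in> {1..k}" and ab: "a < b" "{a..b} \<subseteq> slot v i"
  shows "proper_interval n {a..b}"
proof -
  have k: "2 \<le> k" "\<forall>i\<in>{1..k}. 1 \<le> v i" using y unfolding insertion_scheme_def by auto
  have "{a..b} \<subseteq> {1..n}" using slot_subset[OF y i] ab(2) by blast
  moreover have "{a..b} \<noteq> {1..n}"
  proof -
    define l where "l = (if i = 1 then 2 else 1 :: nat)"
    have l: "l \<in> {1..k}" "l \<noteq> i" using k(1) unfolding l_def by auto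
    obtain c where c: "c \<in> slot v l" using slot_nonempty[of v l] k(2) l(1) by auto
    have "c \<notin> {a..b}" using slot_disjoint[of i l c v] i l c ab(2) by auto
    moreover have "c \<in> {1..n}" using slot_subset[OF y l(1)] c by blast
    ultimately show ?thesis by metis
  qed
  ultimately show ?thesis unfolding proper_interval_def using ab(1) by auto
qed

text \<open>
  An interval inside one slot is proper in \<open>{1..n}\<close>, since there are other slots, so that the tests for
  the slice are among the tests for \<open>c\<close>.
\<close>

lemma slot_slice_convergent:
  assumes c: "convergent_family n c" and y: "insertion_scheme n k v y"
    and i: "i \<in> {1..k}" and p: "p \<in> fillings k v"
  shows "(\<Sum>b\<in>words_on (slot v i). lc_scale (coeff c (subst_letters (p(i := b)) y)) (bvec b))
           \<in> convergent_shuffles (slot v i)" (is "?z \<in> _")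
proof -
  have co: "coeff ?z b = (if b \<in> words_on (slot v i) then coeff c (subst_letters (p(i := b)) y) else 0)" for b
    by (rule coeff_sum_scale_bvec) simp
  show ?thesis
    unfolding convergent_shuffles_def word_converges_along_def
  proof (intro CollectI conjI allI impI)
    show "supp ?z \<subseteq> words_on (slot v i)"
      by (auto simp: in_keys_iff co split: if_splits)
    fix a b f u w assume ab: "a < b" "{a..b} \<subseteq> slot v i" and f: "kills_shuffles {a..b} f"
    let ?T = "{a..b}"
    show "(\<Sum>B\<in>words_on ?T. coeff ?z (u @ B @ w) * f B) = 0"
    proof (cases "\<exists>B\<in>words_on ?T. u @ B @ w \<in> words_on (slot v i)")
      case False
      then show ?thesis by (intro sum.neutral) (simp add: co)
    next
      case True
      then obtain B0 where B0: "B0 \<in> words_on ?T" "u @ B0 @ w \<in> words_on (slot v i)" by blast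
      have all: "u @ B @ w \<in> words_on (slot v i)" if "B \<in> words_on ?T" for B
        using B0 that unfolding words_on_def by auto
      have yk: "concat y \<in> words_on {1..k}" using y unfolding insertion_scheme_def by simp
      have "i \<in> set (concat y)" using yk i unfolding words_on_def by simp
      then obtain A where A: "A \<in> set y" "i \<in> set A" by auto
      let ?p = "p(i := u @ B0 @ w)"
      have p': "?p \<in> fillings k v" using p i B0(2) by (auto simp: PiE_iff extensional_def)
      obtain ys zs where ys: "y = ys @ A # zs" using A(1) by (meson split_list)
      obtain A1 A2 where A12: "A = A1 @ i # A2" using A(2) by (meson split_list)
      define Xs Ys where "Xs = subst_letters ?p ys" and "Ys = subst_letters ?p zs"
      define u' w' where "u' = concat (map ?p A1) @ u" and "w' = w @ concat (map ?p A2)"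
      have x: "subst_letters ?p y = Xs @ (u' @ B0 @ w') # Ys"
        unfolding ys A12 Xs_def Ys_def u'_def w'_def subst_letters_def by simp
      have ctx: "subst_letters (p(i := u @ B @ w)) y = Xs @ (u' @ B @ w') # Ys" for B
      proof -
        have n: "i \<notin> set (concat ys)" "i \<notin> set (concat zs)" "i \<notin> set A1" "i \<notin> set A2"
          using yk ys A12 unfolding words_on_def by auto
        let ?q = "p(i := u @ B @ w)"
        have "map ?q L = map ?p L" if "i \<notin> set L" for L using that by auto
        then have e: "concat (map ?q L) = concat (map ?p L)" if "i \<notin> set L" for L using that by metis
        have "subst_letters ?q ys = Xs" "subst_letters ?q zs = Ys"
          unfolding Xs_def Ys_def subst_letters_def using n(1,2) by (intro map_cong refl e; auto)+
        moreover have "concat (map ?q A) = u' @ B @ w'"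
          using e[OF n(3)] e[OF n(4)] unfolding A12 u'_def w'_def by simp
        ultimately show ?thesis unfolding ys subst_letters_def by simp
      qed
      have "(\<Sum>B\<in>words_on ?T. coeff ?z (u @ B @ w) * f B) =
          (\<Sum>B\<in>words_on ?T. coeff c (Xs @ (u' @ B @ w') # Ys) * f B)"
        by (intro sum.cong refl) (simp only: co all if_True ctx)
      also have "\<dots> = 0"
        using c interval_in_slot_proper[OF y i ab] f
        unfolding convergent_family_def converges_along_def by blast
      finally show ?thesis .
    qed
  qed
qed

text \<open>
  The convergent families are spanned by insertions, provided that every list of words on which
  such a family does not vanish comes from an insertion scheme: remove the part supported on the
  fillings of one scheme after the other. Such a part is a convergent family whose slices are
  convergent in each slot.
\<close>

lemma convergent_family_span:
  assumes scheme: "\<And>c x. convergent_family n c \<Longrightarrow> supp c \<subseteq> X \<Longrightarrow> x \<in> supp c \<Longrightarrow>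
      \<exists>k v y p. insertion_scheme n k v y \<and> adm k v y \<and> p \<in> fillings k v \<and> x = subst_letters p y"
    and gen: "\<And>k v y i. insertion_scheme n k v y \<Longrightarrow> adm k v y \<Longrightarrow> i \<in> {1..k} \<Longrightarrow>
      convergent_shuffles (slot v i) \<subseteq> lc.span (gen v i)"
    and c: "convergent_family n c" "supp c \<subseteq> X"
  shows "c \<in> lc.span {insert_lc k v y \<sigma> | k v y \<sigma>.
      insertion_scheme n k v y \<and> adm k v y \<and> (\<forall>i\<in>{1..k}. \<sigma> i \<in> gen v i)}" (is "c \<in> lc.span ?G")
  using c
proof (induction "card (supp c)" arbitrary: c rule: less_induct)
  case less
  show ?case
  proof (cases "supp c = {}")
    case True
    then have "c = 0" by simp
    then show ?thesis by (simp add: lc.span_zero)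
  next
    case False
    then obtain x where x: "x \<in> supp c" by (metis all_not_in_conv)
    obtain k v y p0 where y: "insertion_scheme n k v y" "adm k v y" and p0: "p0 \<in> fillings k v" "x = subst_letters p0 y"
      using scheme[OF less.prems x] by blast
    let ?Y = "(\<lambda>p. subst_letters p y) ` fillings k v"
    define c1 where "c1 = restrict_lc ?Y c"
    have c1: "convergent_family n c1" unfolding c1_def by (rule convergent_family_restrict[OF less.prems(1) y(1)])
    have co: "coeff c1 b = (if b \<in> ?Y then coeff c b else 0)" for b unfolding c1_def by (rule coeff_restrict_lc)
    have diff: "c - c1 \<in> lc.span ?G"
    proof (rule less.hyps)
      have sub: "supp (c - c1) \<subseteq> supp c"
        by (auto simp: in_keys_iff lookup_minus co split: if_splits)
      then show "supp (c - c1) \<subseteq> X" using less.prems(2) by blast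
      have "x \<notin> supp (c - c1)" using p0 by (simp add: in_keys_iff lookup_minus co)
      then show "card (supp (c - c1)) < card (supp c)"
        using sub x by (intro psubset_card_mono) auto
      show "convergent_family n (c - c1)"
        using lc.subspace_diff[OF subspace_convergent_family] less.prems(1) c1 by blast
    qed
    have yk: "concat y \<in> words_on {1..k}" using y unfolding insertion_scheme_def by simp
    have "c1 = (\<Sum>x\<in>?Y. lc_scale (coeff c1 x) (bvec x))"
      by (rule lc_expand[OF finite_imageI[OF finite_fillings]]) (auto simp: in_keys_iff co split: if_splits)
    also have "\<dots> = (\<Sum>p\<in>fillings k v. lc_scale (coeff c1 (subst_letters p y)) (bvec (subst_letters p y)))"
      by (subst sum.reindex[OF subst_letters_inj[OF yk]]) simp
    also have "\<dots> = (\<Sum>p\<in>fillings k v. lc_scale (coeff c1 (subst_letters p y)) (insert_lc k v y (\<lambda>i. bvec (p i))))"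
      by (intro sum.cong refl) (simp add: insert_lc_bvec)
    also have "\<dots> \<in> lc.span {insert_lc k v y \<tau> | \<tau>. \<forall>i\<in>{1..k}. \<tau> i \<in> gen v i}"
    proof (rule tensor_of_slices[OF _ multilinear_insert_lc])
      fix i p assume i: "i \<in> {1..k}" and p: "p \<in> fillings k v"
      show "(\<Sum>b\<in>words_on (slot v i). lc_scale (coeff c1 (subst_letters (p(i := b)) y)) (bvec b)) \<in> lc.span (gen v i)"
        using slot_slice_convergent[OF c1 y(1) i p] gen[OF y i] by blast
    qed simp_all
    also have "\<dots> \<subseteq> lc.span ?G" by (rule lc.span_mono) (use y in blast)
    finally have "c1 \<in> lc.span ?G" .
    from lc.span_add[OF diff this] show ?thesis by simp
  qed
qed

section \<open>Lyndon shuffles form a basis\<close>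

text \<open>
  The letters of the factors are distinct, so that the words in the shuffle are those whose restriction
  to the letters of each factor is that factor.
\<close>

definition interleaves :: "'a list list \<Rightarrow> 'a list \<Rightarrow> bool" where
  "interleaves xs w \<longleftrightarrow> w \<in> words_on (set (concat xs)) \<and> (\<forall>A\<in>set xs. filter (\<lambda>a. a \<in> set A) w = A)"

definition factor_shuffle :: "'a list list \<Rightarrow> 'a list lc" where
  "factor_shuffle xs = shuffle_list (map bvec xs)"

lemma finite_interleaves [simp]: "finite {w. interleaves xs w}"
  by (rule finite_subset[of _ "words_on (set (concat xs))"]) (auto simp: interleaves_def)

lemma interleaves_Cons:
  assumes "distinct (concat (A # xs))"
  shows "interleaves (A # xs) z \<longleftrightarrow> (\<exists>w. interleaves xs w \<and> z \<in> shuffles A w)"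
proof -
  let ?C = "set (concat xs)"
  have d: "set A \<inter> ?C = {}" "distinct A" using assms by auto
  have sub: "set B \<subseteq> ?C" if "B \<in> set xs" for B using that by auto
  show ?thesis
  proof
    assume z: "interleaves (A # xs) z"
    define w where "w = filter (\<lambda>a. a \<in> ?C) z"
    have z': "distinct z" "set z = set A \<union> ?C" "filter (\<lambda>a. a \<in> set A) z = A"
      "\<And>B. B \<in> set xs \<Longrightarrow> filter (\<lambda>a. a \<in> set B) z = B"
      using z unfolding interleaves_def words_on_def by auto
    have sw: "set w = ?C" unfolding w_def set_filter z'(2) by blast
    have "filter (\<lambda>a. a \<in> set B) w = B" if B: "B \<in> set xs" for B
    proof -
      have "filter (\<lambda>a. a \<in> set B) w = filter (\<lambda>a. a \<in> set B) z"
        unfolding w_def filter_filter using sub[OF B] by (intro filter_cong refl) auto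
      then show ?thesis using z'(4)[OF B] by simp
    qed
    moreover have "distinct w" using z'(1) unfolding w_def by simp
    ultimately have "interleaves xs w" unfolding interleaves_def words_on_def using sw by simp
    moreover have "z \<in> shuffles A w"
      unfolding mem_shuffles_iff_filter[OF d(1)[folded sw]] using z'(2,3) w_def sw by simp
    ultimately show "\<exists>w. interleaves xs w \<and> z \<in> shuffles A w" by blast
  next
    assume "\<exists>w. interleaves xs w \<and> z \<in> shuffles A w"
    then obtain w where w: "interleaves xs w" "z \<in> shuffles A w" by blast
    have w': "distinct w" "set w = ?C" "\<And>B. B \<in> set xs \<Longrightarrow> filter (\<lambda>a. a \<in> set B) w = B"
      using w(1) unfolding interleaves_def words_on_def by auto
    have z: "set z \<subseteq> set A \<union> set w" "filter (\<lambda>a. a \<in> set A) z = A" "filter (\<lambda>a. a \<in> set w) z = w"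
      using w(2) unfolding mem_shuffles_iff_filter[OF d(1)[folded w'(2)]] by blast+
    have "filter (\<lambda>a. a \<in> set B) z = B" if B: "B \<in> set xs" for B
    proof -
      have "filter (\<lambda>a. a \<in> set B) w = filter (\<lambda>a. a \<in> set B) z"
        by (subst z(3)[symmetric], unfold filter_filter) (use sub[OF B] w'(2) in \<open>auto intro!: filter_cong\<close>)
      then show ?thesis using w'(3)[OF B] by simp
    qed
    moreover have "z \<in> words_on (set (concat (A # xs)))"
      using distinct_disjoint_shuffles[of A w z] d w' w(2) set_shuffles[OF w(2)]
      unfolding words_on_def by auto
    ultimately show "interleaves (A # xs) z" unfolding interleaves_def using z(2) by simp
  qed
qed

lemma factor_shuffle_eq:
  "distinct (concat xs) \<Longrightarrow> factor_shuffle xs = (\<Sum>w\<in>{w. interleaves xs w}. bvec w)"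
proof (induction xs)
  case Nil
  have e: "{w. interleaves [] w} = {[]}" by (auto simp: interleaves_def words_on_def)
  show ?case unfolding factor_shuffle_def shuffle_list_def by (subst e) simp
next
  case (Cons A xs)
  have d: "set A \<inter> set (concat xs) = {}" "distinct (concat xs)" using Cons.prems by auto
  have "factor_shuffle (A # xs) = shuffle (bvec A) (factor_shuffle xs)"
    by (simp add: factor_shuffle_def shuffle_list_def)
  also have "\<dots> = (\<Sum>w\<in>{w. interleaves xs w}. shuffle_word A w)"
    unfolding Cons.IH[OF d(2)] shuffle_def by (simp add: lin_sum[OF lin_bilin_ext_right])
  also have "\<dots> = (\<Sum>w\<in>{w. interleaves xs w}. \<Sum>z\<in>shuffles A w. bvec z)"
    by (simp add: shuffle_word_def)
  also have "\<dots> = (\<Sum>z\<in>(\<Union>w\<in>{w. interleaves xs w}. shuffles A w). bvec z)"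
  proof (rule sum.UNION_disjoint[symmetric])
    have fil: "filter (\<lambda>a. a \<in> set (concat xs)) z = w" if "interleaves xs w" "z \<in> shuffles A w" for w z
    proof -
      have sw: "set w = set (concat xs)" using that(1) unfolding interleaves_def words_on_def by simp
      show ?thesis using that(2) unfolding mem_shuffles_iff_filter[OF d(1)[folded sw]] sw by blast
    qed
    show "\<forall>i\<in>{w. interleaves xs w}. \<forall>j\<in>{w. interleaves xs w}. i \<noteq> j \<longrightarrow> shuffles A i \<inter> shuffles A j = {}"
    proof (intro ballI impI)
      fix i j assume ij: "i \<in> {w. interleaves xs w}" "j \<in> {w. interleaves xs w}" "i \<noteq> j"
      show "shuffles A i \<inter> shuffles A j = {}"
      proof (rule ccontr)
        assume "shuffles A i \<inter> shuffles A j \<noteq> {}"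
        then obtain z where "z \<in> shuffles A i" "z \<in> shuffles A j" by blast
        then have "i = j" using fil[of i z] fil[of j z] ij(1,2) by simp
        then show False using ij(3) by simp
      qed
    qed
  qed simp_all
  also have "(\<Union>w\<in>{w. interleaves xs w}. shuffles A w) = {z. interleaves (A # xs) z}"
    using interleaves_Cons[OF Cons.prems] by blast
  finally show ?case .
qed

lemma coeff_factor_shuffle:
  "distinct (concat xs) \<Longrightarrow> coeff (factor_shuffle xs) w = (if interleaves xs w then 1 else 0)"
  by (simp add: factor_shuffle_eq coeff_sum_bvec)

lemma interleaves_concat:
  assumes "distinct (concat xs)"
  shows "interleaves xs (concat xs)"
  using assms
proof (induction xs)
  case Nil
  then show ?case by (simp add: interleaves_def words_on_def)
next
  case (Cons A xs)
  have "A @ concat xs \<in> shuffles A (concat xs)"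
  proof (subst mem_shuffles_iff_filter)
    show "set A \<inter> set (concat xs) = {}" using Cons.prems by auto
    then show "set (A @ concat xs) \<subseteq> set A \<union> set (concat xs) \<and>
      filter (\<lambda>x. x \<in> set A) (A @ concat xs) = A \<and> filter (\<lambda>x. x \<in> set (concat xs)) (A @ concat xs) = concat xs"
      by (auto simp: filter_empty_conv simp del: set_concat intro!: filter_True)
  qed
  moreover have "interleaves xs (concat xs)" using Cons by simp
  ultimately show ?case using interleaves_Cons[OF Cons.prems] by auto
qed

text \<open>
  Lyndon words are listed by decreasing first letters. Then the concatenation of the factors
  determines the factors: they begin at the left-to-right minima.
\<close>

definition lyndon_list :: "'a::linorder list list \<Rightarrow> bool" where
  "lyndon_list xs \<longleftrightarrow> (\<forall>A\<in>set xs. A \<noteq> [] \<and> (\<forall>a\<in>set A. hd A \<le> a)) \<and> sorted_wrt (\<lambda>A B. hd B < hd A) xs"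

definition lyndon_lists :: "'a::linorder set \<Rightarrow> 'a list list set" where
  "lyndon_lists R = {xs. lyndon_list xs \<and> concat xs \<in> words_on R}"

text \<open>
  Cut off the longest initial segment whose letters are not smaller than the first one.
\<close>

lemma lyndon_factorization: "\<exists>xs. lyndon_list xs \<and> concat xs = (w :: 'a::linorder list)"
proof (induction "length w" arbitrary: w rule: less_induct)
  case less
  show ?case
  proof (cases w)
    case Nil
    then show ?thesis by (intro exI[of _ "[]"]) (simp add: lyndon_list_def)
  next
    case (Cons a w')
    let ?A = "takeWhile (\<lambda>b. a \<le> b) w" and ?r = "dropWhile (\<lambda>b. a \<le> b) w"
    have "length ?r < length w" using Cons by (simp add: le_imp_less_Suc length_dropWhile_le)
    then obtain xs where xs: "lyndon_list xs" "concat xs = ?r" using less by blast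
    have A: "hd ?A = a" "?A \<noteq> []" using Cons by auto
    have "hd B < a" if B: "B \<in> set xs" for B
    proof -
      obtain C ys where C: "xs = C # ys" using B by (cases xs) auto
      then have "C \<noteq> []" using xs(1) unfolding lyndon_list_def by simp
      then have "?r \<noteq> []" "hd C = hd ?r" using xs(2)[symmetric] C by auto
      then have "hd C < a" using hd_dropWhile[of "\<lambda>b. a \<le> b" w] by auto
      moreover have "hd B \<le> hd C" using xs(1) B C unfolding lyndon_list_def by auto
      ultimately show ?thesis by simp
    qed
    moreover have "\<forall>b\<in>set ?A. a \<le> b" by (auto dest: set_takeWhileD)
    ultimately have "lyndon_list (?A # xs)" using xs(1) A unfolding lyndon_list_def by simp
    moreover have "concat (?A # xs) = w" using xs(2) by simp
    ultimately show ?thesis by blast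
  qed
qed

lemma lyndon_list_unique:
  assumes "lyndon_list xs" and "lyndon_list ys" and "concat xs = concat ys"
  shows "xs = ys"
  using assms
proof (induction xs arbitrary: ys)
  case Nil
  then show ?case by (cases ys) (auto simp: lyndon_list_def)
next
  have tw: "takeWhile (\<lambda>b. hd (concat (A # xs)) \<le> b) (concat (A # xs)) = A"
    if l: "lyndon_list (A # xs)" for A and xs :: "'a list list"
  proof -
    have A: "A \<noteq> []" "\<forall>b\<in>set A. hd A \<le> b" using l unfolding lyndon_list_def by auto
    have "takeWhile (\<lambda>b. hd A \<le> b) (concat xs) = []"
    proof (cases xs)
      case (Cons B zs)
      then have "B \<noteq> []" "hd B < hd A" using l unfolding lyndon_list_def by auto
      then show ?thesis using Cons by (cases B) auto
    qed simp
    then show ?thesis using A by (simp add: takeWhile_append2)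
  qed
  case (Cons A xs)
  have "concat (A # xs) \<noteq> []" using Cons.prems(1) unfolding lyndon_list_def by simp
  then have "concat ys \<noteq> []" using Cons.prems(3) by metis
  then obtain B zs where ys: "ys = B # zs" by (cases ys) auto
  have "A = B" using tw[OF Cons.prems(1)] tw[OF Cons.prems(2)[unfolded ys]] Cons.prems(3) ys by simp
  moreover have "lyndon_list xs" "lyndon_list zs"
    using Cons.prems(1,2) ys unfolding lyndon_list_def by auto
  ultimately show ?case using Cons.IH[of zs] Cons.prems(3) ys by simp
qed

text \<open>
  The concatenation is the lexicographically largest word of the shuffle: the first letter of any
  other word comes from the first factor or from a factor with a smaller first letter.
\<close>

lemma interleaves_le_append_concat:
  fixes A :: "'a::linorder list"
  assumes "interleaves (A # xs) w" and "distinct (concat (A # xs))" and "lyndon_list xs"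
    and "\<And>a B. a \<in> set A \<Longrightarrow> B \<in> set xs \<Longrightarrow> hd B < a"
  shows "w \<le> concat (A # xs)"
  using assms
proof (induction w arbitrary: A xs)
  case Nil
  then show ?case by simp
next
  case (Cons c w)
  have nonempty: "c # w \<le> concat (A # xs)"
    if h: "interleaves (A # xs) (c # w)" "distinct (concat (A # xs))" "lyndon_list xs"
      "\<And>a B. a \<in> set A \<Longrightarrow> B \<in> set xs \<Longrightarrow> hd B < a" "A \<noteq> []" for A xs
  proof -
    obtain a A' where A: "A = a # A'" using h(5) by (cases A) auto
    have i: "distinct (c # w)" "set (c # w) = set A \<union> set (concat xs)"
      "filter (\<lambda>b. b \<in> set A) (c # w) = A" "\<And>B. B \<in> set xs \<Longrightarrow> filter (\<lambda>b. b \<in> set B) (c # w) = B"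
      using h(1) unfolding interleaves_def words_on_def by auto
    show ?thesis
    proof (cases "c \<in> set A")
      case True
      then have "c # filter (\<lambda>b. b \<in> set A) w = a # A'" using i(3) A by simp
      then have ca: "c = a" and fA: "filter (\<lambda>b. b \<in> set A) w = A'" by simp_all
      have aw: "a \<notin> set w" using i(1) ca by simp
      have da: "a \<notin> set A'" "a \<notin> set (concat xs)" using h(2) A by auto
      have "interleaves (A' # xs) w"
        unfolding interleaves_def words_on_def
      proof (intro conjI CollectI ballI)
        show "distinct w" using i(1) by simp
        have "insert a (set w) = insert a (set A' \<union> set (concat xs))" using i(2) A ca by simp
        then show "set w = set (concat (A' # xs))" using aw da by (simp add: insert_ident)
        fix B assume "B \<in> set (A' # xs)"
        then consider "B = A'" | "B \<in> set xs" by auto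
        then show "filter (\<lambda>b. b \<in> set B) w = B"
        proof cases
          case 1
          have "filter (\<lambda>b. b \<in> set A') w = filter (\<lambda>b. b \<in> set A) w"
            by (rule filter_cong) (use aw A in auto)
          then show ?thesis using 1 fA by simp
        next
          case 2
          then have "a \<notin> set B" using da(2) by auto
          then show ?thesis using i(4)[OF 2] ca by simp
        qed
      qed
      then have "w \<le> concat (A' # xs)"
        by (rule Cons.IH) (use h(2-4) A in auto)
      then show ?thesis using ca A by simp
    next
      case False
      then have "c \<in> set (concat xs)" using i(2) by auto
      then obtain B where B: "B \<in> set xs" "c \<in> set B" by auto
      then have "hd B = c" using i(4)[OF B(1)] by (metis filter.simps(2) list.sel(1))
      then have "c < a" using h(4)[of a B] B A by simp
      then show ?thesis using A by simp
    qed
  qed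
  show ?case
  proof (cases "A = []")
    case True
    have "set (c # w) = set (concat xs)"
      using Cons.prems(1) True unfolding interleaves_def words_on_def by simp
    then have "xs \<noteq> []" by auto
    then obtain B ys where xs: "xs = B # ys" by (cases xs) auto
    have "c # w \<le> concat (B # ys)"
    proof (rule nonempty)
      show "interleaves (B # ys) (c # w)" using Cons.prems(1) True xs unfolding interleaves_def by simp
      show "distinct (concat (B # ys))" "lyndon_list ys" "B \<noteq> []"
        using Cons.prems(2,3) True xs unfolding lyndon_list_def by simp_all
      show "hd C < b" if "b \<in> set B" "C \<in> set ys" for b C
        using Cons.prems(3) that xs unfolding lyndon_list_def by fastforce
    qed
    then show ?thesis using True xs by simp
  next
    case False
    then show ?thesis using nonempty Cons.prems by blast
  qed
qed

lemma interleaves_le_concat: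
  fixes xs :: "'a::linorder list list"
  assumes "interleaves xs w" and "distinct (concat xs)" and "lyndon_list xs"
  shows "w \<le> concat xs"
  using interleaves_le_append_concat[of "[]" xs w] assms unfolding interleaves_def by simp

text \<open>
  The transition from words to Lyndon shuffles is unitriangular for the lexicographic order.
\<close>

lemma lyndon_shuffles_span:
  fixes R :: "'a::linorder set"
  assumes R: "finite R" and w: "w \<in> words_on R"
  shows "bvec w \<in> lc.span (factor_shuffle ` lyndon_lists R)"
  using w
proof (induction "card {z \<in> words_on R. z < w}" arbitrary: w rule: less_induct)
  case less
  obtain xs where xs: "lyndon_list xs" "concat xs = w" using lyndon_factorization by blast
  have d: "distinct (concat xs)" using xs(2) less.prems unfolding words_on_def by simp
  let ?I = "{z. interleaves xs z}"
  have wI: "w \<in> ?I" using interleaves_concat[OF d] xs(2) by simp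
  have "factor_shuffle xs = bvec w + (\<Sum>z\<in>?I - {w}. bvec z)"
    unfolding factor_shuffle_eq[OF d] by (rule sum.remove) (use wI in auto)
  then have eq: "bvec w = factor_shuffle xs - (\<Sum>z\<in>?I - {w}. bvec z)" by simp
  have "bvec z \<in> lc.span (factor_shuffle ` lyndon_lists R)" if z: "z \<in> ?I - {w}" for z
  proof (rule less.hyps)
    show zR: "z \<in> words_on R" using z xs(2) less.prems unfolding interleaves_def words_on_def by auto
    have "z < w" using z interleaves_le_concat[of xs z] d xs by auto
    then show "card {y \<in> words_on R. y < z} < card {y \<in> words_on R. y < w}"
      using zR R by (intro psubset_card_mono) auto
  qed
  moreover have "factor_shuffle xs \<in> lc.span (factor_shuffle ` lyndon_lists R)"
    using xs less.prems by (intro lc.span_base) (auto simp: lyndon_lists_def)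
  ultimately show ?case unfolding eq by (intro lc.span_diff lc.span_sum) auto
qed

lemma lyndon_shuffle_expansion:
  fixes R :: "'a::linorder set"
  assumes R: "finite R" and x: "supp x \<subseteq> words_on R"
  obtains c where "supp c \<subseteq> lyndon_lists R" and "x = lin_ext factor_shuffle c"
proof -
  have "x \<in> lc.span (bvec ` words_on R)" using x free_on_iff[of x] unfolding free_on_def by blast
  then have "x \<in> lc.span (factor_shuffle ` lyndon_lists R)"
    using lin_span_into[OF lin_id, of x "bvec ` words_on R" "factor_shuffle ` lyndon_lists R"]
      lyndon_shuffles_span[OF R] by auto
  also have "factor_shuffle ` lyndon_lists R = lin_ext factor_shuffle ` (bvec ` lyndon_lists R)"
    by (simp add: image_image)
  also have "lc.span \<dots> = lin_ext factor_shuffle ` lc.span (bvec ` lyndon_lists R)"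
    by (rule lc_pair.linear_span_image[OF lin_lin_ext])
  finally obtain c where c: "c \<in> free_on (lyndon_lists R)" "x = lin_ext factor_shuffle c"
    unfolding free_on_def by (rule imageE)
  then show ?thesis using that[of c] by (simp add: free_on_iff)
qed

text \<open>
  Look at the lexicographically largest concatenation of factors.
\<close>

lemma lyndon_shuffles_independent:
  fixes R :: "'a::linorder set"
  assumes c: "supp c \<subseteq> lyndon_lists R"
    and 0: "\<And>w. w \<in> words_on R \<Longrightarrow> coeff (lin_ext factor_shuffle c) w = 0"
  shows "c = 0"
proof (rule ccontr)
  assume "c \<noteq> 0"
  then have ne: "concat ` supp c \<noteq> {}" by simp
  have fin: "finite (concat ` supp c)" by simp
  define w where "w = Max (concat ` supp c)"
  have "w \<in> concat ` supp c" unfolding w_def by (rule Max_in[OF fin ne])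
  then obtain xs where xs: "xs \<in> supp c" "w = concat xs" by blast
  have lyn: "lyndon_list ys" "distinct (concat ys)" if "ys \<in> supp c" for ys
    using c that unfolding lyndon_lists_def words_on_def by auto
  have "coeff c ys * coeff (factor_shuffle ys) w = (if ys = xs then coeff c xs else 0)"
    if ys: "ys \<in> supp c" for ys
  proof (cases "interleaves ys w")
    case True
    then have "w \<le> concat ys" using interleaves_le_concat lyn[OF ys] by blast
    moreover have "concat ys \<le> w" unfolding w_def using fin ys by (intro Max_ge) auto
    ultimately have "ys = xs" using lyndon_list_unique[of ys xs] lyn[OF ys] lyn[OF xs(1)] xs(2) by simp
    then show ?thesis using True coeff_factor_shuffle[OF lyn(2)[OF ys]] by simp
  next
    case False
    then have "ys \<noteq> xs" using interleaves_concat[OF lyn(2)[OF xs(1)]] xs(2) by auto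
    then show ?thesis using False coeff_factor_shuffle[OF lyn(2)[OF ys]] by simp
  qed
  then have "coeff (lin_ext factor_shuffle c) w = (\<Sum>ys\<in>supp c. if ys = xs then coeff c xs else 0)"
    unfolding coeff_lin_ext by (intro sum.cong refl)
  also have "\<dots> = coeff c xs" using xs(1) by (simp add: sum.delta)
  also have "\<dots> \<noteq> 0" using xs(1) by (simp add: in_keys_iff)
  finally show False using 0[of w] xs c unfolding lyndon_lists_def by auto
qed

section \<open>Cutting Lyndon shuffles along an interval\<close>

lemma interleaves_block_parts:
  assumes "interleaves xs (u @ B @ w)" and "set B = T"
    and "interleaves xs (u @ B' @ w)" and "set B' = T" and "A \<in> set xs"
  shows "filter (\<lambda>a. a \<in> set A) B' = filter (\<lambda>a. a \<in> set A) B"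
  using assms unfolding interleaves_def by (metis append_same_eq filter_append same_append_eq)

text \<open>
  The words in the shuffle of the factors \<open>xs\<close> in which the letters of \<open>T\<close> form a block \<open>B\<close>, in a
  given context, are obtained by interleaving the parts of the factors on \<open>T\<close>. If more than one factor
  meets \<open>T\<close>, then these \<open>B\<close> add up to shuffles; if only one does, then \<open>T\<close> is a block of it.
\<close>

lemma cut_factor_shuffle_no_block:
  assumes T: "finite T" "T \<noteq> {}" and f: "kills_shuffles T f" and d: "distinct (concat xs)"
    and nb: "\<not> factor_block T xs"
  shows "(\<Sum>B\<in>words_on T. (if interleaves xs (u @ B @ w) then f B else 0)) = 0"
proof -
  define W where "W = {B \<in> words_on T. interleaves xs (u @ B @ w)}"
  have fin: "finite W" unfolding W_def using T by simp
  have sum: "(\<Sum>B\<in>words_on T. (if interleaves xs (u @ B @ w) then f B else 0)) = (\<Sum>B\<in>W. f B)"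
    unfolding W_def by (rule sum.inter_filter[symmetric]) (use T in simp)
  show ?thesis
  proof (cases "W = {}")
    case True
    then show ?thesis unfolding sum by simp
  next
    case False
    then obtain B0 where B0: "B0 \<in> words_on T" "interleaves xs (u @ B0 @ w)" unfolding W_def by blast
    have sB0: "set B0 = T" "distinct B0" using B0(1) unfolding words_on_def by auto
    obtain t where t: "t \<in> T" using T by blast
    have "T \<subseteq> set (concat xs)" using B0(2) sB0(1) unfolding interleaves_def words_on_def by auto
    then obtain A where A: "A \<in> set xs" "t \<in> set A" using t by auto
    let ?P = "\<lambda>a. a \<in> set A"
    define A1 where "A1 = filter ?P B0"
    have notsub: "\<not> T \<subseteq> set A"
    proof
      assume "T \<subseteq> set A"
      then have "filter ?P B0 = B0" using sB0(1) by (auto intro: filter_True)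
      then have "A = filter ?P u @ B0 @ filter ?P w"
        using B0(2) A(1) unfolding interleaves_def by (metis filter_append)
      then show False using nb A(1) sB0(1) unfolding factor_block_def by blast
    qed
    have A1: "A1 \<noteq> []" "set A1 = T \<inter> set A" using t A(2) sB0(1) unfolding A1_def by (auto simp: filter_empty_conv)
    define g where "g B = filter (\<lambda>a. a \<notin> set A) B" for B :: "'a list"
    have fA: "filter ?P B = A1" if "B \<in> W" for B
      using interleaves_block_parts[OF B0(2) sB0(1) _ _ A(1), of B] that
      unfolding W_def words_on_def A1_def by blast
    \<comment> \<open>Fixing the order of the letters of \<open>T\<close> outside \<open>A\<close>, one obtains all shuffles with the part \<open>A1\<close> of \<open>A\<close>.\<close>
    have fibre: "{B \<in> W. g B = g B1} = shuffles A1 (g B1)" if B1: "B1 \<in> W" for B1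
    proof (rule set_eqI)
      fix B
      have B1': "distinct B1" "set B1 = T" "interleaves xs (u @ B1 @ w)"
        using B1 unfolding W_def words_on_def by auto
      have dis: "set A1 \<inter> set (g B1) = {}" using A1(2) unfolding g_def by auto
      have sg: "set (g B1) = T - set A" using B1'(2) unfolding g_def by auto
      show "B \<in> {B \<in> W. g B = g B1} \<longleftrightarrow> B \<in> shuffles A1 (g B1)"
      proof
        assume B: "B \<in> {B \<in> W. g B = g B1}"
        then have sB: "set B = T" unfolding W_def words_on_def by auto
        have "filter (\<lambda>a. a \<in> set A1) B = filter ?P B"
          by (rule filter_cong) (use sB A1(2) in auto)
        moreover have "filter (\<lambda>a. a \<in> set (g B1)) B = g B"
          unfolding g_def by (rule filter_cong) (use sB sg[unfolded g_def] in auto)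
        ultimately show "B \<in> shuffles A1 (g B1)"
          unfolding mem_shuffles_iff_filter[OF dis] using B fA sB A1(2) sg by auto
      next
        assume B: "B \<in> shuffles A1 (g B1)"
        have f1: "set B \<subseteq> set A1 \<union> set (g B1)" "filter (\<lambda>a. a \<in> set A1) B = A1"
          "filter (\<lambda>a. a \<in> set (g B1)) B = g B1"
          using B unfolding mem_shuffles_iff_filter[OF dis] by blast+
        have sB: "set B = T" using set_shuffles[OF B] A1(2) sg by auto
        have "distinct A1" using sB0(2) unfolding A1_def by simp
        moreover have "distinct (g B1)" using B1'(1) unfolding g_def by simp
        ultimately have dB: "distinct B" using distinct_disjoint_shuffles[OF _ _ dis B] by simp
        have "g B = filter (\<lambda>a. a \<in> set (g B1)) B"
          unfolding g_def[of B] by (rule filter_cong[OF refl]) (use sB sg in simp)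
        then have gB: "g B = g B1" using f1(3) by simp
        have "filter ?P B = filter (\<lambda>a. a \<in> set A1) B"
          by (rule filter_cong[OF refl]) (use sB A1(2) in simp)
        then have fP: "filter ?P B = A1" using f1(2) by simp
        have "filter (\<lambda>a. a \<in> set C) B = filter (\<lambda>a. a \<in> set C) B1" if C: "C \<in> set xs" for C
        proof (cases "C = A")
          case True
          then show ?thesis using fP fA[OF B1] by simp
        next
          case False
          then have "set C \<inter> set A = {}" using d C A(1) by (simp add: distinct_concat_iff)
          then have "filter (\<lambda>a. a \<in> set C) L = filter (\<lambda>a. a \<in> set C) (g L)" for L
            unfolding g_def filter_filter by (intro filter_cong) auto
          then show ?thesis using gB by metis
        qed
        then have "interleaves xs (u @ B @ w)"
          using B1'(3,1,2) sB dB unfolding interleaves_def words_on_def by auto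
        then show "B \<in> {B \<in> W. g B = g B1}" using gB sB dB unfolding W_def words_on_def by simp
      qed
    qed
    have "(\<Sum>B\<in>W. f B) = (\<Sum>C\<in>g ` W. \<Sum>B\<in>{B \<in> W. g B = C}. f B)"
      by (rule sum.image_gen[OF fin])
    also have "\<dots> = 0"
    proof (rule sum.neutral, rule ballI)
      fix C assume "C \<in> g ` W"
      then obtain B1 where B1: "B1 \<in> W" "C = g B1" by blast
      have B1': "distinct B1" "set B1 = T" using B1(1) unfolding W_def words_on_def by auto
      have "g B1 \<noteq> []" using notsub B1'(2) unfolding g_def by (auto simp: filter_empty_conv)
      moreover have "A1 @ g B1 \<in> words_on T"
        using A1(2) B1' sB0(2) unfolding words_on_def g_def A1_def by auto
      ultimately show "(\<Sum>B\<in>{B \<in> W. g B = C}. f B) = 0"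
        using f A1(1) unfolding B1(2) fibre[OF B1(1)] kills_shuffles_def by blast
    qed
    finally show ?thesis unfolding sum .
  qed
qed

lemma append_block_unique:
  assumes "P @ M @ Q = u @ B @ v" and "set B = set M" and "distinct (P @ M @ Q)" and "M \<noteq> []"
  shows "P = u \<and> M = B \<and> Q = v"
proof -
  have "B \<noteq> []" using assms(2,4) by (metis set_empty)
  obtain u' v' where uv: "M = u' @ B @ v'" "u = P @ u'" "v = v' @ Q"
    by (rule append_middle_cancel[OF assms(1,3) _ \<open>B \<noteq> []\<close>]) (use assms(2) in auto)
  have "set u' \<inter> set B = {}" "set v' \<inter> set B = {}" using assms(3) uv(1) by auto
  moreover have "set u' \<subseteq> set B" "set v' \<subseteq> set B" using assms(2) uv(1) by auto
  ultimately have "u' = []" "v' = []" by (metis inf.absorb1 set_empty)+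
  then show ?thesis using uv by simp
qed

text \<open>
  The letters of \<open>T\<close> have to appear in the order of \<open>M\<close>, and they may be treated as one letter \<open>t\<close>.
\<close>

lemma cut_factor_shuffle_block:
  fixes xs :: "'a list list"
  assumes xs: "xs = Xs @ (P @ M @ Q) # Ys" and d: "distinct (concat xs)" and M: "set M = T" "finite T" "t \<in> T"
  shows "(\<Sum>B\<in>words_on T. (if interleaves xs (u @ B @ w) then f B else 0)) =
     (if interleaves (Xs @ (P @ [t] @ Q) # Ys) (u @ [t] @ w) then f M else (0::rat))"
proof -
  let ?A = "P @ M @ Q" and ?ys = "Xs @ (P @ [t] @ Q) # Ys"
  have Mne: "M \<noteq> []" using M by auto
  have dM: "distinct M" "distinct ?A" "set M \<inter> set (concat Xs) = {}" "set M \<inter> set (concat Ys) = {}"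
    "set M \<inter> set P = {}" "set M \<inter> set Q = {}"
    "set ?A \<inter> set (concat Xs) = {}" "set ?A \<inter> set (concat Ys) = {}" using d xs by auto
  have forced: "B = M" if B: "B \<in> words_on T" "interleaves xs (u @ B @ w)" for B
  proof -
    have sB: "set B = set M" using B(1) M unfolding words_on_def by simp
    have "filter (\<lambda>a. a \<in> set ?A) (u @ B @ w) = ?A" using B(2) xs unfolding interleaves_def by simp
    moreover have "filter (\<lambda>a. a \<in> set ?A) B = B" using sB by (intro filter_True) auto
    ultimately have "?A = filter (\<lambda>a. a \<in> set ?A) u @ B @ filter (\<lambda>a. a \<in> set ?A) w"
      by (simp only: filter_append)
    from append_block_unique[OF this sB dM(2) Mne] show ?thesis by simp
  qed
  have same: "interleaves xs (u @ M @ w) \<longleftrightarrow> interleaves ?ys (u @ [t] @ w)"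
  proof (cases "set u \<inter> T = {} \<and> set w \<inter> T = {}")
    case False
    have "\<not> interleaves xs (u @ M @ w)" using False M(1) unfolding interleaves_def words_on_def by auto
    moreover have "\<not> interleaves ?ys (u @ [t] @ w)"
    proof
      assume "interleaves ?ys (u @ [t] @ w)"
      then have i: "distinct (u @ [t] @ w)" "set (u @ [t] @ w) = set (concat ?ys)"
        unfolding interleaves_def words_on_def by auto
      obtain s where s: "s \<in> T" "s \<in> set u \<or> s \<in> set w" using False by blast
      then have "s \<noteq> t" using i(1) by auto
      moreover have "s \<in> set (concat ?ys)" using s(2) i(2) by auto
      ultimately show False using s(1) M(1) dM by auto
    qed
    ultimately show ?thesis by simp
  next
    case True
    have uT: "set u \<inter> set M = {}" "set w \<inter> set M = {}" "t \<notin> set u" "t \<notin> set w" using True M by auto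
    have other: "filter (\<lambda>a. a \<in> set C) (u @ M @ w) = filter (\<lambda>a. a \<in> set C) (u @ [t] @ w)"
      if "C \<in> set Xs \<union> set Ys" for C
    proof -
      have "set M \<inter> set C = {}" using that dM(3,4) by auto
      then have "filter (\<lambda>a. a \<in> set C) M = []" "t \<notin> set C" using M by (auto simp: filter_empty_conv)
      then show ?thesis by simp
    qed
    have A: "filter (\<lambda>a. a \<in> set ?A) (u @ M @ w) = ?A \<longleftrightarrow>
        filter (\<lambda>a. a \<in> set (P @ [t] @ Q)) (u @ [t] @ w) = P @ [t] @ Q" (is "?l = ?A \<longleftrightarrow> ?r = _")
    proof -
      let ?u = "filter (\<lambda>a. a \<in> set P \<union> set Q) u" and ?w = "filter (\<lambda>a. a \<in> set P \<union> set Q) w"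
      have "filter (\<lambda>a. a \<in> set ?A) u = ?u" "filter (\<lambda>a. a \<in> set ?A) w = ?w"
        using uT(1,2) by (auto intro!: filter_cong)
      moreover have "filter (\<lambda>a. a \<in> set ?A) M = M" by (intro filter_True) auto
      ultimately have l: "?l = ?u @ M @ ?w" by (simp only: filter_append)
      have "filter (\<lambda>a. a \<in> set (P @ [t] @ Q)) u = ?u" "filter (\<lambda>a. a \<in> set (P @ [t] @ Q)) w = ?w"
        using uT(3,4) by (auto intro!: filter_cong)
      then have r: "?r = ?u @ [t] @ ?w" by simp
      have "?u @ M @ ?w = P @ M @ Q \<longleftrightarrow> ?u = P \<and> ?w = Q"
        using append_block_unique[OF _ refl dM(2) Mne, of ?u ?w] by metis
      moreover have "distinct (P @ [t] @ Q)" using dM(2,5,6) M by auto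
      then have "?u @ [t] @ ?w = P @ [t] @ Q \<longleftrightarrow> ?u = P \<and> ?w = Q"
        using append_block_unique[OF _ refl, of P "[t]" Q ?u ?w] by (metis not_Cons_self2)
      ultimately show ?thesis unfolding l r by blast
    qed
    have "u @ M @ w \<in> words_on (set (concat xs)) \<longleftrightarrow> u @ [t] @ w \<in> words_on (set (concat ?ys))"
    proof -
      have dist: "distinct (u @ M @ w) \<longleftrightarrow> distinct (u @ [t] @ w)" using uT dM(1) by auto
      define R where "R = set (concat Xs) \<union> set P \<union> set Q \<union> set (concat Ys)"
      have R: "set (concat xs) = R \<union> set M" "set (concat ?ys) = insert t R" "set M \<inter> R = {}" "t \<in> set M"
        unfolding R_def using xs dM M by auto
      have "set (u @ M @ w) = set (concat xs) \<longleftrightarrow> set u \<union> set w = R"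
        unfolding R(1) set_append using R(3) uT(1,2) by blast
      moreover have "set (u @ [t] @ w) = set (concat ?ys) \<longleftrightarrow> set u \<union> set w = R"
        unfolding R(2) set_append using R(3,4) uT(3,4) by auto
      ultimately show ?thesis using dist unfolding words_on_def by blast
    qed
    moreover have "(\<forall>C\<in>set xs. filter (\<lambda>a. a \<in> set C) (u @ M @ w) = C) \<longleftrightarrow>
        (\<forall>C\<in>set ?ys. filter (\<lambda>a. a \<in> set C) (u @ [t] @ w) = C)"
    proof -
      have "(\<forall>C\<in>set xs. filter (\<lambda>a. a \<in> set C) (u @ M @ w) = C) \<longleftrightarrow>
        (\<forall>C\<in>set Xs \<union> set Ys. filter (\<lambda>a. a \<in> set C) (u @ M @ w) = C) \<and> ?l = ?A" unfolding xs by auto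
      also have "\<dots> \<longleftrightarrow> (\<forall>C\<in>set Xs \<union> set Ys. filter (\<lambda>a. a \<in> set C) (u @ [t] @ w) = C) \<and> ?r = P @ [t] @ Q"
        using other A by metis
      also have "\<dots> \<longleftrightarrow> (\<forall>C\<in>set ?ys. filter (\<lambda>a. a \<in> set C) (u @ [t] @ w) = C)" by auto
      finally show ?thesis .
    qed
    ultimately show ?thesis unfolding interleaves_def by blast
  qed
  have "(\<Sum>B\<in>words_on T. (if interleaves xs (u @ B @ w) then f B else 0)) =
      (\<Sum>B\<in>words_on T. if B = M then (if interleaves xs (u @ M @ w) then f M else 0) else 0)"
  proof (intro sum.cong refl)
    fix B assume "B \<in> words_on T"
    from forced[OF this] show "(if interleaves xs (u @ B @ w) then f B else 0) =
        (if B = M then (if interleaves xs (u @ M @ w) then f M else 0) else 0)"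
      by (cases "B = M") auto
  qed
  also have "\<dots> = (if interleaves xs (u @ M @ w) then f M else 0)"
  proof -
    have "M \<in> words_on T" using M(1) dM(1) unfolding words_on_def by simp
    then show ?thesis by (simp only: sum.delta[OF finite_words_on[OF M(2)]] if_True)
  qed
  finally show ?thesis unfolding same .
qed

definition contract :: "'a set \<Rightarrow> 'a \<Rightarrow> 'a list list \<Rightarrow> 'a list list" where
  "contract T t xs = map (filter (\<lambda>a. a \<in> T \<longrightarrow> a = t)) xs"

lemma contract_block:
  assumes "distinct (concat (Xs @ (P @ M @ Q) # Ys))" and "set M = T" and "t \<in> T"
  shows "contract T t (Xs @ (P @ M @ Q) # Ys) = Xs @ (P @ [t] @ Q) # Ys"
proof -
  have keep: "filter (\<lambda>a. a \<in> T \<longrightarrow> a = t) A = A" if "set A \<inter> T = {}" for A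
    using that by (intro filter_True) auto
  have d: "set P \<inter> T = {}" "set Q \<inter> T = {}" "\<And>A. A \<in> set Xs \<union> set Ys \<Longrightarrow> set A \<inter> T = {}" "distinct M"
    using assms(1,2) by auto
  obtain M1 M2 where M: "M = M1 @ t # M2" using assms(2,3) by (metis split_list)
  have "filter (\<lambda>a. a \<in> T \<longrightarrow> a = t) M = filter (\<lambda>a. a = t) M"
    using assms(2) by (intro filter_cong) auto
  moreover have "filter (\<lambda>a. a = t) M1 = []" "filter (\<lambda>a. a = t) M2 = []"
    using d(4) M by (auto simp: filter_empty_conv)
  ultimately have "filter (\<lambda>a. a \<in> T \<longrightarrow> a = t) M = [t]" using M by simp
  moreover have "map (filter (\<lambda>a. a \<in> T \<longrightarrow> a = t)) L = L" if "set L \<subseteq> set Xs \<union> set Ys" for L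
    using that d(3) by (intro map_idI keep) auto
  ultimately show ?thesis unfolding contract_def using keep[OF d(1)] keep[OF d(2)] by simp
qed

text \<open>
  The marked letter \<open>t\<close> occurs only once, and therefore it determines the context.
\<close>

lemma context_unique:
  assumes d: "distinct (concat (Xs @ (P @ [t] @ Q) # Ys))"
    and eq: "Xs @ (P @ [t] @ Q) # Ys = Xs' @ (P' @ [t] @ Q') # Ys'"
  shows "Xs = Xs' \<and> P = P' \<and> Q = Q' \<and> Ys = Ys'"
proof -
  have t: "t \<notin> set (concat Xs)" "t \<notin> set (concat Ys)" "t \<notin> set P" "t \<notin> set Q" using d by auto
  let ?A = "P @ [t] @ Q" and ?A' = "P' @ [t] @ Q'"
  have "?A' \<in> set (Xs @ ?A # Ys)" unfolding eq by simp
  moreover have "?A' \<notin> set Xs" "?A' \<notin> set Ys" using t(1,2) by auto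
  ultimately have A: "?A' = ?A" by auto
  have "?A \<notin> set Xs" "?A \<notin> set Ys" using t(1,2) by auto
  then have "Xs = Xs' \<and> Ys = Ys'"
    using eq unfolding A by (simp add: append_Cons_eq_iff del: append_assoc)
  moreover have "P = P' \<and> Q = Q'" using A t(3,4) append_Cons_eq_iff[of t P Q P' Q'] by auto
  ultimately show ?thesis by blast
qed

text \<open>
  Collecting the Lyndon shuffles which become equal after contraction, one obtains a combination of
  contracted shuffles. By the following lemma its coefficients are the test sums for \<open>c\<close>.
\<close>

lemma cut_lin_ext_factor_shuffle:
  fixes c :: "'a list list lc"
  assumes T: "finite T" "t \<in> T" and f: "kills_shuffles T f"
    and d: "\<And>xs. xs \<in> supp c \<Longrightarrow> distinct (concat xs)"
  defines "\<Gamma> \<equiv> {xs \<in> supp c. factor_block T xs}"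
  shows "(\<Sum>B\<in>words_on T. coeff (lin_ext factor_shuffle c) (u @ B @ w) * f B) =
    (\<Sum>\<delta>\<in>contract T t ` \<Gamma>. (\<Sum>xs\<in>{xs \<in> \<Gamma>. contract T t xs = \<delta>}. coeff c xs * f (filter (\<lambda>a. a \<in> T) (concat xs)))
       * (if interleaves \<delta> (u @ [t] @ w) then 1 else 0))"
proof -
  let ?b = "\<lambda>xs. filter (\<lambda>a. a \<in> T) (concat xs)"
  have inner: "(\<Sum>B\<in>words_on T. (if interleaves xs (u @ B @ w) then f B else 0)) =
      (if factor_block T xs then f (?b xs) * (if interleaves (contract T t xs) (u @ [t] @ w) then 1 else 0) else 0)"
    if xs: "xs \<in> supp c" for xs
  proof (cases "factor_block T xs")
    case False
    then show ?thesis using cut_factor_shuffle_no_block[OF T(1) _ f d[OF xs] False] T(2) by auto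
  next
    case True
    then obtain A P M Q where A: "A \<in> set xs" "A = P @ M @ Q" "set M = T" unfolding factor_block_def by blast
    then obtain Xs Ys where e: "xs = Xs @ (P @ M @ Q) # Ys" by (metis split_list)
    have b: "?b xs = M"
    proof -
      have "set (concat Xs) \<inter> T = {}" "set (concat Ys) \<inter> T = {}" "set P \<inter> T = {}" "set Q \<inter> T = {}"
        using d[OF xs] A(3) unfolding e by auto
      then have "filter (\<lambda>a. a \<in> T) (concat Xs) = []" "filter (\<lambda>a. a \<in> T) (concat Ys) = []"
        "filter (\<lambda>a. a \<in> T) P = []" "filter (\<lambda>a. a \<in> T) Q = []"
        by (auto simp: filter_empty_conv simp del: set_concat)
      moreover have "filter (\<lambda>a. a \<in> T) M = M" using A(3) by simp
      ultimately show ?thesis unfolding e by simp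
    qed
    have c: "contract T t xs = Xs @ (P @ [t] @ Q) # Ys"
      unfolding e by (rule contract_block[OF d[OF xs, unfolded e] A(3) T(2)])
    show ?thesis unfolding cut_factor_shuffle_block[OF e d[OF xs] A(3) T] b c using True by simp
  qed
  have "(\<Sum>B\<in>words_on T. coeff (lin_ext factor_shuffle c) (u @ B @ w) * f B) =
      (\<Sum>B\<in>words_on T. \<Sum>xs\<in>supp c. coeff c xs * (if interleaves xs (u @ B @ w) then f B else 0))"
    by (intro sum.cong refl)
      (auto simp: coeff_lin_ext coeff_factor_shuffle d sum_distrib_right intro!: sum.cong)
  also have "\<dots> = (\<Sum>xs\<in>supp c. coeff c xs *
      (\<Sum>B\<in>words_on T. if interleaves xs (u @ B @ w) then f B else 0))"
    by (subst sum.swap) (simp only: sum_distrib_left)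
  also have "\<dots> = (\<Sum>xs\<in>supp c. if factor_block T xs then
      coeff c xs * f (?b xs) * (if interleaves (contract T t xs) (u @ [t] @ w) then 1 else 0) else 0)"
    by (intro sum.cong refl) (simp add: inner)
  also have "\<dots> = (\<Sum>xs\<in>\<Gamma>. coeff c xs * f (?b xs) * (if interleaves (contract T t xs) (u @ [t] @ w) then 1 else 0))"
    unfolding \<Gamma>_def by (rule sum.inter_filter[symmetric]) simp
  also have "\<dots> = (\<Sum>\<delta>\<in>contract T t ` \<Gamma>. \<Sum>xs\<in>{xs \<in> \<Gamma>. contract T t xs = \<delta>}.
      coeff c xs * f (?b xs) * (if interleaves (contract T t xs) (u @ [t] @ w) then 1 else 0))"
    by (rule sum.image_gen) (simp add: \<Gamma>_def)
  also have "\<dots> = (\<Sum>\<delta>\<in>contract T t ` \<Gamma>. (\<Sum>xs\<in>{xs \<in> \<Gamma>. contract T t xs = \<delta>}. coeff c xs * f (?b xs))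
       * (if interleaves \<delta> (u @ [t] @ w) then 1 else 0))"
    by (intro sum.cong refl) (auto simp: sum_distrib_right intro!: sum.cong)
  finally show ?thesis .
qed

text \<open>
  The lists that contract to the same list as \<open>x\<close> differ from \<open>x\<close> only by the word in place of \<open>M\<close>.
\<close>

lemma sum_over_contraction_fibre:
  fixes c :: "'a list list lc"
  assumes T: "finite T" "t \<in> T" and d: "\<And>xs. xs \<in> supp c \<Longrightarrow> distinct (concat xs)"
    and x: "x = Xs @ (P @ M @ Q) # Ys" "set M = T" "distinct (concat x)"
  shows "(\<Sum>xs\<in>{xs \<in> {xs \<in> supp c. factor_block T xs}. contract T t xs = contract T t x}.
      coeff c xs * f (filter (\<lambda>a. a \<in> T) (concat xs))) =
    (\<Sum>B\<in>words_on T. coeff c (Xs @ (P @ B @ Q) # Ys) * (f B :: rat))"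
proof -
  let ?ctx = "\<lambda>B. Xs @ (P @ B @ Q) # Ys" and ?b = "\<lambda>xs. filter (\<lambda>a. a \<in> T) (concat xs)"
  let ?S = "{B \<in> words_on T. ?ctx B \<in> supp c}"
  have cx: "contract T t x = ?ctx [t]" unfolding x(1) by (rule contract_block[OF x(3)[unfolded x(1)] x(2) T(2)])
  have dt: "distinct (concat (?ctx [t]))" using x T(2) by auto
  have out: "set (concat Xs) \<inter> T = {}" "set (concat Ys) \<inter> T = {}" "set P \<inter> T = {}" "set Q \<inter> T = {}"
    using x by auto
  have bctx: "?b (?ctx B) = B" if "B \<in> words_on T" for B
  proof -
    have "filter (\<lambda>a. a \<in> T) (concat Xs) = []" "filter (\<lambda>a. a \<in> T) (concat Ys) = []"
      "filter (\<lambda>a. a \<in> T) P = []" "filter (\<lambda>a. a \<in> T) Q = []"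
      using out by (auto simp: filter_empty_conv simp del: set_concat)
    moreover have "filter (\<lambda>a. a \<in> T) B = B" using that unfolding words_on_def by simp
    ultimately show ?thesis by simp
  qed
  have img: "{xs \<in> {xs \<in> supp c. factor_block T xs}. contract T t xs = contract T t x} = ?ctx ` ?S"
  proof (intro equalityI subsetI)
    fix xs assume "xs \<in> {xs \<in> {xs \<in> supp c. factor_block T xs}. contract T t xs = contract T t x}"
    then have xs: "xs \<in> supp c" "factor_block T xs" "contract T t xs = ?ctx [t]" using cx by auto
    then obtain A P' B Q' where A: "A \<in> set xs" "A = P' @ B @ Q'" "set B = T" unfolding factor_block_def by blast
    then obtain Xs' Ys' where e: "xs = Xs' @ (P' @ B @ Q') # Ys'" by (metis split_list)
    have "contract T t xs = Xs' @ (P' @ [t] @ Q') # Ys'"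
      unfolding e by (rule contract_block[OF d[OF xs(1), unfolded e] A(3) T(2)])
    then have "Xs = Xs' \<and> P = P' \<and> Q = Q' \<and> Ys = Ys'" using context_unique[OF dt] xs(3) by metis
    then have "xs = ?ctx B" using e by simp
    moreover have "B \<in> words_on T" using d[OF xs(1)] e A(3) unfolding words_on_def by auto
    ultimately show "xs \<in> ?ctx ` ?S" using xs(1) by blast
  next
    fix xs assume "xs \<in> ?ctx ` ?S"
    then obtain B where B: "B \<in> words_on T" "xs = ?ctx B" "xs \<in> supp c" by blast
    have sB: "set B = T" using B(1) unfolding words_on_def by simp
    have "contract T t xs = ?ctx [t]"
      unfolding B(2) by (rule contract_block[OF d[OF B(3), unfolded B(2)] sB T(2)])
    moreover have "factor_block T xs" unfolding factor_block_def B(2) using sB by force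
    ultimately show "xs \<in> {xs \<in> {xs \<in> supp c. factor_block T xs}. contract T t xs = contract T t x}"
      using B(3) cx by simp
  qed
  have "(\<Sum>xs\<in>?ctx ` ?S. coeff c xs * f (?b xs)) = (\<Sum>B\<in>?S. coeff c (?ctx B) * f B)"
    by (subst sum.reindex) (auto intro!: inj_onI sum.cong simp: bctx simp del: concat_append concat.simps filter_append)
  also have "\<dots> = (\<Sum>B\<in>words_on T. coeff c (?ctx B) * f B)"
    using T(1) by (intro sum.mono_neutral_left) (auto simp: in_keys_iff)
  finally show ?thesis unfolding img .
qed

lemma word_converges_of_converges:
  assumes T: "finite T" "T \<noteq> {}" and c: "converges_along T c"
    and d: "\<And>xs. xs \<in> supp c \<Longrightarrow> distinct (concat xs)"
  shows "word_converges_along T (lin_ext factor_shuffle c)"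
  unfolding word_converges_along_def
proof (intro allI impI)
  fix f u w assume f: "kills_shuffles T f"
  obtain t where t: "t \<in> T" using T(2) by blast
  let ?G = "{xs \<in> supp c. factor_block T xs}"
  have z: "(\<Sum>xs\<in>{xs \<in> ?G. contract T t xs = \<delta>}. coeff c xs * f (filter (\<lambda>a. a \<in> T) (concat xs))) = 0"
    if \<delta>: "\<delta> \<in> contract T t ` ?G" for \<delta>
  proof -
    obtain x where x: "x \<in> supp c" "factor_block T x" "\<delta> = contract T t x" using \<delta> by blast
    then obtain A P M Q where A: "A \<in> set x" "A = P @ M @ Q" "set M = T" unfolding factor_block_def by blast
    then obtain Xs Ys where e: "x = Xs @ (P @ M @ Q) # Ys" by (metis split_list)
    show ?thesis
      unfolding x(3)
    proof (rule trans[OF sum_over_contraction_fibre[OF T(1) t d e A(3) d[OF x(1)]]])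
      show "(\<Sum>B\<in>words_on T. coeff c (Xs @ (P @ B @ Q) # Ys) * f B) = 0"
        using c f unfolding converges_along_def by blast
    qed
  qed
  show "(\<Sum>B\<in>words_on T. coeff (lin_ext factor_shuffle c) (u @ B @ w) * f B) = 0"
  proof (rule trans[OF cut_lin_ext_factor_shuffle[OF T(1) t f d]], assumption, intro sum.neutral ballI)
    fix \<delta> assume "\<delta> \<in> contract T t ` ?G"
    from z[OF this] show "(\<Sum>xs\<in>{xs \<in> ?G. contract T t xs = \<delta>}. coeff c xs * f (filter (\<lambda>a. a \<in> T) (concat xs)))
        * (if interleaves \<delta> (u @ [t] @ w) then 1 else 0) = 0" by (simp only: mult_zero_left)
  qed
qed

text \<open>
  Contracting a block of a factor to its smallest letter turns Lyndon shuffles into Lyndon shuffles,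
  and these are linearly independent. This is why convergence can be read off from the coefficients
  in the Lyndon basis.
\<close>

lemma contract_lyndon:
  fixes xs :: "nat list list"
  assumes xs: "xs \<in> lyndon_lists D" and T: "finite T" and blk: "factor_block T xs" and t: "t = Min T" "T \<noteq> {}"
  shows "contract T t xs \<in> lyndon_lists (D - (T - {t}))"
proof -
  let ?P = "\<lambda>a. a \<in> T \<longrightarrow> a = t"
  have l: "\<And>A. A \<in> set xs \<Longrightarrow> A \<noteq> [] \<and> (\<forall>a\<in>set A. hd A \<le> a)" "sorted_wrt (\<lambda>A B. hd B < hd A) xs"
    "distinct (concat xs)" "set (concat xs) = D"
    using xs unfolding lyndon_lists_def lyndon_list_def words_on_def by auto
  obtain A0 P M Q where A0: "A0 \<in> set xs" "A0 = P @ M @ Q" "set M = T" using blk unfolding factor_block_def by blast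
  have tT: "t \<in> T" using t T by simp
  have hdP: "?P (hd A)" if A: "A \<in> set xs" for A
  proof
    assume h: "hd A \<in> T"
    have "A = A0"
    proof (rule ccontr)
      assume "A \<noteq> A0"
      then have "set A \<inter> set A0 = {}" using l(3) A A0(1) by (simp add: distinct_concat_iff)
      moreover have "hd A \<in> set A" using l(1)[OF A] by simp
      moreover have "hd A \<in> set A0" using h A0(2,3) by simp
      ultimately show False by blast
    qed
    then have "hd A \<le> t" using l(1)[OF A] tT A0(2,3) by simp
    moreover have "t \<le> hd A" using h t(1) T by simp
    ultimately show "hd A = t" by simp
  qed
  have hdf: "filter ?P A \<noteq> []" "hd (filter ?P A) = hd A" if A: "A \<in> set xs" for A
  proof -
    obtain a A' where "A = a # A'" using l(1)[OF A] by (cases A) auto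
    then show "filter ?P A \<noteq> []" "hd (filter ?P A) = hd A" using hdP[OF A] by auto
  qed
  have "lyndon_list (contract T t xs)"
    unfolding lyndon_list_def
  proof
    show "\<forall>A\<in>set (contract T t xs). A \<noteq> [] \<and> (\<forall>a\<in>set A. hd A \<le> a)"
    proof
      fix B assume "B \<in> set (contract T t xs)"
      then obtain A where A: "A \<in> set xs" "B = filter ?P A" unfolding contract_def by auto
      show "B \<noteq> [] \<and> (\<forall>a\<in>set B. hd B \<le> a)" unfolding A(2) using hdf[OF A(1)] l(1)[OF A(1)] by simp
    qed
    show "sorted_wrt (\<lambda>A B. hd B < hd A) (contract T t xs)"
      unfolding contract_def sorted_wrt_map
      by (rule sorted_wrt_mono_rel[OF _ l(2)]) (simp add: hdf)
  qed
  moreover have "concat (contract T t xs) = filter ?P (concat xs)"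
    unfolding contract_def by (simp add: filter_concat)
  then have "concat (contract T t xs) \<in> words_on (D - (T - {t}))"
    using l(3,4) tT unfolding words_on_def by auto
  ultimately show ?thesis unfolding lyndon_lists_def by simp
qed

lemma converges_of_word_converges:
  fixes c :: "nat list list lc"
  assumes D: "finite D" and c: "supp c \<subseteq> lyndon_lists D" and T: "T \<subseteq> D" "T \<noteq> {}"
    and w: "word_converges_along T (lin_ext factor_shuffle c)"
  shows "converges_along T c"
  unfolding converges_along_def
proof (intro allI impI)
  fix f Xs u w Ys assume f: "kills_shuffles T f"
  have fT: "finite T" using D T finite_subset by blast
  define t where "t = Min T"
  have t: "t \<in> T" unfolding t_def using fT T by simp
  let ?R = "D - (T - {t})"
  have d: "distinct (concat xs)" if "xs \<in> supp c" for xs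
    using c that unfolding lyndon_lists_def words_on_def by auto
  define G where "G = {xs \<in> supp c. factor_block T xs}"
  define e where "e \<delta> = (\<Sum>xs\<in>{xs \<in> G. contract T t xs = \<delta>}. coeff c xs * f (filter (\<lambda>a. a \<in> T) (concat xs)))" for \<delta>
  define c' where "c' = (\<Sum>\<delta>\<in>contract T t ` G. lc_scale (e \<delta>) (bvec \<delta>))"
  have fG: "finite (contract T t ` G)" unfolding G_def by simp
  have co: "coeff c' \<delta> = (if \<delta> \<in> contract T t ` G then e \<delta> else 0)" for \<delta>
    unfolding c'_def by (rule coeff_sum_scale_bvec[OF fG])
  have kG: "supp c' \<subseteq> contract T t ` G" by (auto simp: in_keys_iff co split: if_splits)
  have GR: "contract T t ` G \<subseteq> lyndon_lists ?R"
  proof clarify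
    fix xs assume "xs \<in> G"
    then show "contract T t xs \<in> lyndon_lists ?R"
      unfolding G_def using contract_lyndon[OF _ fT _ t_def T(2)] c by blast
  qed
  have "c' = 0"
  proof (rule lyndon_shuffles_independent)
    show "supp c' \<subseteq> lyndon_lists ?R" using kG GR by blast
    fix z assume z: "z \<in> words_on ?R"
    then have "t \<in> set z" using t T unfolding words_on_def by auto
    then obtain u w where uw: "z = u @ [t] @ w" by (metis append_Cons append_Nil split_list)
    have dd: "distinct (concat \<delta>)" if "\<delta> \<in> contract T t ` G" for \<delta>
      using GR that unfolding lyndon_lists_def words_on_def by auto
    have "coeff (lin_ext factor_shuffle c') z = (\<Sum>\<delta>\<in>contract T t ` G. coeff c' \<delta> * coeff (factor_shuffle \<delta>) z)"
      unfolding lin_ext_superset[OF fG kG] by (simp add: coeff_sum)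
    also have "\<dots> = (\<Sum>\<delta>\<in>contract T t ` G. e \<delta> * (if interleaves \<delta> (u @ [t] @ w) then 1 else 0))"
      by (intro sum.cong refl) (simp add: co coeff_factor_shuffle[OF dd] uw)
    also have "\<dots> = (\<Sum>B\<in>words_on T. coeff (lin_ext factor_shuffle c) (u @ B @ w) * f B)"
      unfolding e_def G_def by (rule cut_lin_ext_factor_shuffle[OF fT t f d, symmetric])
    also have "\<dots> = 0" using w f unfolding word_converges_along_def by blast
    finally show "coeff (lin_ext factor_shuffle c') z = 0" .
  qed
  then have e0: "e \<delta> = 0" if "\<delta> \<in> contract T t ` G" for \<delta> using co[of \<delta>] that by simp
  show "(\<Sum>B\<in>words_on T. coeff c (Xs @ (u @ B @ w) # Ys) * f B) = 0"
  proof (cases "\<exists>B\<in>words_on T. Xs @ (u @ B @ w) # Ys \<in> supp c")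
    case False
    then show ?thesis by (intro sum.neutral) (auto simp: in_keys_iff)
  next
    case True
    then obtain M where M: "M \<in> words_on T" "Xs @ (u @ M @ w) # Ys \<in> supp c" by blast
    let ?x = "Xs @ (u @ M @ w) # Ys"
    have sM: "set M = T" using M(1) unfolding words_on_def by simp
    then have "factor_block T ?x" unfolding factor_block_def by force
    then have "?x \<in> G" using M(2) unfolding G_def by simp
    then have "e (contract T t ?x) = 0" using e0 by blast
    moreover have "e (contract T t ?x) = (\<Sum>B\<in>words_on T. coeff c (Xs @ (u @ B @ w) # Ys) * f B)"
      unfolding e_def G_def by (rule sum_over_contraction_fibre[OF fT t d refl sM d[OF M(2)]])
    ultimately show ?thesis by simp
  qed
qed

section \<open>Lyndon insertion shuffles span the convergent shuffles\<close>

lemma subst_word_Cons: "subst_word \<sigma> (a # w) = conc (\<sigma> a) (subst_word \<sigma> w)"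
  by (simp add: subst_word_def)

lemma subst_word_cong: "(\<And>i. i \<in> set w \<Longrightarrow> \<sigma> i = \<tau> i) \<Longrightarrow> subst_word \<sigma> w = subst_word \<tau> w"
  by (induction w) (simp_all add: subst_word_Cons, simp add: subst_word_def)

lemma subst_word_bvec: "subst_word (\<lambda>i. bvec (p i)) w = bvec (concat (map p w))"
  by (induction w) (simp_all add: subst_word_Cons conc_def, simp add: subst_word_def)

lemma lin_subst_word:
  assumes "distinct w" and "i \<in> set w"
  shows "lin (\<lambda>x. subst_word (\<sigma>(i := x)) w)"
  using assms
proof (induction w)
  case (Cons a w)
  show ?case
  proof (cases "a = i")
    case True
    then have "i \<notin> set w" using Cons.prems by simp
    then have "subst_word (\<sigma>(i := x)) w = subst_word \<sigma> w" for x by (intro subst_word_cong) auto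
    then have "(\<lambda>x. subst_word (\<sigma>(i := x)) (a # w)) = (\<lambda>x. conc x (subst_word \<sigma> w))"
      using True by (simp add: subst_word_Cons)
    then show ?thesis unfolding conc_def by (simp only: lin_bilin_ext_left)
  next
    case False
    then have "(\<lambda>x. subst_word (\<sigma>(i := x)) (a # w)) = (\<lambda>x. conc (\<sigma> a) (subst_word (\<sigma>(i := x)) w))"
      by (simp add: subst_word_Cons)
    moreover have "lin (\<lambda>x. conc (\<sigma> a) (subst_word (\<sigma>(i := x)) w))"
      unfolding conc_def by (rule lin_compose[OF Cons.IH lin_bilin_ext_right]) (use Cons.prems False in auto)
    ultimately show ?thesis by (simp only:)
  qed
qed simp

lemma shuffle_list_Cons: "shuffle_list (x # xs) = shuffle x (shuffle_list xs)"
  by (simp add: shuffle_list_def)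

lemma lin_shuffle_list_subst:
  assumes "distinct (concat y)" and "i \<in> set (concat y)"
  shows "lin (\<lambda>x. shuffle_list (map (subst_word (\<sigma>(i := x))) y))"
  using assms
proof (induction y)
  case (Cons A y)
  have const: "subst_word (\<sigma>(i := x)) B = subst_word \<sigma> B" if "i \<notin> set B" for x B
    using that by (intro subst_word_cong) auto
  show ?case
  proof (cases "i \<in> set A")
    case True
    then have "i \<notin> set (concat y)" using Cons.prems by auto
    then have m: "map (subst_word (\<sigma>(i := x))) y = map (subst_word \<sigma>) y" for x
      by (intro map_cong refl const) auto
    have "(\<lambda>x. shuffle_list (map (subst_word (\<sigma>(i := x))) (A # y))) =
        (\<lambda>x. shuffle (subst_word (\<sigma>(i := x)) A) (shuffle_list (map (subst_word \<sigma>) y)))"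
      unfolding list.map shuffle_list_Cons m ..
    moreover have "lin (\<lambda>x. shuffle (subst_word (\<sigma>(i := x)) A) (shuffle_list (map (subst_word \<sigma>) y)))"
      unfolding shuffle_def
      by (rule lin_compose[OF lin_subst_word lin_bilin_ext_left]) (use Cons.prems True in auto)
    ultimately show ?thesis by (simp only:)
  next
    case False
    then have "(\<lambda>x. shuffle_list (map (subst_word (\<sigma>(i := x))) (A # y))) =
        (\<lambda>x. shuffle (subst_word \<sigma> A) (shuffle_list (map (subst_word (\<sigma>(i := x))) y)))"
      by (simp add: shuffle_list_Cons const)
    moreover have "lin (\<lambda>x. shuffle (subst_word \<sigma> A) (shuffle_list (map (subst_word (\<sigma>(i := x))) y)))"
      unfolding shuffle_def by (rule lin_compose[OF Cons.IH lin_bilin_ext_right]) (use Cons.prems False in auto)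
    ultimately show ?thesis by (simp only:)
  qed
qed simp

text \<open>Both sides are multilinear in the inserted elements, and they agree on words.\<close>

lemma multilinear_insert_expand:
  assumes M: "multilinear_on {1..k} M"
    and E: "\<And>p. p \<in> fillings k v \<Longrightarrow> M (\<lambda>i. bvec (p i)) = E (subst_letters p y)"
    and \<sigma>: "\<And>i. i \<in> {1..k} \<Longrightarrow> supp (\<sigma> i) \<subseteq> words_on (slot v i)"
  shows "lin_ext E (insert_lc k v y \<sigma>) = M \<sigma>"
proof -
  have "M \<sigma> = (\<Sum>p\<in>fillings k v. lc_scale (\<Prod>i\<in>{1..k}. coeff (\<sigma> i) (p i)) (M (\<lambda>i. bvec (p i))))"
    by (rule multilinear_expand[OF _ M]) (use \<sigma> in auto)
  also have "\<dots> = (\<Sum>p\<in>fillings k v. lc_scale (\<Prod>i\<in>{1..k}. coeff (\<sigma> i) (p i)) (E (subst_letters p y)))"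
    by (intro sum.cong refl) (simp only: E)
  also have "\<dots> = lin_ext E (insert_lc k v y \<sigma>)"
    unfolding insert_lc_def lin_sum[OF lin_lin_ext] lin_scale[OF lin_lin_ext] lin_ext_bvec ..
  finally show ?thesis ..
qed

lemma factor_shuffle_insert_lc:
  assumes y: "concat y \<in> words_on {1..k}"
    and \<sigma>: "\<And>i. i \<in> {1..k} \<Longrightarrow> supp (\<sigma> i) \<subseteq> words_on (slot v i)"
  shows "lin_ext factor_shuffle (insert_lc k v y \<sigma>) = shuffle_list (map (subst_word \<sigma>) y)"
proof (rule multilinear_insert_expand[OF _ _ \<sigma>])
  have sy: "set (concat y) = {1..k}" "distinct (concat y)" using y unfolding words_on_def by auto
  show "multilinear_on {1..k} (\<lambda>\<sigma> :: nat \<Rightarrow> nat list lc. shuffle_list (map (subst_word \<sigma>) y))"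
    unfolding multilinear_on_def
  proof (intro conjI allI impI ballI)
    fix \<sigma> \<tau> :: "nat \<Rightarrow> nat list lc" assume "\<forall>i\<in>{1..k}. \<sigma> i = \<tau> i"
    then have "map (subst_word \<sigma>) y = map (subst_word \<tau>) y"
      using sy(1) by (intro map_cong refl subst_word_cong) auto
    then show "shuffle_list (map (subst_word \<sigma>) y) = shuffle_list (map (subst_word \<tau>) y)" by (rule arg_cong)
  next
    fix \<sigma> :: "nat \<Rightarrow> nat list lc" and i assume "i \<in> {1..k}"
    then show "lin (\<lambda>x. shuffle_list (map (subst_word (\<sigma>(i := x))) y))"
      using sy by (intro lin_shuffle_list_subst) auto
  qed
  show "shuffle_list (map (subst_word (\<lambda>i. bvec (p i))) y) = factor_shuffle (subst_letters p y)"
    for p :: "nat \<Rightarrow> nat list"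
  proof -
    have "map (subst_word (\<lambda>i. bvec (p i))) y = map bvec (subst_letters p y)"
      unfolding subst_letters_def by (simp add: subst_word_bvec)
    then show ?thesis unfolding factor_shuffle_def by (rule arg_cong)
  qed
qed

subsection \<open>Renumbering\<close>

lemma coeff_rename:
  assumes \<phi>: "inj_on \<phi> D" and x: "supp x \<subseteq> words_on D" and w: "set w \<subseteq> D"
  shows "coeff (rename \<phi> x) (map \<phi> w) = coeff x w"
proof -
  have "coeff (rename \<phi> x) (map \<phi> w) = (\<Sum>z\<in>supp x. if z = w then coeff x w else 0)"
    unfolding rename_def coeff_lin_ext
  proof (intro sum.cong refl)
    fix z assume "z \<in> supp x"
    then have "set z \<subseteq> D" using x unfolding words_on_def by auto
    then have "map \<phi> z = map \<phi> w \<longleftrightarrow> z = w"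
      using w \<phi> by (metis inj_on_map_eq_map inj_on_subset le_sup_iff)
    then show "coeff x z * coeff (bvec (map \<phi> z)) (map \<phi> w) = (if z = w then coeff x w else 0)"
      by (simp add: coeff_bvec)
  qed
  then show ?thesis by (simp add: sum.delta in_keys_iff)
qed

lemma keys_rename:
  assumes x: "supp x \<subseteq> words_on D" and \<phi>: "inj_on \<phi> D"
  shows "supp (rename \<phi> x) \<subseteq> words_on (\<phi> ` D)"
proof
  fix z assume "z \<in> supp (rename \<phi> x)"
  then obtain b where "b \<in> supp x" "coeff (bvec (map \<phi> b)) z \<noteq> 0"
    unfolding rename_def by (rule keys_lin_ext)
  then have b: "b \<in> words_on D" "z = map \<phi> b" using x by (auto simp: coeff_bvec split: if_splits)
  then show "z \<in> words_on (\<phi> ` D)"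
    using \<phi> unfolding words_on_def by (auto simp: distinct_map)
qed

lemma shuffles_map: "shuffles (map \<phi> A) (map \<phi> B) = map \<phi> ` shuffles A B"
  by (induction A B rule: shuffles.induct) (simp_all add: image_Un image_image)

lemma subset_image_map:
  assumes "set u \<subseteq> \<phi> ` D"
  obtains u' where "set u' \<subseteq> D" and "u = map \<phi> u'"
proof -
  have "\<exists>u'. set u' \<subseteq> D \<and> u = map \<phi> u'" using assms
  proof (induction u)
    case (Cons a u)
    then obtain u' b where "set u' \<subseteq> D" "u = map \<phi> u'" "b \<in> D" "a = \<phi> b" by auto
    then show ?case by (intro exI[of _ "b # u'"]) simp
  qed simp
  then show ?thesis using that by blast
qed

lemma words_on_image:
  assumes "inj_on \<phi> T"
  shows "words_on (\<phi> ` T) = map \<phi> ` words_on T"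
proof
  show "map \<phi> ` words_on T \<subseteq> words_on (\<phi> ` T)"
    using assms unfolding words_on_def by (auto simp: distinct_map)
  show "words_on (\<phi> ` T) \<subseteq> map \<phi> ` words_on T"
  proof
    fix z assume z: "z \<in> words_on (\<phi> ` T)"
    then have sz: "set z = \<phi> ` T" "distinct z" unfolding words_on_def by auto
    obtain z' where z': "set z' \<subseteq> T" "z = map \<phi> z'" by (rule subset_image_map[of z \<phi> T]) (use sz in auto)
    have "\<phi> ` set z' = \<phi> ` T" using sz(1) z'(2) by simp
    then have "set z' = T" using inj_on_image_eq_iff[OF assms z'(1), of T] by simp
    moreover have "distinct z'" using z'(2) sz(2) by (simp add: distinct_map)
    ultimately show "z \<in> map \<phi> ` words_on T" using z'(2) unfolding words_on_def by blast
  qed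
qed

lemma inj_on_map_words: "inj_on \<phi> T \<Longrightarrow> inj_on (map \<phi>) (words_on T)"
  by (rule inj_onI, rule map_inj_on) (auto simp: words_on_def)

text \<open>
  Renaming letters maps shuffles to shuffles.
\<close>

lemma kills_shuffles_map:
  assumes inj: "inj_on \<phi> T" and f: "kills_shuffles (\<phi> ` T) f"
  shows "kills_shuffles T (\<lambda>z. f (map \<phi> z))"
  unfolding kills_shuffles_def
proof (intro allI impI)
  fix A B assume AB: "A \<noteq> [] \<and> B \<noteq> [] \<and> A @ B \<in> words_on T"
  have sub: "shuffles A B \<subseteq> words_on T" using shuffles_words_on AB by blast
  have "map \<phi> (A @ B) \<in> words_on (\<phi> ` T)" unfolding words_on_image[OF inj] using AB by blast
  then have "(\<Sum>z\<in>shuffles (map \<phi> A) (map \<phi> B). f z) = 0"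
    using f AB unfolding kills_shuffles_def by simp
  then show "(\<Sum>z\<in>shuffles A B. f (map \<phi> z)) = 0"
    unfolding shuffles_map using sum.reindex[OF inj_on_subset[OF inj_on_map_words[OF inj] sub], of f]
    by (simp add: comp_def)
qed

text \<open>
  Only intervals are tested, so the renaming has to respect these.
\<close>

lemma rename_convergent_shuffles:
  assumes x: "x \<in> convergent_shuffles D" and \<phi>: "inj_on \<phi> D"
    and intervals: "\<And>a b. a < b \<Longrightarrow> {a..b} \<subseteq> \<phi> ` D \<Longrightarrow> \<exists>i j. i < j \<and> {i..j} \<subseteq> D \<and> \<phi> ` {i..j} = {a..b}"
  shows "rename \<phi> x \<in> convergent_shuffles (\<phi> ` D)"
proof -
  have kx: "supp x \<subseteq> words_on D"
    and cx: "\<And>i j. i < j \<Longrightarrow> {i..j} \<subseteq> D \<Longrightarrow> word_converges_along {i..j} x"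
    using x unfolding convergent_shuffles_def by auto
  have "word_converges_along {a..b} (rename \<phi> x)" if ab: "a < b" "{a..b} \<subseteq> \<phi> ` D" for a b
    unfolding word_converges_along_def
  proof (intro allI impI)
    fix f u w assume f: "kills_shuffles {a..b} f"
    obtain i j where ij: "i < j" "{i..j} \<subseteq> D" "\<phi> ` {i..j} = {a..b}" using intervals[OF ab] by blast
    have inj: "inj_on \<phi> {i..j}" using \<phi> ij(2) by (rule inj_on_subset)
    show "(\<Sum>B\<in>words_on {a..b}. coeff (rename \<phi> x) (u @ B @ w) * f B) = 0"
    proof (cases "set u \<subseteq> \<phi> ` D \<and> set w \<subseteq> \<phi> ` D")
      case False
      have "coeff (rename \<phi> x) (u @ B @ w) = 0" for B
      proof (rule ccontr)
        assume "coeff (rename \<phi> x) (u @ B @ w) \<noteq> 0"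
        then have "u @ B @ w \<in> words_on (\<phi> ` D)"
          using keys_rename[OF kx \<phi>] unfolding in_keys_iff[symmetric] by blast
        then show False using False unfolding words_on_def by auto
      qed
      then show ?thesis by simp
    next
      case True
      obtain u' where u': "set u' \<subseteq> D" "u = map \<phi> u'" using True subset_image_map by metis
      obtain w' where w': "set w' \<subseteq> D" "w = map \<phi> w'" using True subset_image_map by metis
      have "(\<Sum>B\<in>words_on {a..b}. coeff (rename \<phi> x) (u @ B @ w) * f B) =
          (\<Sum>B\<in>words_on {i..j}. coeff (rename \<phi> x) (u @ map \<phi> B @ w) * f (map \<phi> B))"
        unfolding ij(3)[symmetric] words_on_image[OF inj]
        by (subst sum.reindex[OF inj_on_map_words[OF inj]]) simp
      also have "\<dots> = (\<Sum>B\<in>words_on {i..j}. coeff x (u' @ B @ w') * f (map \<phi> B))"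
      proof (intro sum.cong refl)
        fix B assume "B \<in> words_on {i..j}"
        then have "set (u' @ B @ w') \<subseteq> D" using u' w' ij(2) unfolding words_on_def by auto
        from coeff_rename[OF \<phi> kx this]
        show "coeff (rename \<phi> x) (u @ map \<phi> B @ w) * f (map \<phi> B) = coeff x (u' @ B @ w') * f (map \<phi> B)"
          unfolding u'(2) w'(2) by simp
      qed
      also have "\<dots> = 0"
        using cx[OF ij(1,2)] kills_shuffles_map[OF inj, of f] f ij(3) unfolding word_converges_along_def by simp
      finally show ?thesis .
    qed
  qed
  then show ?thesis unfolding convergent_shuffles_def using keys_rename[OF kx \<phi>] by blast
qed

lemma rename_inverse:
  assumes "supp x \<subseteq> words_on D" and "\<And>a. a \<in> D \<Longrightarrow> \<phi> (\<psi> a) = a"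
  shows "rename \<phi> (rename \<psi> x) = x"
proof -
  have "rename \<phi> (rename \<psi> x) = (\<Sum>b\<in>supp x. lc_scale (coeff x b) (bvec (map \<phi> (map \<psi> b))))"
    unfolding rename_def lin_ext_def[of _ x] lin_sum[OF lin_lin_ext] lin_scale[OF lin_lin_ext] lin_ext_bvec ..
  also have "\<dots> = (\<Sum>b\<in>supp x. lc_scale (coeff x b) (bvec b))"
  proof (intro sum.cong refl)
    fix b assume "b \<in> supp x"
    then have "map \<phi> (map \<psi> b) = b"
      unfolding map_map using assms unfolding words_on_def by (intro map_idI) auto
    then show "lc_scale (coeff x b) (bvec (map \<phi> (map \<psi> b))) = lc_scale (coeff x b) (bvec b)" by simp
  qed
  also have "\<dots> = x" by (rule lc_expand[symmetric]) auto
  finally show ?thesis .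
qed

lemma slot_eq_image: "slot v i = (\<lambda>a. a + offset v i) ` {1..v i}"
  unfolding slot_def by (auto simp: image_iff intro!: bexI[of _ "_ - offset v i"])

lemma shift_convergent_shuffles:
  "x \<in> convergent_shuffles {1..m} \<Longrightarrow> rename (\<lambda>a. a + l) x \<in> convergent_shuffles ((\<lambda>a. a + l) ` {1..m})"
proof (rule rename_convergent_shuffles)
  fix a b :: nat assume ab: "a < b" "{a..b} \<subseteq> (\<lambda>a. a + l) ` {1..m}"
  then have "a \<in> (\<lambda>a. a + l) ` {1..m}" "b \<in> (\<lambda>a. a + l) ` {1..m}" by auto
  then have "l < a" "b \<le> m + l" by auto
  then show "\<exists>i j. i < j \<and> {i..j} \<subseteq> {1..m} \<and> (\<lambda>a. a + l) ` {i..j} = {a..b}"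
    using ab(1) by (intro exI[of _ "a - l"] exI[of _ "b - l"]) (auto simp: image_iff intro!: bexI[of _ "_ - l"])
qed auto

lemma unshift_convergent_shuffles:
  assumes "x \<in> convergent_shuffles ((\<lambda>a. a + l) ` {1..m})"
  shows "rename (\<lambda>a. a - l) x \<in> convergent_shuffles {1..m}"
proof -
  have "rename (\<lambda>a. a - l) x \<in> convergent_shuffles ((\<lambda>a. a - l) ` (\<lambda>a. a + l) ` {1..m})"
  proof (rule rename_convergent_shuffles[OF assms])
    show "inj_on (\<lambda>a. a - l) ((\<lambda>a. a + l) ` {1..m})" by (auto intro!: inj_onI)
    fix a b :: nat assume ab: "a < b" "{a..b} \<subseteq> (\<lambda>a. a - l) ` (\<lambda>a. a + l) ` {1..m}"
    then have "{a..b} \<subseteq> (\<lambda>a. a + l - l) ` {1..m}" by (simp only: image_image)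
    then have "{a..b} \<subseteq> {1..m}" by (simp only: add_diff_cancel_right' image_ident)
    moreover have "(\<lambda>a. a - l) ` {a + l..b + l} = {a..b}"
      by (auto simp: image_iff intro!: bexI[of _ "_ + l"])
    moreover have "{a + l..b + l} = (\<lambda>a. a + l) ` {a..b}" by simp
    ultimately show "\<exists>i j. i < j \<and> {i..j} \<subseteq> (\<lambda>a. a + l) ` {1..m} \<and> (\<lambda>a. a - l) ` {i..j} = {a..b}"
      using ab(1) by (intro exI[of _ "a + l"] exI[of _ "b + l"]) (auto simp del: image_add_atLeastAtMost')
  qed
  then show ?thesis by (simp only: image_image add_diff_cancel_right' image_ident)
qed

subsection \<open>The recursion for Lyndon insertion shuffles\<close>

definition slot_insertions :: "(nat \<Rightarrow> nat) \<Rightarrow> nat \<Rightarrow> nat list lc set" where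
  "slot_insertions v i = {replacement v V i | V. 1 < v i \<longrightarrow> V i \<in> Lset (v i)}"

lemma slot_insertions_choice:
  assumes "\<forall>i\<in>I. \<sigma> i \<in> slot_insertions v i"
  obtains V where "\<forall>i\<in>I. \<sigma> i = replacement v V i \<and> (1 < v i \<longrightarrow> V i \<in> Lset (v i))"
proof -
  have "\<forall>i\<in>I. \<exists>z. \<sigma> i = replacement v (\<lambda>_. z) i \<and> (1 < v i \<longrightarrow> z \<in> Lset (v i))"
  proof
    fix i assume "i \<in> I"
    then obtain V where "\<sigma> i = replacement v V i" "1 < v i \<longrightarrow> V i \<in> Lset (v i)"
      using assms unfolding slot_insertions_def by blast
    then show "\<exists>z. \<sigma> i = replacement v (\<lambda>_. z) i \<and> (1 < v i \<longrightarrow> z \<in> Lset (v i))"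
      by (intro exI[of _ "V i"]) (simp add: replacement_def)
  qed
  then obtain V where "\<forall>i\<in>I. \<sigma> i = replacement v V i \<and> (1 < v i \<longrightarrow> V i \<in> Lset (v i))"
    unfolding replacement_def by metis
  then show ?thesis by (rule that)
qed

lemma words_on_singleton: "words_on {a} = {[a]}"
proof -
  have "w = [a]" if "distinct w" "set w = {a}" for w
  proof -
    have "length w = 1" using distinct_card[OF that(1)] that(2) by simp
    then obtain b where "w = [b]" by (metis One_nat_def length_0_conv length_Suc_conv)
    then show ?thesis using that(2) by simp
  qed
  then show ?thesis unfolding words_on_def by auto
qed

lemma replacement_convergent:
  assumes "1 \<le> v i" and "1 < v i \<Longrightarrow> V i \<in> convergent_shuffles {1..v i}"
  shows "replacement v V i \<in> convergent_shuffles (slot v i)"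
proof (cases "v i = 1")
  case True
  then have "slot v i = {offset v i + 1}" unfolding slot_def by simp
  moreover have "\<not> {a..b} \<subseteq> {c}" if "a < b" for a b c :: nat
  proof
    assume "{a..b} \<subseteq> {c}"
    then have "a \<in> {c}" "b \<in> {c}" using that by (meson atLeastAtMost_iff less_imp_le order_refl subsetD)+
    then show False using that by simp
  qed
  ultimately show ?thesis
    using True unfolding convergent_shuffles_def replacement_def by (auto simp: words_on_singleton)
next
  case False
  then have "V i \<in> convergent_shuffles {1..v i}" using assms by simp
  then show ?thesis
    unfolding slot_eq_image replacement_def using False by (simp only: shift_convergent_shuffles if_False)
qed

lemma convergent_shuffles_slot_span:
  assumes "1 \<le> v i" and "1 < v i \<Longrightarrow> convergent_shuffles {1..v i} \<subseteq> lc.span (Lset (v i))"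
  shows "convergent_shuffles (slot v i) \<subseteq> lc.span (slot_insertions v i)"
proof
  fix x assume x: "x \<in> convergent_shuffles (slot v i)"
  then have kx: "supp x \<subseteq> words_on (slot v i)" unfolding convergent_shuffles_def by simp
  show "x \<in> lc.span (slot_insertions v i)"
  proof (cases "v i = 1")
    case True
    let ?w = "[offset v i + 1]"
    have "words_on (slot v i) = {?w}" using True unfolding slot_def by (simp add: words_on_singleton)
    then have "x = (\<Sum>b\<in>{?w}. lc_scale (coeff x b) (bvec b))" using kx by (intro lc_expand) auto
    moreover have "bvec ?w \<in> slot_insertions v i"
      unfolding slot_insertions_def replacement_def using True by auto
    then have "(\<Sum>b\<in>{?w}. lc_scale (coeff x b) (bvec b)) \<in> lc.span (slot_insertions v i)"
      by (intro lc.span_sum lc.span_scale lc.span_base) simp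
    ultimately show ?thesis by (rule ssubst)
  next
    case False
    let ?l = "offset v i"
    define z where "z = rename (\<lambda>a. a - ?l) x"
    have "z \<in> convergent_shuffles {1..v i}"
      unfolding z_def by (rule unshift_convergent_shuffles) (use x in \<open>simp only: slot_eq_image\<close>)
    then have zs: "z \<in> lc.span (Lset (v i))" using assms False by auto
    have "rename (\<lambda>a. a + ?l) z \<in> lc.span (slot_insertions v i)"
    proof (rule lin_span_into[OF _ zs])
      show "lin (rename (\<lambda>a. a + ?l))" unfolding rename_def by (rule lin_lin_ext)
      fix s assume "s \<in> Lset (v i)"
      then have "replacement v (\<lambda>_. s) i \<in> slot_insertions v i" unfolding slot_insertions_def by blast
      moreover have "replacement v (\<lambda>_. s) i = rename (\<lambda>a. a + ?l) s" using False by (simp add: replacement_def)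
      ultimately show "rename (\<lambda>a. a + ?l) s \<in> lc.span (slot_insertions v i)" by (simp add: lc.span_base)
    qed
    moreover have "rename (\<lambda>a. a + ?l) z = x"
      unfolding z_def by (rule rename_inverse[OF kx]) (auto simp: slot_def)
    ultimately show ?thesis by simp
  qed
qed

lemma card_interval_ge_2: "distinct B \<Longrightarrow> set B = {i..j} \<Longrightarrow> 2 \<le> length B \<longleftrightarrow> i < (j::nat)"
  using distinct_card[of B] by auto

lemma lyndon_insertion_scheme:
  assumes y: "convergent_lyndon_shuffle k y" and k: "2 \<le> k"
    and v: "\<forall>i\<in>{1..k}. 1 \<le> v i" "(\<Sum>i\<in>{1..k}. v i) = n"
  shows "insertion_scheme n k v y" and "\<And>A. A \<in> set y \<Longrightarrow> set A \<noteq> {1..k}"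
proof -
  have y': "2 \<le> length y" "distinct (concat y)" "set (concat y) = {1..k}" "\<And>A. A \<in> set y \<Longrightarrow> A \<noteq> []"
    using y unfolding convergent_lyndon_shuffle_def lyndon_shuffle_def words_on_def by simp_all
  have y'5: "set B \<noteq> {i..j}" if "A \<in> set y" "A = u @ B @ w" "2 \<le> length B" for A u B w i j
    using y that unfolding convergent_lyndon_shuffle_def by blast
  show whole: "set A \<noteq> {1..k}" if A: "A \<in> set y" for A
  proof
    assume sA: "set A = {1..k}"
    have "2 \<le> length A" using distinct_card[of A] sA k y'(2) A by (simp add: distinct_concat_iff)
    then show False using y'5[OF A, of "[]" A "[]" 1 k] sA by simp
  qed
  have "\<not> factor_block T y" if T: "proper_interval k T" for T
  proof
    assume "factor_block T y"
    then obtain A u B w where A: "A \<in> set y" "A = u @ B @ w" "set B = T" unfolding factor_block_def by blast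
    obtain i j where ij: "i < j" "T = {i..j}" using T unfolding proper_interval_def by blast
    have "distinct B" using A(1,2) y'(2) by (auto simp: distinct_concat_iff)
    then have "2 \<le> length B" using card_interval_ge_2[of B i j] A(3) ij by simp
    then show False using y'5[OF A(1,2)] A(3) ij(2) by blast
  qed
  then show "insertion_scheme n k v y"
    unfolding insertion_scheme_def using k v whole y'(2,3) by (auto simp: words_on_def simp del: set_concat)
qed

lemma keys_insert_lc:
  assumes "xs \<in> supp (insert_lc k v y \<sigma>)"
  obtains p where "p \<in> fillings k v" and "xs = subst_letters p y"
  using assms coeff_insert_lc_0[of xs y k v \<sigma>] unfolding in_keys_iff by blast

lemma subst_letters_words_on:
  assumes y: "concat y \<in> words_on {1..k}" and v: "(\<Sum>i\<in>{1..k}. v i) = n" and p: "p \<in> fillings k v"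
  shows "concat (subst_letters p y) \<in> words_on {1..n}"
proof -
  have sy: "set (concat y) = {1..k}" "distinct (concat y)" using y unfolding words_on_def by auto
  have "set (concat (map p (concat y))) = (\<Union>i\<in>{1..k}. slot v i)"
    using fillings_set[OF p] unfolding sy(1)[symmetric] by auto
  then show ?thesis
    unfolding concat_subst_letters words_on_def slot_UN v using distinct_concat_filling[OF p] sy by blast
qed

text \<open>
  The interval of all letters, which is not tested for families, imposes no condition here: it is not a
  block of any factor.
\<close>

lemma lin_ext_factor_shuffle_convergent:
  assumes c: "convergent_family m c"
    and keys: "\<And>xs. xs \<in> supp c \<Longrightarrow> concat xs \<in> words_on {1..m}"
    and whole: "\<And>xs A. xs \<in> supp c \<Longrightarrow> A \<in> set xs \<Longrightarrow> set A \<noteq> {1..m}"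
  shows "lin_ext factor_shuffle c \<in> convergent_shuffles {1..m}"
proof -
  have d: "distinct (concat xs)" if "xs \<in> supp c" for xs
    using keys[OF that] unfolding words_on_def by simp
  have "supp (lin_ext factor_shuffle c) \<subseteq> words_on {1..m}"
  proof
    fix w assume "w \<in> supp (lin_ext factor_shuffle c)"
    then obtain xs where xs: "xs \<in> supp c" "coeff (factor_shuffle xs) w \<noteq> 0"
      by (rule keys_lin_ext)
    then have "interleaves xs w" using coeff_factor_shuffle[OF d[OF xs(1)]] by (metis)
    then show "w \<in> words_on {1..m}" using keys[OF xs(1)] unfolding interleaves_def words_on_def by auto
  qed
  moreover have "word_converges_along {i..j} (lin_ext factor_shuffle c)" if ij: "i < j" "{i..j} \<subseteq> {1..m}" for i j
  proof (rule word_converges_of_converges[OF _ _ _ d])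
    show "converges_along {i..j} c"
    proof (cases "{i..j} = {1..m}")
      case False
      then have "proper_interval m {i..j}" using ij unfolding proper_interval_def by auto
      then show ?thesis using c unfolding convergent_family_def by blast
    next
      case True
      have "coeff c (Xs @ (u @ B @ w) # Ys) = 0" if B: "B \<in> words_on {1..m}" for Xs u B w Ys
      proof (rule ccontr)
        assume "coeff c (Xs @ (u @ B @ w) # Ys) \<noteq> 0"
        then have k: "Xs @ (u @ B @ w) # Ys \<in> supp c" by (simp add: in_keys_iff)
        have "set (u @ B @ w) = {1..m}" using keys[OF k] B unfolding words_on_def by auto
        then show False using whole[OF k, of "u @ B @ w"] by simp
      qed
      then show ?thesis unfolding converges_along_def True by simp
    qed
  qed (use ij in auto)
  ultimately show ?thesis unfolding convergent_shuffles_def by blast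
qed

lemma Lset_convergent: "(m, x) \<in> lyndon_insertions \<Longrightarrow> x \<in> convergent_shuffles {1..m}"
proof (induction m x rule: lyndon_insertions.induct)
  case two
  let ?c = "bvec [[1], [2::nat]]"
  have "lin_ext factor_shuffle ?c \<in> convergent_shuffles {1..2}"
  proof (rule lin_ext_factor_shuffle_convergent)
    show "convergent_family 2 ?c" unfolding convergent_family_def proper_interval_def by auto
    fix xs assume "xs \<in> supp ?c"
    then have xs: "xs = [[1], [2]]" by simp
    show "concat xs \<in> words_on {1..2}" unfolding xs words_on_def by auto
    show "set A \<noteq> {1..2}" if "A \<in> set xs" for A
    proof -
      have "card (set A) = 1" using that unfolding xs by auto
      then show ?thesis by auto
    qed
  qed
  moreover have "factor_shuffle [[1], [2::nat]] = shuffle_word [1] [2]"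
    by (simp add: factor_shuffle_def shuffle_list_def shuffle_def shuffle_word_def)
  ultimately show ?case by simp
next
  case (insertion k As v m V)
  have k: "2 \<le> k" using insertion.hyps(1) by simp
  note scheme = lyndon_insertion_scheme[OF insertion.hyps(2) k insertion.hyps(3,4)]
  have As: "concat As \<in> words_on {1..k}" using scheme(1) unfolding insertion_scheme_def by simp
  have \<sigma>: "replacement v V i \<in> convergent_shuffles (slot v i)" if "i \<in> {1..k}" for i
    by (rule replacement_convergent) (use insertion that in auto)
  have "lin_ext factor_shuffle (insert_lc k v As (replacement v V)) \<in> convergent_shuffles {1..m}"
  proof (rule lin_ext_factor_shuffle_convergent)
    show "convergent_family m (insert_lc k v As (replacement v V))"
      by (rule insert_lc_convergent[OF scheme(1) \<sigma>])
    fix xs assume "xs \<in> supp (insert_lc k v As (replacement v V))"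
    then obtain p where p: "p \<in> fillings k v" "xs = subst_letters p As" by (rule keys_insert_lc)
    show "concat xs \<in> words_on {1..m}"
      unfolding p(2) by (rule subst_letters_words_on[OF As insertion.hyps(4) p(1)])
    show "set A \<noteq> {1..m}" if A: "A \<in> set xs" for A
    proof
      assume sA: "set A = {1..m}"
      obtain A' where A': "A' \<in> set As" "A = concat (map p A')" using A unfolding p(2) subst_letters_def by auto
      have "set A' \<subseteq> {1..k}" using As A'(1) unfolding words_on_def by auto
      moreover have "{1..k} \<subseteq> set A'"
      proof
        fix i assume i: "i \<in> {1..k}"
        obtain a where a: "a \<in> slot v i" using slot_nonempty[of v i] insertion.hyps(3) i by auto
        then have "a \<in> set A" using slot_subset[OF scheme(1) i] sA by auto
        then obtain j where j: "j \<in> set A'" "a \<in> set (p j)" using A'(2) by auto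
        then have "j \<in> {1..k}" using \<open>set A' \<subseteq> {1..k}\<close> by blast
        then have "i = j" using slot_disjoint[of i j a v] i a j fillings_set[OF p(1), of j] by auto
        then show "i \<in> set A'" using j(1) by simp
      qed
      ultimately show False using scheme(2)[OF A'(1)] by blast
    qed
  qed
  moreover have "lin_ext factor_shuffle (insert_lc k v As (replacement v V)) =
      shuffle_list (map (subst_word (replacement v V)) As)"
    by (rule factor_shuffle_insert_lc[OF As]) (use \<sigma> in \<open>auto simp: convergent_shuffles_def\<close>)
  ultimately show ?case by simp
qed

lemma replacement_Lset_convergent:
  assumes "1 \<le> v i" and "1 < v i \<Longrightarrow> V i \<in> Lset (v i)"
  shows "replacement v V i \<in> convergent_shuffles (slot v i)"
proof (rule replacement_convergent)
  show "1 \<le> v i" by (rule assms(1))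
  show "V i \<in> convergent_shuffles {1..v i}" if "1 < v i"
    by (rule Lset_convergent) (use assms(2)[OF that] in \<open>simp add: Lset_def\<close>)
qed

text \<open>
  In a convergent combination of Lyndon shuffles no factor begins with a block: in the contexts
  concerned only words with one and the same first letter occur, and these are linearly independent
  modulo shuffles. For the block of all letters this says that there are at least two factors.
\<close>

lemma no_initial_block:
  fixes c :: "nat list list lc"
  assumes c: "converges_along T c" and keys: "supp c \<subseteq> lyndon_lists D"
    and x: "Xs @ (B @ w) # Ys \<in> supp c" and B: "set B = T" "T \<noteq> {}"
  shows False
proof -
  have lyn: "hd (B' @ w) = Min (set B')"
    if "Xs @ (B' @ w) # Ys \<in> supp c" "B' \<noteq> []" for B'
  proof -
    have "\<forall>a\<in>set (B' @ w). hd (B' @ w) \<le> a" using keys that(1) unfolding lyndon_lists_def lyndon_list_def by auto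
    then have "\<forall>a\<in>set B'. hd B' \<le> a" "hd B' \<in> set B'" using that(2) by auto
    then have "Min (set B') = hd B'" by (intro Min_eqI) auto
    then show ?thesis using that(2) by simp
  qed
  have Bne: "B \<noteq> []" using B by auto
  have "distinct B" using keys x unfolding lyndon_lists_def words_on_def by auto
  then have Bw: "B \<in> words_on T" using B(1) unfolding words_on_def by simp
  obtain f where f: "kills_shuffles T f" "f B \<noteq> 0"
    "\<And>B'. B' \<in> words_on T \<Longrightarrow> hd B' = hd B \<Longrightarrow> B' \<noteq> B \<Longrightarrow> f B' = 0"
    by (rule functional_isolating_hd[OF Bw Bne]) blast
  have "coeff c (Xs @ ([] @ B' @ w) # Ys) * f B' = (if B' = B then coeff c (Xs @ (B @ w) # Ys) * f B else 0)"
    if B': "B' \<in> words_on T" for B'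
  proof (cases "B' = B \<or> Xs @ (B' @ w) # Ys \<notin> supp c")
    case True
    then show ?thesis by (auto simp: in_keys_iff)
  next
    case False
    have sB': "set B' = set B" using B' B(1) unfolding words_on_def by simp
    then have "B' \<noteq> []" using Bne by auto
    then have "hd B' = hd B" using lyn[of B'] lyn[OF x Bne] False sB' Bne by simp
    then show ?thesis using f(3)[OF B'] False by simp
  qed
  then have "(\<Sum>B'\<in>words_on T. coeff c (Xs @ ([] @ B' @ w) # Ys) * f B') =
      (\<Sum>B'\<in>words_on T. if B' = B then coeff c (Xs @ (B @ w) # Ys) * f B else 0)"
    by (intro sum.cong refl)
  also have "\<dots> = coeff c (Xs @ (B @ w) # Ys) * f B"
    using Bw B(1) by (auto simp: sum.delta)
  also have "\<dots> \<noteq> 0" using x f(2) by (simp add: in_keys_iff)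
  finally show False using c f(1) unfolding converges_along_def by blast
qed

text \<open>
  The order of the slots is that of the letters which they replace, so that first letters of factors
  remain smallest when words are contracted.
\<close>

lemma lyndon_scheme_of_block_free:
  assumes x: "lyndon_list (subst_letters p y)" and p: "p \<in> fillings k v"
    and y: "concat y \<in> words_on {1..k}" "\<forall>i\<in>{1..k}. 1 \<le> v i" "\<And>T. proper_interval k T \<Longrightarrow> \<not> factor_block T y"
    and len: "2 \<le> length y"
  shows "convergent_lyndon_shuffle k y"
proof -
  have pne: "p i \<noteq> []" if "i \<in> {1..k}" for i
    using fillings_set[OF p that] slot_nonempty[of v i] y(2) that by auto
  have lA: "A \<noteq> []" "\<forall>a\<in>set (concat (map p A)). hd (concat (map p A)) \<le> a" if "A \<in> set y" for A
  proof -
    have "concat (map p A) \<in> set (subst_letters p y)" using that unfolding subst_letters_def by simp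
    then have "concat (map p A) \<noteq> []" "\<forall>a\<in>set (concat (map p A)). hd (concat (map p A)) \<le> a"
      using x unfolding lyndon_list_def by blast+
    then show "A \<noteq> []" "\<forall>a\<in>set (concat (map p A)). hd (concat (map p A)) \<le> a" by auto
  qed
  have Ak: "set A \<subseteq> {1..k}" "distinct A" if "A \<in> set y" for A
    using y(1) that unfolding words_on_def by (auto simp: distinct_concat_iff)
  have hdA: "hd A = Min (set A)" if A: "A \<in> set y" for A
  proof (rule Min_eqI[symmetric])
    show "hd A \<in> set A" using lA(1)[OF A] by simp
    fix a assume a: "a \<in> set A"
    show "hd A \<le> a"
    proof (rule ccontr)
      assume "\<not> hd A \<le> a"
      then have less: "a < hd A" by simp
      have k: "a \<in> {1..k}" "hd A \<in> {1..k}" using Ak(1)[OF A] a lA(1)[OF A] hd_in_set by blast+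
      obtain A' where A': "A = hd A # A'" using lA(1)[OF A] by (cases A) auto
      have "hd (concat (map p A)) = hd (p (hd A))"
        using A' pne[OF k(2)] by (metis concat.simps(2) hd_append2 list.simps(9))
      moreover have "hd (p (hd A)) \<in> slot v (hd A)" using fillings_set[OF p k(2)] pne[OF k(2)] hd_in_set by blast
      moreover obtain b where b: "b \<in> set (p a)" using pne[OF k(1)] by (metis hd_in_set)
      moreover have "b \<in> slot v a" using b fillings_set[OF p k(1)] by blast
      moreover have "b \<in> set (concat (map p A))" using b a by auto
      ultimately show False using slot_less[of a "hd A" b v "hd (p (hd A))"] less k lA(2)[OF A] by fastforce
    qed
  qed simp
  have noblk: False if A: "A \<in> set y" "A = us @ B @ vs" "2 \<le> length B" "set B = {i..j}" for A us B vs i j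
  proof -
    have ij: "i < j" using card_interval_ge_2[of B i j] A Ak(2)[OF A(1)] by auto
    have sub: "{i..j} \<subseteq> {1..k}" using A(2,4) Ak(1)[OF A(1)] by auto
    have blk: "factor_block {i..j} y" unfolding factor_block_def using A by blast
    show False
    proof (cases "{i..j} = {1..k}")
      case False
      then have "proper_interval k {i..j}" unfolding proper_interval_def using ij sub by auto
      then show False using y(3) blk by blast
    next
      case True
      then have sA: "set A = {1..k}" using A(2,4) Ak(1)[OF A(1)] by auto
      obtain ys zs where yz: "y = ys @ A # zs" using A(1) by (meson split_list)
      then have "ys @ zs \<noteq> []" using len by auto
      then obtain A' where A': "A' \<in> set (ys @ zs)" by (metis hd_in_set)
      then have "A' \<noteq> []" "set A' \<subseteq> {1..k}" using lA(1)[of A'] Ak(1)[of A'] yz by auto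
      moreover have "set A' \<inter> set A = {}" using y(1) yz A' unfolding words_on_def by auto
      ultimately show False using sA by (metis inf.absorb1 set_empty)
    qed
  qed
  show ?thesis
    unfolding convergent_lyndon_shuffle_def lyndon_shuffle_def
    using len y(1) lA(1) hdA noblk by blast
qed

text \<open>
  Induction on the number of letters. A convergent combination is written in the Lyndon basis; its
  coefficients form a convergent family without initial blocks, hence one spanned by insertions into
  convergent Lyndon shuffles, where the first letter of each factor is replaced by a single letter. The
  induction hypothesis applies to the slots, as there are at least two of them.
\<close>

theorem convergent_shuffles_eq_span_Lset:
  assumes "2 \<le> m"
  shows "convergent_shuffles {1..m} = lc.span (Lset m)"
proof
  show "lc.span (Lset m) \<subseteq> convergent_shuffles {1..m}"
    using Lset_convergent by (intro lc.span_minimal subspace_convergent_shuffles) (auto simp only: Lset_def)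
  show "convergent_shuffles {1..m} \<subseteq> lc.span (Lset m)"
    using assms
  proof (induction m rule: less_induct)
    case (less m)
    show ?case
    proof
      fix x assume x: "x \<in> convergent_shuffles {1..m}"
      then have kx: "supp x \<subseteq> words_on {1..m}" unfolding convergent_shuffles_def by simp
      obtain c where c: "supp c \<subseteq> lyndon_lists {1..m}" "x = lin_ext factor_shuffle c"
        by (rule lyndon_shuffle_expansion[OF _ kx]) simp
      have conv: "converges_along {i..j} c" if "i < j" "{i..j} \<subseteq> {1..m}" for i j
        by (rule converges_of_word_converges[OF _ c(1) that(2)])
          (use that x c(2) in \<open>auto simp: convergent_shuffles_def\<close>)
      define adm where "adm k v y \<longleftrightarrow> convergent_lyndon_shuffle k y \<and> (\<forall>A\<in>set y. v (hd A) = 1)"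
        for k and v :: "nat \<Rightarrow> nat" and y
      define X where "X = {xs \<in> lyndon_lists {1..m}. 2 \<le> length xs}"
      have "c \<in> lc.span {insert_lc k v y \<sigma> | k v y \<sigma>.
          insertion_scheme m k v y \<and> adm k v y \<and> (\<forall>i\<in>{1..k}. \<sigma> i \<in> slot_insertions v i)}"
      proof (rule convergent_family_span)
        show "convergent_family m c"
          unfolding convergent_family_def proper_interval_def using conv by auto
        show "supp c \<subseteq> X"
        proof
          fix xs assume xs: "xs \<in> supp c"
          then have l: "xs \<in> lyndon_lists {1..m}" using c(1) by blast
          have "2 \<le> length xs"
          proof (rule ccontr)
            assume "\<not> 2 \<le> length xs"
            moreover have "xs \<noteq> []" using l less.prems unfolding lyndon_lists_def words_on_def by auto
            ultimately obtain B where B: "xs = [B]" by (cases xs; cases "tl xs") auto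
            have "set B = {1..m}" using l B unfolding lyndon_lists_def words_on_def by simp
            then show False
              using no_initial_block[OF conv[of 1 m] c(1), of "[]" B "[]" "[]"] xs B less.prems by auto
          qed
          then show "xs \<in> X" using l unfolding X_def by simp
        qed
      next
        fix c xs assume c': "convergent_family m c" "supp c \<subseteq> X" "xs \<in> supp c"
        then have xs: "xs \<in> lyndon_lists {1..m}" "2 \<le> length xs" unfolding X_def by auto
        have cm: "concat xs \<in> words_on {1..m}" using xs unfolding lyndon_lists_def by simp
        obtain k v y p where y: "2 \<le> k" "concat y \<in> words_on {1..k}" "\<forall>i\<in>{1..k}. 1 \<le> v i"
          "(\<Sum>i\<in>{1..k}. v i) = m" "\<And>T. proper_interval k T \<Longrightarrow> \<not> factor_block T y"
          "p \<in> fillings k v" "xs = subst_letters p y"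
          "\<And>i. i \<in> {1..k} \<Longrightarrow> 1 < v i \<Longrightarrow> proper_interval m (slot v i) \<and> factor_block (slot v i) xs"
          by (rule insertion_decomposition[OF cm less.prems]) blast
        have len: "2 \<le> length y" using xs(2) y(7) unfolding subst_letters_def by simp
        have lyn: "convergent_lyndon_shuffle k y"
          by (rule lyndon_scheme_of_block_free[OF _ y(6,2,3,5) len])
            (use xs(1) y(7) in \<open>simp_all add: lyndon_lists_def\<close>)
        have "v (hd A) = 1" if A: "A \<in> set y" for A
        proof (rule ccontr)
          assume "v (hd A) \<noteq> 1"
          obtain A' where A': "A = hd A # A'"
            using A lyn unfolding convergent_lyndon_shuffle_def lyndon_shuffle_def by (metis list.collapse)
          then have "hd A \<in> set A" by (metis list.set_intros(1))
          then have k: "hd A \<in> {1..k}" using A y(2) unfolding words_on_def by auto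
          then have "1 < v (hd A)" using y(3) \<open>v (hd A) \<noteq> 1\<close> by fastforce
          then have prp: "proper_interval m (slot v (hd A))" using y(8) k by blast
          obtain ys zs where "y = ys @ A # zs" using A by (meson split_list)
          then have "xs = subst_letters p ys @ (p (hd A) @ concat (map p A')) # subst_letters p zs"
            unfolding y(7) subst_letters_def using A' by (metis (no_types, lifting) concat.simps(2) list.simps(9) map_append)
          moreover have "converges_along (slot v (hd A)) c"
            using c'(1) prp unfolding convergent_family_def by blast
          moreover have "set (p (hd A)) = slot v (hd A)" "slot v (hd A) \<noteq> {}"
            using fillings_set[OF y(6) k] slot_nonempty[of v "hd A"] y(3) k by auto
          ultimately show False
            using no_initial_block[of "slot v (hd A)" c "{1..m}"] c'(2,3) unfolding X_def by blast
        qed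
        then show "\<exists>k v y p. insertion_scheme m k v y \<and> adm k v y \<and> p \<in> fillings k v \<and> xs = subst_letters p y"
          using lyndon_insertion_scheme(1)[OF lyn y(1,3,4)] lyn y(6,7) unfolding adm_def by blast
      next
        fix k v y i assume y: "insertion_scheme m k v y" and i: "i \<in> {1..k}"
        have v: "2 \<le> k" "\<forall>i\<in>{1..k}. 1 \<le> v i" "(\<Sum>i\<in>{1..k}. v i) = m"
          using y unfolding insertion_scheme_def by auto
        have "v i < m"
        proof -
          define l where "l = (if i = 1 then 2 else 1 :: nat)"
          have l: "l \<in> {1..k}" "l \<noteq> i" using v(1) unfolding l_def by auto
          have "v i + v l = (\<Sum>i\<in>{i, l}. v i)" using l by simp
          also have "\<dots> \<le> (\<Sum>i\<in>{1..k}. v i)" using l i by (intro sum_mono2) auto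
          finally show ?thesis using v l by fastforce
        qed
        then show "convergent_shuffles (slot v i) \<subseteq> lc.span (slot_insertions v i)"
          using v(2) i less.IH by (intro convergent_shuffles_slot_span) auto
      qed
      then have "x \<in> lc.span (Lset m)"
        unfolding c(2)
      proof (rule lin_span_into[OF lin_lin_ext])
        fix s assume "s \<in> {insert_lc k v y \<sigma> | k v y \<sigma>.
          insertion_scheme m k v y \<and> adm k v y \<and> (\<forall>i\<in>{1..k}. \<sigma> i \<in> slot_insertions v i)}"
        then obtain k v y \<sigma> where s: "s = insert_lc k v y \<sigma>" "insertion_scheme m k v y" "adm k v y"
          "\<forall>i\<in>{1..k}. \<sigma> i \<in> slot_insertions v i" by blast
        have y: "2 \<le> k" "\<forall>i\<in>{1..k}. 1 \<le> v i" "(\<Sum>i\<in>{1..k}. v i) = m" "concat y \<in> words_on {1..k}"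
          using s(2) unfolding insertion_scheme_def by auto
        obtain V where V: "\<forall>i\<in>{1..k}. \<sigma> i = replacement v V i \<and> (1 < v i \<longrightarrow> V i \<in> Lset (v i))"
          by (rule slot_insertions_choice[OF s(4)])
        have "supp (\<sigma> i) \<subseteq> words_on (slot v i)" if i: "i \<in> {1..k}" for i
        proof -
          have "replacement v V i \<in> convergent_shuffles (slot v i)"
            by (rule replacement_Lset_convergent) (use y(2) i V in auto)
          then show ?thesis using V i unfolding convergent_shuffles_def by simp
        qed
        then have "lin_ext factor_shuffle s = shuffle_list (map (subst_word \<sigma>) y)"
          unfolding s(1) by (rule factor_shuffle_insert_lc[OF y(4)])
        also have "map (subst_word \<sigma>) y = map (subst_word (replacement v V)) y"
          using V y(4) unfolding words_on_def by (intro map_cong refl subst_word_cong) auto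
        finally have e: "lin_ext factor_shuffle s = shuffle_list (map (subst_word (replacement v V)) y)" .
        have lyn: "convergent_lyndon_shuffle k y" "\<forall>A\<in>set y. v (hd A) = 1" using s(3) unfolding adm_def by auto
        have "(m, shuffle_list (map (subst_word (replacement v V)) y)) \<in> lyndon_insertions"
        proof (cases "3 \<le> k")
          case True
          then show ?thesis
            by (intro lyndon_insertions.insertion[of k y v m V]) (use lyn y V in \<open>auto simp: Lset_def\<close>)
        next
          case False
          \<comment> \<open>two letters, in two factors, none of them replaced by more than one letter\<close>
          then have k2: "k = 2" using y(1) by simp
          have y2: "2 \<le> length y" "\<And>A. A \<in> set y \<Longrightarrow> A \<noteq> []" "distinct (concat y)" "set (concat y) = {1..2}"
            using lyn(1) k2 unfolding convergent_lyndon_shuffle_def lyndon_shuffle_def words_on_def by auto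
          obtain A B ys where yAB: "y = A # B # ys"
            using y2(1) by (metis Suc_le_length_iff numeral_2_eq_2)
          have "length (concat y) = 2" using distinct_card[OF y2(3)] y2(4) by simp
          then have sum2: "length A + length B + length (concat ys) = 2" unfolding yAB by simp
          have "0 < length A" "0 < length B" using y2(2) unfolding yAB by simp_all
          with sum2 have len: "length A = 1" "length B = 1" "length (concat ys) = 0" by linarith+
          moreover have "ys = []"
          proof (rule ccontr)
            assume "ys \<noteq> []"
            then obtain C where C: "C \<in> set ys" by (metis hd_in_set)
            then have "C \<noteq> []" using y2(2) unfolding yAB by simp
            then show False using len(3) C by simp
          qed
          ultimately have len: "length A = 1" "length B = 1" "ys = []" by blast+
          then obtain a b where ab: "y = [[a], [b]]"
            unfolding yAB by (metis One_nat_def length_0_conv length_Suc_conv)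
          have vab: "v a = 1" "v b = 1" using lyn(2) unfolding ab by auto
          have e12: "{1..2} = {1, 2 :: nat}" by auto
          have sab: "{a, b} = {1, 2}" using y2(4) unfolding ab e12 by simp
          then have v1: "v 1 = 1" "v 2 = 1" using vab by (metis insertE insertI1 insertI2 singletonD)+
          then have m: "m = 2" using y(3) k2 by (simp add: numeral_2_eq_2)
          have rep: "replacement v V i = bvec [i]" if "i \<in> {1, 2}" for i
            using that v1 offset_Suc[of 1 v] unfolding replacement_def by (auto simp: numeral_2_eq_2)
          have sub: "subst_word (replacement v V) [i] = bvec [i]" if "i \<in> {1, 2}" for i
            by (simp only: subst_word_Cons rep[OF that]) (simp add: subst_word_def conc_def)
          have "a \<in> {1, 2}" "b \<in> {1, 2}" using sab by blast+
          then have "shuffle_list (map (subst_word (replacement v V)) y) = shuffle_word [a] [b]"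
            unfolding ab by (simp add: sub shuffle_list_def shuffle_def shuffle_word_def)
          also have "\<dots> = shuffle_word [1] [2]"
          proof -
            have "a = 1 \<and> b = 2 \<or> a = 2 \<and> b = 1" using sab by (metis doubleton_eq_iff)
            then show ?thesis unfolding shuffle_word_def by (auto simp: insert_commute)
          qed
          finally show ?thesis unfolding m using lyndon_insertions.two by simp
        qed
        then show "lin_ext factor_shuffle s \<in> lc.span (Lset m)"
          unfolding e by (intro lc.span_base) (simp add: Lset_def)
      qed
      then show "x \<in> lc.span (Lset m)" .
    qed
  qed
qed

section \<open>Residues of polygons\<close>

lemma cyc_append_commute: "cyc (A @ B) = cyc (B @ A)"
proof -
  have sub: "cyc (A @ B) \<subseteq> cyc (B @ A)" for A B :: "'a list"
  proof
    fix z assume "z \<in> cyc (A @ B)"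
    then obtain k where "z = rotate k (A @ B)" unfolding cyc_def by blast
    also have "A @ B = rotate (length B) (B @ A)" by (simp add: rotate_append)
    finally have "z = rotate (k + length B) (B @ A)" by (simp add: rotate_rotate)
    then show "z \<in> cyc (B @ A)" unfolding cyc_def by blast
  qed
  show ?thesis using sub[of A B] sub[of B A] by blast
qed

lemma mem_cyc_self: "w \<in> cyc w"
  unfolding cyc_def by (auto intro: exI[of _ 0])

lemma cyc_cut:
  assumes "z \<in> cyc L" and "L \<noteq> []"
  obtains m where "m < length L" and "z = drop m L @ take m L"
proof -
  obtain k where k: "z = rotate k L" using assms(1) unfolding cyc_def by blast
  show ?thesis
    by (rule that[of "k mod length L"]) (use assms(2) k in \<open>simp_all add: rotate_drop_take\<close>)
qed

lemma cyc_snoc_inject: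
  assumes eq: "cyc (w @ [z]) = cyc (w' @ [z])" and z: "z \<notin> set w'"
  shows "w = w'"
proof -
  let ?L = "w' @ [z]"
  have "w @ [z] \<in> cyc ?L" using mem_cyc_self[of "w @ [z]"] unfolding eq .
  then obtain m where m: "m < length ?L" "w @ [z] = drop m ?L @ take m ?L" by (rule cyc_cut) simp
  have "m = 0"
  proof (rule ccontr)
    assume "m \<noteq> 0"
    then have tk: "take m ?L = take m w'" "take m w' \<noteq> []" using m(1) by auto
    have "z = last (w @ [z])" by simp
    also have "\<dots> = last (take m w')" unfolding m(2) using tk by simp
    finally have "z \<in> set (take m w')" using tk(2) by (metis last_in_set)
    then show False using z by (meson in_set_takeD)
  qed
  then show ?thesis using m(2) by simp
qed

lemma map_Num_inject [simp]: "map Num u = map Num v \<longleftrightarrow> u = v"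
  by (rule inj_map_eq_map) (auto intro: injI)

lemma Num_image_inject [simp]: "Num ` A = Num ` B \<longleftrightarrow> A = B"
  by (rule inj_image_eq_iff) (auto intro: injI)

lemma is_block_close_d_iff:
  assumes "T \<noteq> {}"
  shows "is_block (Num ` T) (close_d w) \<longleftrightarrow> (\<exists>u B v. w = u @ B @ v \<and> set B = T)"
proof
  assume "\<exists>u B v. w = u @ B @ v \<and> set B = T"
  then obtain u B v where w: "w = u @ B @ v" "set B = T" by blast
  have "close_d w = cyc (map Num B @ (map Num v @ [Ltr_d] @ map Num u))"
    using cyc_append_commute[of "map Num u" "map Num B @ map Num v @ [Ltr_d]"]
    unfolding close_d_def w(1) by simp
  moreover have "map Num B @ (map Num v @ [Ltr_d] @ map Num u) \<in> cyc (map Num B @ (map Num v @ [Ltr_d] @ map Num u))"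
    by (rule mem_cyc_self)
  ultimately show "is_block (Num ` T) (close_d w)" unfolding is_block_def using w(2) by (metis set_map)
next
  assume "is_block (Num ` T) (close_d w)"
  then obtain A B' where A: "A @ B' \<in> close_d w" "set A = Num ` T" unfolding is_block_def by blast
  let ?L = "map Num w @ [Ltr_d]"
  obtain m where m: "m < length ?L" "A @ B' = drop m ?L @ take m ?L"
    using A(1) unfolding close_d_def by (rule cyc_cut) simp
  have dr: "drop m ?L = drop m (map Num w) @ [Ltr_d]" and tk: "take m ?L = take m (map Num w)" using m(1) by auto
  have "length A \<le> length (drop m (map Num w))"
  proof (rule ccontr)
    assume l: "\<not> length A \<le> length (drop m (map Num w))"
    have "drop m (map Num w) @ ([Ltr_d] @ take m ?L) = A @ B'" using m(2) dr by simp
    then obtain z where z: "A = drop m (map Num w) @ z" "[Ltr_d] @ take m ?L = z @ B'"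
      by (rule append_eq_append_longer) (use l in simp)
    have "z \<noteq> []" using l z(1) by auto
    then have "hd z = Ltr_d" using z(2) by (cases z) auto
    then have "Ltr_d \<in> set A" using z(1) \<open>z \<noteq> []\<close> by (metis Un_iff hd_in_set set_append)
    then show False using A(2) by auto
  qed
  moreover have "A @ B' = drop m (map Num w) @ ([Ltr_d] @ take m ?L)" using m(2) dr by simp
  ultimately obtain z where z: "drop m (map Num w) = A @ z" using append_eq_append_longer by metis
  have "map Num w = take m (map Num w) @ A @ z" using z append_take_drop_id[of m "map Num w"] by simp
  from iffD1[OF map_eq_append_conv this] obtain u r where r: "w = u @ r" "A @ z = map Num r" by blast
  from iffD1[OF map_eq_append_conv r(2)[symmetric]] obtain B v where "r = B @ v" "A = map Num B" by blast
  then have w: "w = u @ B @ v" "A = map Num B" using r(1) by simp_all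
  then have "set B = T" using A(2) by simp
  then show "\<exists>u B v. w = u @ B @ v \<and> set B = T" using w(1) by blast
qed

abbreviation inner_polygon :: "nat list \<Rightarrow> letter polygon" where
  "inner_polygon B \<equiv> cyc (map Num B @ [Ltr_e])"

abbreviation outer_polygon :: "nat list \<Rightarrow> nat list \<Rightarrow> letter polygon" where
  "outer_polygon u v \<equiv> cyc ((map Num v @ [Ltr_d] @ map Num u) @ [Ltr_e])"

lemma inner_polygon_inject: "inner_polygon B = inner_polygon B' \<longleftrightarrow> B = B'"
  using cyc_snoc_inject[of "map Num B" Ltr_e "map Num B'"] by auto

lemma outer_polygon_inject: "outer_polygon u v = outer_polygon u' v' \<longleftrightarrow> u = u' \<and> v = v'"
proof
  assume "outer_polygon u v = outer_polygon u' v'"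
  then have "map Num v @ [Ltr_d] @ map Num u = map Num v' @ [Ltr_d] @ map Num u'"
    by (rule cyc_snoc_inject) auto
  moreover have "Ltr_d \<notin> set (map Num v)" "Ltr_d \<notin> set (map Num u)" by auto
  ultimately show "u = u' \<and> v = v'"
    using append_Cons_eq_iff[of Ltr_d "map Num v" "map Num u" "map Num v'" "map Num u'"] by simp
qed simp

text \<open>
  Opening the polygon before \<open>B\<close> puts the block in front, as \<open>res_polygon_cyc\<close> requires.
\<close>

lemma res_polygon_close_d:
  assumes "distinct (u @ B @ v)" and "B \<noteq> []"
  shows "res_polygon (Num ` set B) (close_d (u @ B @ v)) = bvec (inner_polygon B, outer_polygon u v)"
proof -
  let ?A = "map Num B" and ?B = "map Num v @ [Ltr_d] @ map Num u"
  have "close_d (u @ B @ v) = cyc (?A @ ?B)"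
    using cyc_append_commute[of "map Num u" "map Num B @ map Num v @ [Ltr_d]"]
    unfolding close_d_def by simp
  moreover have "distinct (?A @ ?B)" using assms(1) by (auto simp: distinct_map intro: inj_onI)
  ultimately show ?thesis using res_polygon_cyc[of ?A ?B] assms(2) by simp
qed

lemma res_polygon_no_block:
  assumes "T \<noteq> {}" and "\<nexists>u B v. w = u @ B @ v \<and> set B = T"
  shows "res_polygon (Num ` T) (close_d w) = 0"
proof -
  have "\<not> is_block (Num ` T) (close_d w)" using assms(2) unfolding is_block_close_d_iff[OF assms(1)] .
  then show ?thesis unfolding res_polygon_def by (rule if_not_P)
qed

lemma res_polygon_of:
  "res T (polygon_of \<eta>) = (\<Sum>w\<in>supp \<eta>. lc_scale (coeff \<eta> w) (res_polygon T (close_d w)))"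
  unfolding res_def polygon_of_def lin_ext_def[of _ \<eta>] lin_sum[OF lin_lin_ext] lin_scale[OF lin_lin_ext]
    lin_ext_bvec ..

lemma coeff_res_polygon_of:
  assumes \<eta>: "supp \<eta> \<subseteq> words_on D" and B: "B \<in> words_on T" and T: "T \<noteq> {}"
  shows "coeff (res (Num ` T) (polygon_of \<eta>)) (inner_polygon B, outer_polygon u v) = coeff \<eta> (u @ B @ v)"
proof -
  have sB: "set B = T" using B unfolding words_on_def by simp
  have "coeff \<eta> w * coeff (res_polygon (Num ` T) (close_d w)) (inner_polygon B, outer_polygon u v) =
      (if w = u @ B @ v then coeff \<eta> w else 0)" if w: "w \<in> supp \<eta>" for w
  proof (cases "\<exists>u B v. w = u @ B @ v \<and> set B = T")
    case False
    then have "w \<noteq> u @ B @ v" using sB by blast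
    then show ?thesis using res_polygon_no_block[OF T False] by simp
  next
    case True
    then obtain u' B' v' where w': "w = u' @ B' @ v'" "set B' = T" by blast
    have "w \<in> words_on D" using w \<eta> by blast
    then have d: "distinct (u' @ B' @ v')" unfolding w'(1) words_on_def by simp
    have d2: "B' \<noteq> []" using w'(2) T by auto
    have "u' @ B' @ v' = u @ B @ v \<longleftrightarrow> u' = u \<and> B' = B \<and> v' = v"
      using append_block_unique[OF _ _ d, of u B v] d2 sB w'(2) by auto
    then have "coeff (bvec (inner_polygon B', outer_polygon u' v')) (inner_polygon B, outer_polygon u v) =
        (if w = u @ B @ v then 1 else 0)"
      unfolding coeff_bvec prod.inject inner_polygon_inject outer_polygon_inject w'(1) by auto
    then show ?thesis
      using res_polygon_close_d[OF d d2] unfolding w'(1)[symmetric] w'(2) by (cases "w = u @ B @ v") (simp_all only: if_True if_False mult_1_right mult_zero_right refl)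
  qed
  then have "coeff (res (Num ` T) (polygon_of \<eta>)) (inner_polygon B, outer_polygon u v) =
      (\<Sum>w\<in>supp \<eta>. if w = u @ B @ v then coeff \<eta> w else 0)"
    unfolding res_polygon_of coeff_sum lookup_lc_scale by (intro sum.cong refl)
  then show ?thesis by (simp add: sum.delta in_keys_iff)
qed

lemma coeff_tensor: "coeff (tensor x y) (a, b) = coeff x a * coeff y b"
proof -
  have "coeff (tensor x y) (a, b) = (\<Sum>a'\<in>supp x. coeff x a' *
      (\<Sum>b'\<in>supp y. coeff y b' * (if a' = a \<and> b' = b then 1 else 0)))"
    unfolding tensor_def bilin_ext_def lin_ext_def coeff_sum lookup_lc_scale coeff_bvec by simp
  also have "\<dots> = (\<Sum>a'\<in>supp x. if a' = a then coeff x a * coeff y b else 0)"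
  proof (intro sum.cong refl)
    fix a'
    have "(\<Sum>b'\<in>supp y. coeff y b' * (if a' = a \<and> b' = b then 1 else 0)) =
        (\<Sum>b'\<in>supp y. if b' = b then (if a' = a then coeff y b else 0) else 0)"
      by (intro sum.cong refl) auto
    also have "\<dots> = (if a' = a then coeff y b else 0)" by (simp add: sum.delta in_keys_iff)
    finally show "coeff x a' * (\<Sum>b'\<in>supp y. coeff y b' * (if a' = a \<and> b' = b then 1 else 0)) =
        (if a' = a then coeff x a * coeff y b else 0)" by simp
  qed
  also have "\<dots> = coeff x a * coeff y b" by (simp add: sum.delta in_keys_iff)
  finally show ?thesis .
qed

text \<open>
  Polygons through \<open>e\<close> correspond to words, so that functionals on words apply to polygons.
\<close>

lemma shuffle_space_killed:
  assumes T: "finite T" and f: "kills_shuffles T f" and x: "x \<in> shuffle_space (Num ` T)"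
  shows "(\<Sum>B\<in>words_on T. coeff x (inner_polygon B) * f B) = 0"
proof -
  let ?Z = "{x. (\<Sum>B\<in>words_on T. coeff x (inner_polygon B) * f B) = 0}"
  have "lc.subspace ?Z"
    unfolding lc.subspace_def
    by (auto simp: lookup_add distrib_right sum.distrib mult.assoc simp flip: sum_distrib_left)
  moreover have "(\<Sum>C\<in>words_on T. coeff (lin_ext (\<lambda>w. bvec (cyc (w @ [Ltr_e]))) (shuffle_word A B)) (inner_polygon C) * f C) = 0"
    if AB: "A \<noteq> []" "B \<noteq> []" "A @ B \<in> words_on (Num ` T)" for A B
  proof -
    have inj: "inj_on Num T" by (auto intro: inj_onI)
    have "set A \<subseteq> Num ` T" "set B \<subseteq> Num ` T" using AB(3) unfolding words_on_def by auto
    then obtain A' B' where A': "A = map Num A'" "B = map Num B'" using subset_image_map by metis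
    have "map Num (A' @ B') \<in> words_on (Num ` T)" using AB(3) A' by simp
    then have "map Num (A' @ B') \<in> map Num ` words_on T" unfolding words_on_image[OF inj] .
    then obtain z where z: "z \<in> words_on T" "map Num (A' @ B') = map Num z" by (rule imageE)
    then have AB': "A' @ B' \<in> words_on T" unfolding map_Num_inject by simp
    have "lin_ext (\<lambda>w. bvec (cyc (w @ [Ltr_e]))) (shuffle_word A B) = (\<Sum>w\<in>shuffles A B. bvec (cyc (w @ [Ltr_e])))"
      unfolding shuffle_word_def by (simp add: lin_sum[OF lin_lin_ext])
    also have "\<dots> = (\<Sum>w\<in>shuffles A' B'. bvec (inner_polygon w))"
      unfolding A' shuffles_map by (subst sum.reindex) (auto intro: inj_onI)
    finally have e: "lin_ext (\<lambda>w. bvec (cyc (w @ [Ltr_e]))) (shuffle_word A B) = (\<Sum>w\<in>shuffles A' B'. bvec (inner_polygon w))" .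
    have "coeff (\<Sum>w\<in>shuffles A' B'. bvec (inner_polygon w)) (inner_polygon C) = (if C \<in> shuffles A' B' then 1 else 0)" for C
    proof -
      have "coeff (\<Sum>w\<in>shuffles A' B'. bvec (inner_polygon w)) (inner_polygon C) = (\<Sum>w\<in>shuffles A' B'. if w = C then 1 else 0)"
        unfolding coeff_sum coeff_bvec inner_polygon_inject ..
      then show ?thesis by (simp add: sum.delta)
    qed
    then have "(\<Sum>C\<in>words_on T. coeff (lin_ext (\<lambda>w. bvec (cyc (w @ [Ltr_e]))) (shuffle_word A B)) (inner_polygon C) * f C) =
        (\<Sum>C\<in>words_on T. if C \<in> shuffles A' B' then f C else 0)"
      unfolding e by (intro sum.cong refl) simp
    also have "\<dots> = (\<Sum>C\<in>words_on T \<inter> shuffles A' B'. f C)" using T by (simp add: sum.inter_restrict)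
    also have "words_on T \<inter> shuffles A' B' = shuffles A' B'" using shuffles_words_on[OF AB'] by blast
    also have "(\<Sum>C\<in>shuffles A' B'. f C) = 0" using f AB(1,2) AB' A' unfolding kills_shuffles_def by simp
    finally show ?thesis .
  qed
  then have "{lin_ext (\<lambda>w. bvec (cyc (w @ [Ltr_e]))) (shuffle_word A B) | A B.
      A \<noteq> [] \<and> B \<noteq> [] \<and> A @ B \<in> words_on (Num ` T)} \<subseteq> ?Z" by blast
  ultimately have "shuffle_space (Num ` T) \<subseteq> ?Z" unfolding shuffle_space_def by (intro lc.span_minimal)
  then show ?thesis using x by blast
qed

lemma shuffle_span_into_shuffle_space:
  assumes "x \<in> shuffle_span T"
  shows "lin_ext (\<lambda>B. bvec (inner_polygon B)) x \<in> shuffle_space (Num ` T)"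
  unfolding shuffle_space_def
proof (rule lin_span_into[OF lin_lin_ext assms[unfolded shuffle_span_def]])
  fix s assume "s \<in> {shuffle_word A B | A B. A \<noteq> [] \<and> B \<noteq> [] \<and> A @ B \<in> words_on T}"
  then obtain A B where s: "s = shuffle_word A B" "A \<noteq> []" "B \<noteq> []" "A @ B \<in> words_on T" by blast
  have "lin_ext (\<lambda>w. bvec (cyc (w @ [Ltr_e]))) (shuffle_word (map Num A) (map Num B)) =
      (\<Sum>w\<in>map Num ` shuffles A B. bvec (cyc (w @ [Ltr_e])))"
    unfolding shuffle_word_def shuffles_map by (simp add: lin_sum[OF lin_lin_ext])
  also have "\<dots> = (\<Sum>w\<in>shuffles A B. bvec (inner_polygon w))"
    by (subst sum.reindex) (auto intro: inj_onI)
  also have "\<dots> = lin_ext (\<lambda>B. bvec (inner_polygon B)) s"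
    unfolding s(1) shuffle_word_def by (simp add: lin_sum[OF lin_lin_ext])
  finally have e: "lin_ext (\<lambda>B. bvec (inner_polygon B)) s =
      lin_ext (\<lambda>w. bvec (cyc (w @ [Ltr_e]))) (shuffle_word (map Num A) (map Num B))" ..
  have "inj_on Num T" by (auto intro: inj_onI)
  then have "map Num (A @ B) \<in> words_on (Num ` T)" using s(4) words_on_image by blast
  then show "lin_ext (\<lambda>B. bvec (inner_polygon B)) s \<in> lc.span {lin_ext (\<lambda>w. bvec (cyc (w @ [Ltr_e]))) (shuffle_word A B) | A B.
      A \<noteq> [] \<and> B \<noteq> [] \<and> A @ B \<in> words_on (Num ` T)}"
    unfolding e using s(2,3) by (intro lc.span_base CollectI exI[of _ "map Num A"] exI[of _ "map Num B"]) simp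
qed

text \<open>
  The polygons \<open>outer_polygon u v\<close> of different contexts are different, so that the residue lies in
  \<open>I\<^sub>T \<otimes> P\<close> iff for each context the combination of the inner polygons lies in \<open>I\<^sub>T\<close>.
\<close>

lemma residue_convergent_iff:
  assumes \<eta>: "supp \<eta> \<subseteq> words_on {1..n}" and T: "T \<subseteq> {1..n}" "T \<noteq> {}"
  shows "res (Num ` T) (polygon_of \<eta>) \<in> tensor_sub (shuffle_space (Num ` T))
           (free_on (polygons (Num ` ({1..n} - T) \<union> {Ltr_d, Ltr_e}))) \<longleftrightarrow> word_converges_along T \<eta>"
    (is "?res \<in> tensor_sub ?I ?P \<longleftrightarrow> _")
proof
  have fT: "finite T" using T(1) finite_subset by blast
  assume r: "?res \<in> tensor_sub ?I ?P"
  show "word_converges_along T \<eta>"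
    unfolding word_converges_along_def
  proof (intro allI impI)
    fix f u v assume f: "kills_shuffles T f"
    let ?Z = "{z. (\<Sum>B\<in>words_on T. coeff z (inner_polygon B, outer_polygon u v) * f B) = 0}"
    have "lc.subspace ?Z"
      unfolding lc.subspace_def
      by (auto simp: lookup_add distrib_right sum.distrib mult.assoc simp flip: sum_distrib_left)
    moreover have "tensor x y \<in> ?Z" if "x \<in> ?I" for x y
    proof -
      have "(\<Sum>B\<in>words_on T. coeff (tensor x y) (inner_polygon B, outer_polygon u v) * f B) =
          coeff y (outer_polygon u v) * (\<Sum>B\<in>words_on T. coeff x (inner_polygon B) * f B)"
        unfolding coeff_tensor sum_distrib_left by (intro sum.cong refl) (simp only: ac_simps)
      then show ?thesis using shuffle_space_killed[OF fT f that] by simp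
    qed
    ultimately have "tensor_sub ?I ?P \<subseteq> ?Z" unfolding tensor_sub_def by (intro lc.span_minimal) auto
    then have "(\<Sum>B\<in>words_on T. coeff ?res (inner_polygon B, outer_polygon u v) * f B) = 0" using r by blast
    moreover have "(\<Sum>B\<in>words_on T. coeff ?res (inner_polygon B, outer_polygon u v) * f B) =
        (\<Sum>B\<in>words_on T. coeff \<eta> (u @ B @ v) * f B)"
      by (intro sum.cong refl) (simp only: coeff_res_polygon_of[OF \<eta> _ T(2)])
    ultimately show "(\<Sum>B\<in>words_on T. coeff \<eta> (u @ B @ v) * f B) = 0" by simp
  qed
next
  have fT: "finite T" using T(1) finite_subset by blast
  assume conv: "word_converges_along T \<eta>"
  define C where "C = {(u, v). \<exists>B\<in>words_on T. u @ B @ v \<in> supp \<eta>}"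
  have "C \<subseteq> (\<Union>w\<in>supp \<eta>. (\<lambda>(i, j). (take i w, drop j w)) ` ({..length w} \<times> {..length w}))"
  proof
    fix uv assume "uv \<in> C"
    then obtain u v B where uv: "uv = (u, v)" "u @ B @ v \<in> supp \<eta>" unfolding C_def by blast
    have "(u, v) = (\<lambda>(i, j). (take i (u @ B @ v), drop j (u @ B @ v))) (length u, length (u @ B))" by simp
    then have "uv \<in> (\<lambda>(i, j). (take i (u @ B @ v), drop j (u @ B @ v))) ` ({..length (u @ B @ v)} \<times> {..length (u @ B @ v)})"
      unfolding uv(1) by (rule image_eqI) simp
    then show "uv \<in> (\<Union>w\<in>supp \<eta>. (\<lambda>(i, j). (take i w, drop j w)) ` ({..length w} \<times> {..length w}))"
      using uv(2) by blast
  qed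
  then have fC: "finite C" by (rule finite_subset) simp
  let ?g = "\<lambda>((u, v), B). u @ B @ v :: nat list"
  let ?S = "{s \<in> C \<times> words_on T. ?g s \<in> supp \<eta>}"
  have inj: "inj_on ?g ?S"
  proof (rule inj_onI)
    fix s s' assume s: "s \<in> ?S" "s' \<in> ?S" "?g s = ?g s'"
    obtain u v B u' v' B' where e: "s = ((u, v), B)" "s' = ((u', v'), B')" by (metis surj_pair)
    have sB: "set B' = T" "set B = T" "u @ B @ v \<in> words_on {1..n}"
      using s(1,2) \<eta> unfolding e words_on_def[of T] by auto
    then have b: "set B' = set B" "distinct (u @ B @ v)" "B \<noteq> []" using T(2) unfolding words_on_def by auto
    have "u @ B @ v = u' @ B' @ v'" using s(3) unfolding e by simp
    from append_block_unique[OF this b] show "s = s'" unfolding e by simp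
  qed
  have img: "?g ` ?S = {w \<in> supp \<eta>. \<exists>u B v. w = u @ B @ v \<and> set B = T}"
  proof (intro equalityI subsetI)
    fix w assume "w \<in> ?g ` ?S"
    then show "w \<in> {w \<in> supp \<eta>. \<exists>u B v. w = u @ B @ v \<and> set B = T}"
      unfolding words_on_def by auto
  next
    fix w assume "w \<in> {w \<in> supp \<eta>. \<exists>u B v. w = u @ B @ v \<and> set B = T}"
    then obtain u B v where w: "w \<in> supp \<eta>" "w = u @ B @ v" "set B = T" by blast
    have "u @ B @ v \<in> words_on {1..n}" using w \<eta> by blast
    then have "distinct B" unfolding words_on_def by simp
    then have B: "B \<in> words_on T" using w(3) unfolding words_on_def by simp
    then have "(u, v) \<in> C" unfolding C_def using w by blast
    then have "((u, v), B) \<in> ?S" using B w by simp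
    then show "w \<in> ?g ` ?S" using w(2) by (intro image_eqI[of _ _ "((u, v), B)"]) auto
  qed
  have "?res = (\<Sum>w\<in>?g ` ?S. lc_scale (coeff \<eta> w) (res_polygon (Num ` T) (close_d w)))"
    unfolding res_polygon_of img
    by (rule sum.mono_neutral_right) (use res_polygon_no_block[OF T(2)] in auto)
  also have "\<dots> = (\<Sum>s\<in>?S. lc_scale (coeff \<eta> (?g s)) (res_polygon (Num ` T) (close_d (?g s))))"
    by (subst sum.reindex[OF inj]) simp
  also have "\<dots> = (\<Sum>((u, v), B)\<in>?S. lc_scale (coeff \<eta> (u @ B @ v)) (bvec (inner_polygon B, outer_polygon u v)))"
  proof (intro sum.cong refl)
    fix s assume s: "s \<in> ?S"
    obtain u v B where e: "s = ((u, v), B)" by (metis surj_pair)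
    have "set B = T" "u @ B @ v \<in> words_on {1..n}" using s \<eta> unfolding e words_on_def[of T] by auto
    then have "set B = T" "B \<noteq> []" "distinct (u @ B @ v)" using T(2) unfolding words_on_def by auto
    then show "lc_scale (coeff \<eta> (?g s)) (res_polygon (Num ` T) (close_d (?g s))) =
        (\<lambda>((u, v), B). lc_scale (coeff \<eta> (u @ B @ v)) (bvec (inner_polygon B, outer_polygon u v))) s"
      using res_polygon_close_d[of u B v] unfolding e by simp
  qed
  also have "\<dots> = (\<Sum>((u, v), B)\<in>C \<times> words_on T. lc_scale (coeff \<eta> (u @ B @ v)) (bvec (inner_polygon B, outer_polygon u v)))"
    by (rule sum.mono_neutral_left) (use fC fT in \<open>auto simp: in_keys_iff\<close>)
  also have "\<dots> = (\<Sum>(u, v)\<in>C. \<Sum>B\<in>words_on T. lc_scale (coeff \<eta> (u @ B @ v)) (bvec (inner_polygon B, outer_polygon u v)))"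
    by (subst sum.cartesian_product[symmetric]) (simp add: case_prod_unfold)
  also have "\<dots> \<in> tensor_sub ?I ?P"
    unfolding tensor_sub_def
  proof (rule lc.span_sum, clarify)
    fix u v assume uv: "(u, v) \<in> C"
    define s where "s = (\<Sum>B\<in>words_on T. lc_scale (coeff \<eta> (u @ B @ v)) (bvec B))"
    have cs: "coeff s B = (if B \<in> words_on T then coeff \<eta> (u @ B @ v) else 0)" for B
      unfolding s_def by (rule coeff_sum_scale_bvec) (use fT in simp)
    have "s \<in> shuffle_span T"
    proof (subst mem_shuffle_span_iff[OF fT])
      show "supp s \<subseteq> words_on T" by (auto simp: in_keys_iff cs split: if_splits)
      show "\<forall>f. kills_shuffles T f \<longrightarrow> (\<Sum>w\<in>words_on T. coeff s w * f w) = 0"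
        using conv unfolding word_converges_along_def by (simp add: cs)
    qed
    then have sI: "lin_ext (\<lambda>B. bvec (inner_polygon B)) s \<in> ?I" by (rule shuffle_span_into_shuffle_space)
    obtain B where B: "B \<in> words_on T" "u @ B @ v \<in> words_on {1..n}" using uv \<eta> unfolding C_def by blast
    have "set u \<union> set v = {1..n} - T" "distinct (u @ v)" using B unfolding words_on_def by auto
    then have "(map Num v @ [Ltr_d] @ map Num u) @ [Ltr_e] \<in> words_on (Num ` ({1..n} - T) \<union> {Ltr_d, Ltr_e})"
      unfolding words_on_def by (auto simp: distinct_map intro: inj_onI simp flip: image_Un)
    then have oP: "bvec (outer_polygon u v) \<in> ?P"
      unfolding free_on_def polygons_def by (intro lc.span_base imageI)
    have "(\<Sum>B\<in>words_on T. lc_scale (coeff \<eta> (u @ B @ v)) (bvec (inner_polygon B, outer_polygon u v))) =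
        tensor (lin_ext (\<lambda>B. bvec (inner_polygon B)) s) (bvec (outer_polygon u v))"
      unfolding s_def tensor_def lin_sum[OF lin_lin_ext] lin_scale[OF lin_lin_ext] lin_ext_bvec
        lin_sum[OF lin_bilin_ext_left] lin_scale[OF lin_bilin_ext_left] bilin_ext_bvec ..
    then show "(\<Sum>B\<in>words_on T. lc_scale (coeff \<eta> (u @ B @ v)) (bvec (inner_polygon B, outer_polygon u v)))
        \<in> lc.span {tensor x y | x y. x \<in> ?I \<and> y \<in> ?P}"
      using sI oP by (intro lc.span_base) auto
  qed
  finally show "?res \<in> tensor_sub ?I ?P" .
qed

lemma convergent_polygon_iff:
  assumes \<eta>: "supp \<eta> \<subseteq> words_on {1..n}"
  shows "convergent_polygon n (polygon_of \<eta>) \<longleftrightarrow> (\<forall>T. proper_interval n T \<longrightarrow> word_converges_along T \<eta>)"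
proof -
  have iff: "1 \<le> i \<and> j \<le> n \<and> 2 \<le> card {i..j} \<and> card {i..j} \<le> n - 1 \<longleftrightarrow>
      1 \<le> i \<and> i < j \<and> j \<le> n \<and> {i..j} \<noteq> {1..n}" for i j
  proof -
    have "i < j \<Longrightarrow> {i..j} \<noteq> {1..n} \<longleftrightarrow> \<not> (i = 1 \<and> j = n)" by auto
    then show ?thesis by (cases "i < j") (auto simp: card_atLeastAtMost)
  qed
  have "convergent_polygon n (polygon_of \<eta>) \<longleftrightarrow>
      (\<forall>i j. 1 \<le> i \<and> i < j \<and> j \<le> n \<and> {i..j} \<noteq> {1..n} \<longrightarrow> word_converges_along {i..j} \<eta>)"
    unfolding convergent_polygon_def iff
  proof (intro all_cong1 imp_cong refl)
    fix i j assume "1 \<le> i \<and> i < j \<and> j \<le> n \<and> {i..j} \<noteq> {1..n}"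
    then show "res (Num ` {i..j}) (polygon_of \<eta>) \<in> tensor_sub (shuffle_space (Num ` {i..j}))
         (free_on (polygons (Num ` ({1..n} - {i..j}) \<union> {Ltr_d, Ltr_e}))) \<longleftrightarrow> word_converges_along {i..j} \<eta>"
      by (intro residue_convergent_iff[OF \<eta>]) auto
  qed
  then show ?thesis unfolding proper_interval_def by blast
qed

section \<open>Convergent combinations of 1n-words\<close>

lemma close_d_block_complement:
  assumes w: "w \<in> words_on {1..n}" and R: "R \<subseteq> Num ` {1..n} \<union> {Ltr_d}" and blk: "is_block R (close_d w)"
  shows "is_block (Num ` {1..n} \<union> {Ltr_d} - R) (close_d w)"
proof -
  obtain A B where AB: "A @ B \<in> close_d w" "set A = R" using blk unfolding is_block_def by blast
  let ?L = "map Num w @ [Ltr_d]"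
  obtain k where k: "A @ B = rotate k ?L" using AB(1) unfolding close_d_def cyc_def by blast
  have L: "distinct ?L" "set ?L = Num ` {1..n} \<union> {Ltr_d}"
    using w unfolding words_on_def by (auto simp: distinct_map intro: inj_onI)
  have d: "distinct (A @ B)" "set (A @ B) = Num ` {1..n} \<union> {Ltr_d}"
    unfolding k using L by simp_all
  have "B @ A \<in> close_d w"
  proof -
    have "B @ A = rotate (length A + k) ?L" using k by (metis rotate_append rotate_rotate)
    then show ?thesis unfolding close_d_def cyc_def by blast
  qed
  moreover have "set B = Num ` {1..n} \<union> {Ltr_d} - R" using d AB(2) by auto
  ultimately show ?thesis unfolding is_block_def by blast
qed

lemma block_of_upt:
  assumes "[1..<n+1] = u @ B @ v" and "B \<noteq> []"
  shows "set B = {length u + 1..length u + length B}" and "length u + length B \<le> n"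
proof -
  have len: "length u + (length B + length v) = n"
    using arg_cong[OF assms(1), of length] by (simp del: upt_Suc)
  then show "length u + length B \<le> n" by simp
  have "B = take (length B) (drop (length u) [1..<n+1])" unfolding assms(1) by simp
  also have "\<dots> = [length u + 1..<length u + length B + 1]"
    using len by (simp add: take_upt drop_upt del: upt_Suc)
  finally have "set B = set [length u + 1..<length u + length B + 1]" by simp
  then show "set B = {length u + 1..length u + length B}" by auto
qed

text \<open>
  Passing to complements if necessary, one may assume that the block does not contain \<open>d\<close>; the
  blocks of \<open>(1, \<dots>, n, d)\<close> of this kind are the intervals.
\<close>

lemma special_convergent_iff:
  assumes w: "w \<in> words_on {1..n}"
  shows "special_convergent n w \<longleftrightarrow> (\<forall>T. proper_interval n T \<longrightarrow> \<not> factor_block T [w])"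
proof -
  have fb: "factor_block T [w] \<longleftrightarrow> is_block (Num ` T) (close_d w)" if "T \<noteq> {}" for T
    unfolding is_block_close_d_iff[OF that] factor_block_def by auto
  have std: "[1..<n+1] \<in> words_on {1..n}" unfolding words_on_def by auto
  have card_Num: "card (Num ` T) = card T" for T by (rule card_image) (auto intro: inj_onI)
  show ?thesis
  proof
    assume s: "special_convergent n w"
    show "\<forall>T. proper_interval n T \<longrightarrow> \<not> factor_block T [w]"
    proof (intro allI impI notI)
      fix T assume T: "proper_interval n T" "factor_block T [w]"
      obtain i j where ij: "1 \<le> i" "i < j" "j \<le> n" "T = {i..j}" "T \<noteq> {1..n}" using T(1) unfolding proper_interval_def by blast
      have Tne: "T \<noteq> {}" using ij by auto
      have "[1..<n+1] = [1..<i] @ [i..<j+1] @ [j+1..<n+1]"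
        using ij upt_add_eq_append[of 1 i "n + 1 - i"] upt_add_eq_append[of i "j + 1" "n - j"]
        by (simp add: less_imp_le del: upt_Suc)
      moreover have "set [i..<j+1] = T" using ij by auto
      ultimately have "is_block (Num ` T) (close_d [1..<n+1])"
        unfolding is_block_close_d_iff[OF Tne] by blast
      moreover have "is_block (Num ` T) (close_d w)" using T(2) fb[OF Tne] by simp
      moreover have "Num ` T \<subseteq> Num ` {1..n} \<union> {Ltr_d}" using ij by auto
      moreover have "2 \<le> card (Num ` T)" "card (Num ` T) \<le> n - 1"
      proof -
        have "card T < card {1..n}" by (rule psubset_card_mono) (use ij in auto)
        then show "2 \<le> card (Num ` T)" "card (Num ` T) \<le> n - 1" unfolding card_Num using ij by auto
      qed
      ultimately show False using s unfolding special_convergent_def by blast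
    qed
  next
    assume no: "\<forall>T. proper_interval n T \<longrightarrow> \<not> factor_block T [w]"
    have no_d: False
      if R: "R \<subseteq> Num ` {1..n} \<union> {Ltr_d}" "2 \<le> card R" "card R \<le> n - 1" "is_block R (close_d w)"
        "is_block R (close_d [1..<n+1])" "Ltr_d \<notin> R" for R
    proof -
      define T where "T = {a. Num a \<in> R}"
      have RT: "R = Num ` T" using R(1,6) unfolding T_def by auto
      have cT: "2 \<le> card T" "card T \<le> n - 1" using R(2,3) unfolding RT card_Num by auto
      then have Tne: "T \<noteq> {}" by auto
      obtain u B v where B: "[1..<n+1] = u @ B @ v" "set B = T"
        using R(5) unfolding RT is_block_close_d_iff[OF Tne] by blast
      have Bne: "B \<noteq> []" using B(2) Tne by auto
      note iv = block_of_upt[OF B(1) Bne, unfolded B(2)]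
      have "T \<noteq> {1..n}" using cT by auto
      moreover have "length u + 1 < length u + length B" using cT(1) unfolding iv(1) by simp
      ultimately have "proper_interval n T"
        unfolding proper_interval_def using iv
        by (intro exI[of _ "length u + 1"] exI[of _ "length u + length B"]) simp
      then show False using no R(4) fb[OF Tne] RT by simp
    qed
    have False
      if R: "R \<subseteq> Num ` {1..n} \<union> {Ltr_d}" "2 \<le> card R" "card R \<le> n - 1" "is_block R (close_d w)"
        "is_block R (close_d [1..<n+1])" for R
    proof (cases "Ltr_d \<in> R")
      case False
      then show False using no_d R by blast
    next
      case True
      let ?E = "Num ` {1..n} \<union> {Ltr_d}"
      have "card ?E = n + 1" by (subst card_Un_disjoint) (auto simp: card_Num)
      moreover have "card (?E - R) = card ?E - card R"
        by (rule card_Diff_subset) (use R(1) finite_subset in auto)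
      ultimately have "card (?E - R) = n + 1 - card R" by simp
      then have "2 \<le> card (?E - R)" "card (?E - R) \<le> n - 1" using R(2,3) by linarith+
      then show False
        using no_d[OF Diff_subset _ _ close_d_block_complement[OF w R(1,4)] close_d_block_complement[OF std R(1,5)]] True
        by blast
    qed
    then show "special_convergent n w" unfolding special_convergent_def using w by blast
  qed
qed

lemma single_factor_eq: "Xs @ A # Ys = [w] \<longleftrightarrow> Xs = [] \<and> A = w \<and> Ys = []"
  by (cases Xs) auto

text \<open>In a context inside a 1n-word, a block contains \<open>1\<close> only as last and \<open>n\<close> only as first letter.\<close>

lemma no_block_at_1n:
  assumes c: "converges_along T c" and T: "proper_interval n T" "1 \<in> T \<or> n \<in> T"
    and keys: "supp c \<subseteq> {[w] | w. w \<in> one_n_words n}"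
    and x: "[us @ B @ vs] \<in> supp c" and B: "set B = T"
  shows False
proof -
  obtain i j where ij: "1 \<le> i" "i < j" "j \<le> n" "T = {i..j}" "T \<noteq> {1..n}" using T(1) unfolding proper_interval_def by blast
  have finT: "finite T" using ij by simp
  have key1n: "\<exists>a b. us @ B' @ vs = a @ [1, n] @ b \<and> distinct (us @ B' @ vs)"
    if "[us @ B' @ vs] \<in> supp c" for B'
  proof -
    have "us @ B' @ vs \<in> one_n_words n" using keys that by auto
    then show ?thesis unfolding one_n_words_def words_on_def by blast
  qed
  have dB: "distinct B" using key1n[OF x] by auto
  then have Bw: "B \<in> words_on T" using B unfolding words_on_def by simp
  have Bne: "B \<noteq> []" using B ij by auto
  have last1: "last B' = 1"
    if k: "[us @ B' @ vs] \<in> supp c" and B': "set B' = T" and 1: "1 \<in> T" for B'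
  proof -
    have nT: "n \<notin> T" using 1 ij by auto
    obtain a b where ab: "us @ B' @ vs = a @ [1, n] @ b" "distinct (us @ B' @ vs)" using key1n[OF k] by blast
    obtain B1 B2 where B12: "B' = B1 @ 1 # B2" using 1 B' by (metis split_list)
    have "(us @ B1) @ 1 # (B2 @ vs) = a @ 1 # (n # b)" using ab(1) B12 by simp
    moreover have "1 \<notin> set (us @ B1)" "1 \<notin> set (B2 @ vs)" using ab(2) B12 by auto
    ultimately have "B2 @ vs = n # b" by (simp add: append_Cons_eq_iff del: append_assoc)
    then have "B2 = []" using B12 B' nT by (cases B2) auto
    then show ?thesis using B12 by simp
  qed
  have hdn: "hd B' = n"
    if k: "[us @ B' @ vs] \<in> supp c" and B': "set B' = T" and 1: "n \<in> T" for B'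
  proof -
    have nT: "1 \<notin> T" using 1 ij by auto
    obtain a b where ab: "us @ B' @ vs = a @ [1, n] @ b" "distinct (us @ B' @ vs)" using key1n[OF k] by blast
    obtain B1 B2 where B12: "B' = B1 @ n # B2" using 1 B' by (metis split_list)
    have "(us @ B1) @ n # (B2 @ vs) = (a @ [1]) @ n # b" using ab(1) B12 by simp
    moreover have "n \<notin> set (us @ B1)" "n \<notin> set (B2 @ vs)" using ab(2) B12 by auto
    ultimately have e: "us @ B1 = a @ [1]" by (simp add: append_Cons_eq_iff del: append_assoc)
    have "B1 = []"
    proof (rule ccontr)
      assume "B1 \<noteq> []"
      then have "last B1 = 1" using arg_cong[OF e, of last] by simp
      then have "1 \<in> set B1" using \<open>B1 \<noteq> []\<close> last_in_set by metis
      then show False using B12 B' nT by auto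
    qed
    then show ?thesis using B12 by simp
  qed
  obtain f where f: "kills_shuffles T f" "f B \<noteq> 0"
    "\<And>B'. B' \<in> words_on T \<Longrightarrow> B' \<noteq> B \<Longrightarrow> [us @ B' @ vs] \<in> supp c \<Longrightarrow> f B' = 0"
  proof (cases "1 \<in> T")
    case True
    obtain f where f: "kills_shuffles T f" "f B \<noteq> 0"
      "\<And>B'. B' \<in> words_on T \<Longrightarrow> last B' = last B \<Longrightarrow> B' \<noteq> B \<Longrightarrow> f B' = 0"
      by (rule functional_isolating_last[OF Bw Bne]) blast
    show thesis
    proof (rule that[OF f(1,2)])
      fix B' assume B': "B' \<in> words_on T" "B' \<noteq> B" "[us @ B' @ vs] \<in> supp c"
      then have "set B' = T" unfolding words_on_def by simp
      then show "f B' = 0" using f(3)[OF B'(1) _ B'(2)] last1[OF B'(3) _ True] last1[OF x B True] by simp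
    qed
  next
    case False
    then have n: "n \<in> T" using T(2) by simp
    obtain f where f: "kills_shuffles T f" "f B \<noteq> 0"
      "\<And>B'. B' \<in> words_on T \<Longrightarrow> hd B' = hd B \<Longrightarrow> B' \<noteq> B \<Longrightarrow> f B' = 0"
      by (rule functional_isolating_hd[OF Bw Bne]) blast
    show thesis
    proof (rule that[OF f(1,2)])
      fix B' assume B': "B' \<in> words_on T" "B' \<noteq> B" "[us @ B' @ vs] \<in> supp c"
      then have "set B' = T" unfolding words_on_def by simp
      then show "f B' = 0" using f(3)[OF B'(1) _ B'(2)] hdn[OF B'(3) _ n] hdn[OF x B n] by simp
    qed
  qed
  have "(\<Sum>B'\<in>words_on T. coeff c ([] @ (us @ B' @ vs) # []) * f B') =
      (\<Sum>B'\<in>words_on T. if B' = B then coeff c [us @ B @ vs] * f B else 0)"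
  proof (intro sum.cong refl)
    fix B' assume B': "B' \<in> words_on T"
    show "coeff c ([] @ (us @ B' @ vs) # []) * f B' = (if B' = B then coeff c [us @ B @ vs] * f B else 0)"
      using f(3)[OF B'] by (cases "[us @ B' @ vs] \<in> supp c") (auto simp: in_keys_iff)
  qed
  also have "\<dots> = coeff c [us @ B @ vs] * f B" using Bw finT by (simp add: sum.delta)
  also have "\<dots> \<noteq> 0" using x f(2) by (simp add: in_keys_iff)
  finally show False using c f(1) unfolding converges_along_def by blast
qed

lemma word_insert_lc:
  assumes w: "w \<in> words_on {1..k}"
    and \<sigma>: "\<And>i. i \<in> {1..k} \<Longrightarrow> supp (\<sigma> i) \<subseteq> words_on (slot v i)"
  shows "lin_ext (\<lambda>xs. bvec (concat xs)) (insert_lc k v [w] \<sigma>) = subst_word \<sigma> w"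
proof (rule multilinear_insert_expand[OF _ _ \<sigma>])
  have sw: "set w = {1..k}" "distinct w" using w unfolding words_on_def by auto
  show "multilinear_on {1..k} (\<lambda>\<sigma> :: nat \<Rightarrow> nat list lc. subst_word \<sigma> w)"
    unfolding multilinear_on_def
  proof (intro conjI allI impI ballI)
    fix \<sigma> \<tau> :: "nat \<Rightarrow> nat list lc" assume "\<forall>i\<in>{1..k}. \<sigma> i = \<tau> i"
    then show "subst_word \<sigma> w = subst_word \<tau> w" using sw(1) by (intro subst_word_cong) auto
  next
    fix \<sigma> :: "nat \<Rightarrow> nat list lc" and i assume "i \<in> {1..k}"
    then show "lin (\<lambda>x. subst_word (\<sigma>(i := x)) w)" using sw by (intro lin_subst_word) auto
  qed
  show "subst_word (\<lambda>i. bvec (p i)) w = bvec (concat (subst_letters p [w]))" for p :: "nat \<Rightarrow> nat list"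
    by (simp add: subst_word_bvec subst_letters_def)
qed

definition one_n_schemes :: "nat \<Rightarrow> (nat \<Rightarrow> nat) \<Rightarrow> nat list list \<Rightarrow> bool" where
  "one_n_schemes k v y \<longleftrightarrow>
     (\<exists>w. y = [w] \<and> w \<in> one_n_words k \<and> special_convergent k w \<and> v 1 = 1 \<and> v k = 1)"

lemma one_n_words_ge_2: "w \<in> one_n_words k \<Longrightarrow> 2 \<le> k"
proof -
  assume "w \<in> one_n_words k"
  then have "1 \<noteq> k" "1 \<in> {1..k}" unfolding one_n_words_def words_on_def by auto
  then show ?thesis by auto
qed

lemma one_n_insertion_scheme:
  assumes w: "w \<in> one_n_words k" "special_convergent k w"
    and v: "\<forall>i\<in>{1..k}. 1 \<le> v i" "(\<Sum>i\<in>{1..k}. v i) = n" "v 1 = 1" "v k = 1"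
  shows "insertion_scheme n k v [w]"
proof -
  have "w \<in> words_on {1..k}" using w(1) unfolding one_n_words_def by simp
  then show ?thesis
    using special_convergent_iff[of w k] w(2) v one_n_words_ge_2[OF w(1)] unfolding insertion_scheme_def by simp
qed

text \<open>
  The special convergent 1n-words are the insertion words in which every letter is replaced by one letter.
\<close>

lemma Wset_eq:
  "Wset n = {subst_word (replacement v V) w | k v V w.
     k \<le> n \<and> w \<in> one_n_words k \<and> special_convergent k w \<and>
     (\<forall>i\<in>{1..k}. 1 \<le> v i) \<and> v 1 = 1 \<and> v k = 1 \<and> (\<Sum>i\<in>{1..k}. v i) = n \<and>
     (\<forall>i\<in>{1..k}. 1 < v i \<longrightarrow> V i \<in> Lset (v i))}" (is "_ = ?W")
proof -
  have full: "subst_word (replacement v V) w = bvec w"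
    if w: "w \<in> one_n_words n" and v: "\<forall>i\<in>{1..n}. 1 \<le> v i" "(\<Sum>i\<in>{1..n}. v i) = n" for w v V
  proof -
    have v1: "v i = 1" if i: "i \<in> {1..n}" for i
    proof (rule ccontr)
      assume "v i \<noteq> 1"
      then have "1 < v i" using v(1) i by fastforce
      then have "\<exists>i\<in>{1..n}. 1 < v i" using i by blast
      then have "(\<Sum>i\<in>{1..n}. 1) < (\<Sum>i\<in>{1..n}. v i)"
        using v(1) by (intro sum_strict_mono_ex1) simp_all
      then show False using v(2) by simp
    qed
    have "replacement v V i = bvec [i]" if i: "i \<in> {1..n}" for i
    proof -
      have "offset v i = (\<Sum>j\<in>{1..<i}. 1)" unfolding offset_def using v1 i by (intro sum.cong) auto
      then have "offset v i + 1 = i" using i by simp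
      then show ?thesis using v1[OF i] unfolding replacement_def by simp
    qed
    then have "subst_word (replacement v V) w = subst_word (\<lambda>i. bvec [i]) w"
      using w unfolding one_n_words_def words_on_def by (intro subst_word_cong) auto
    then show ?thesis by (simp add: subst_word_bvec)
  qed
  show ?thesis
  proof (intro equalityI subsetI)
    fix x assume "x \<in> Wset n"
    then consider w where "x = bvec w" "w \<in> one_n_words n" "special_convergent n w" | "x \<in> insertion_words n"
      unfolding Wset_def by blast
    then show "x \<in> ?W"
    proof cases
      case 1
      then have "x = subst_word (replacement (\<lambda>_. 1) (\<lambda>_. 0)) w" using full[of w "\<lambda>_. 1" "\<lambda>_. 0"] by simp
      then show ?thesis using 1
        by (intro CollectI exI[of _ n] exI[of _ "\<lambda>_. 1"] exI[of _ "\<lambda>_. 0"] exI[of _ w]) simp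
    next
      case 2
      then obtain k v V w where "x = subst_word (replacement v V) w" "k < n" "w \<in> one_n_words k"
        "special_convergent k w" "\<forall>i\<in>{1..k}. 1 \<le> v i" "v 1 = 1" "v k = 1" "(\<Sum>i\<in>{1..k}. v i) = n"
        "\<forall>i\<in>{1..k}. 1 < v i \<longrightarrow> V i \<in> Lset (v i)"
        unfolding insertion_words_def by blast
      then show ?thesis
        by (intro CollectI exI[of _ k] exI[of _ v] exI[of _ V] exI[of _ w] conjI) simp_all
    qed
  next
    fix x assume "x \<in> ?W"
    then obtain k v V w where x: "x = subst_word (replacement v V) w" "k \<le> n" "w \<in> one_n_words k"
      "special_convergent k w" "\<forall>i\<in>{1..k}. 1 \<le> v i" "v 1 = 1" "v k = 1" "(\<Sum>i\<in>{1..k}. v i) = n"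
      "\<forall>i\<in>{1..k}. 1 < v i \<longrightarrow> V i \<in> Lset (v i)" by blast
    show "x \<in> Wset n"
    proof (cases "k = n")
      case True
      then have "x = bvec w" using full[of w v V] x by simp
      moreover have "w \<in> {w \<in> one_n_words n. special_convergent n w}" using x(3,4) True by simp
      ultimately show ?thesis unfolding Wset_def by blast
    next
      case False
      then have "k < n" using x(2) by simp
      then have "x \<in> insertion_words n"
        unfolding insertion_words_def using x
        by (intro CollectI exI[of _ k] exI[of _ v] exI[of _ V] exI[of _ w] conjI)
      then show ?thesis unfolding Wset_def by blast
    qed
  qed
qed

lemma lin_ext_concat_singletons:
  assumes "supp c \<subseteq> range (\<lambda>w. [w])"
  shows "coeff (lin_ext (\<lambda>xs. bvec (concat xs)) c) z = coeff c [z]"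
proof -
  have "coeff (lin_ext (\<lambda>xs. bvec (concat xs)) c) z = (\<Sum>xs\<in>supp c. if xs = [z] then coeff c [z] else 0)"
    unfolding coeff_lin_ext by (intro sum.cong refl) (use assms in \<open>auto simp: coeff_bvec\<close>)
  then show ?thesis by (simp add: sum.delta in_keys_iff)
qed

text \<open>
  A word is a list with one factor; the first and last slots consist of \<open>1\<close> and of \<open>n\<close> alone.
\<close>

lemma Wset_convergent:
  assumes "x \<in> Wset n"
  shows "supp x \<subseteq> words_on {1..n} \<and> (\<forall>T. proper_interval n T \<longrightarrow> word_converges_along T x)"
proof -
  obtain k v V w where x: "x = subst_word (replacement v V) w" "k \<le> n" "w \<in> one_n_words k"
      "special_convergent k w" "\<forall>i\<in>{1..k}. 1 \<le> v i" "v 1 = 1" "v k = 1" "(\<Sum>i\<in>{1..k}. v i) = n"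
      "\<forall>i\<in>{1..k}. 1 < v i \<longrightarrow> V i \<in> Lset (v i)"
    using assms unfolding Wset_eq by blast
  have wk: "w \<in> words_on {1..k}" using x(3) unfolding one_n_words_def by simp
  note scheme = one_n_insertion_scheme[OF x(3,4,5,8,6,7)]
  have \<sigma>: "replacement v V i \<in> convergent_shuffles (slot v i)" if "i \<in> {1..k}" for i
    by (rule replacement_Lset_convergent) (use x(5,9) that in auto)
  let ?c = "insert_lc k v [w] (replacement v V)"
  have xc: "x = lin_ext (\<lambda>xs. bvec (concat xs)) ?c"
    unfolding x(1) by (rule word_insert_lc[OF wk, symmetric]) (use \<sigma> in \<open>auto simp: convergent_shuffles_def\<close>)
  have kc: "supp ?c \<subseteq> range (\<lambda>w. [w])"
  proof
    fix xs assume "xs \<in> supp ?c"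
    then obtain p where "xs = subst_letters p [w]" by (rule keys_insert_lc)
    then show "xs \<in> range (\<lambda>w. [w])" unfolding subst_letters_def by simp
  qed
  have co: "coeff x z = coeff ?c [z]" for z unfolding xc by (rule lin_ext_concat_singletons[OF kc])
  have "supp x \<subseteq> words_on {1..n}"
  proof
    fix z assume "z \<in> supp x"
    then have "[z] \<in> supp ?c" by (simp add: in_keys_iff co)
    then obtain p where p: "p \<in> fillings k v" "[z] = subst_letters p [w]" by (rule keys_insert_lc)
    have "concat [w] \<in> words_on {1..k}" using wk by simp
    from subst_letters_words_on[OF this x(8) p(1)] have "concat [z] \<in> words_on {1..n}" unfolding p(2) .
    then show "z \<in> words_on {1..n}" by simp
  qed
  moreover have "word_converges_along T x" if T: "proper_interval n T" for T
    unfolding word_converges_along_def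
  proof (intro allI impI)
    fix f u z assume f: "kills_shuffles T f"
    have "converges_along T ?c"
      using insert_lc_convergent[OF scheme \<sigma>] T unfolding convergent_family_def by blast
    then have "(\<Sum>B\<in>words_on T. coeff ?c ([] @ (u @ B @ z) # []) * f B) = 0"
      using f unfolding converges_along_def by blast
    then show "(\<Sum>B\<in>words_on T. coeff x (u @ B @ z) * f B) = 0" by (simp add: co)
  qed
  ultimately show ?thesis by blast
qed

text \<open>
  No block contains \<open>1\<close> or \<open>n\<close>, so that in the decomposition of a word these two letters are kept, and in
  the contracted word they are still adjacent.
\<close>

lemma convergent_in_Kspace:
  assumes \<eta>: "supp \<eta> \<subseteq> one_n_words n" and n: "2 \<le> n"
    and conv: "\<And>T. proper_interval n T \<Longrightarrow> word_converges_along T \<eta>"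
  shows "\<eta> \<in> Kspace n"
proof -
  define X where "X = {[w] | w. w \<in> one_n_words n}"
  define c where "c = lin_ext (\<lambda>w. bvec [w]) \<eta>"
  have c1: "coeff c [w] = coeff \<eta> w" for w
  proof -
    have "coeff c [w] = (\<Sum>z\<in>supp \<eta>. if z = w then coeff \<eta> w else 0)"
      unfolding c_def coeff_lin_ext by (intro sum.cong refl) (auto simp: coeff_bvec)
    then show ?thesis by (simp add: sum.delta in_keys_iff)
  qed
  have c0: "coeff c xs = 0" if "\<And>w. xs \<noteq> [w]" for xs
    unfolding c_def coeff_lin_ext by (intro sum.neutral) (use that in \<open>auto simp: coeff_bvec\<close>)
  have kc: "supp c \<subseteq> X"
  proof
    fix xs assume xs: "xs \<in> supp c"
    then obtain w where w: "xs = [w]" using c0[of xs] by (auto simp: in_keys_iff)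
    then have "w \<in> supp \<eta>" using xs c1[of w] by (simp add: in_keys_iff)
    then show "xs \<in> X" using w \<eta> unfolding X_def by blast
  qed
  have "converges_along T c" if T: "proper_interval n T" for T
    unfolding converges_along_def
  proof (intro allI impI)
    fix f Xs u w Ys assume f: "kills_shuffles T f"
    show "(\<Sum>B\<in>words_on T. coeff c (Xs @ (u @ B @ w) # Ys) * f B) = 0"
    proof (cases "Xs = [] \<and> Ys = []")
      case True
      then show ?thesis using conv[OF T] f unfolding word_converges_along_def by (simp add: c1)
    next
      case False
      then have "coeff c (Xs @ A # Ys) = 0" for A by (intro c0) (simp add: single_factor_eq)
      then show ?thesis by simp
    qed
  qed
  then have cf: "convergent_family n c" unfolding convergent_family_def by blast
  have "c \<in> lc.span {insert_lc k v y \<sigma> | k v y \<sigma>.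
      insertion_scheme n k v y \<and> one_n_schemes k v y \<and> (\<forall>i\<in>{1..k}. \<sigma> i \<in> slot_insertions v i)}"
  proof (rule convergent_family_span[OF _ _ cf kc])
    fix c xs assume c: "convergent_family n c" "supp c \<subseteq> X" "xs \<in> supp c"
    obtain w where w: "xs = [w]" "w \<in> one_n_words n" using c(2,3) unfolding X_def by blast
    have wn: "concat xs \<in> words_on {1..n}" using w unfolding one_n_words_def by simp
    obtain k v y p where y: "2 \<le> k" "concat y \<in> words_on {1..k}" "\<forall>i\<in>{1..k}. 1 \<le> v i"
          "(\<Sum>i\<in>{1..k}. v i) = n" "\<And>T. proper_interval k T \<Longrightarrow> \<not> factor_block T y"
          "p \<in> fillings k v" "xs = subst_letters p y"
          "\<And>i. i \<in> {1..k} \<Longrightarrow> 1 < v i \<Longrightarrow> proper_interval n (slot v i) \<and> factor_block (slot v i) xs"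
      by (rule insertion_decomposition[OF wn n]) blast
    obtain w' where w': "y = [w']" "w = concat (map p w')" using y(7) w(1) unfolding subst_letters_def by auto
    have small: "v i = 1" if i: "i \<in> {1..k}" "1 \<in> slot v i \<or> n \<in> slot v i" for i
    proof (rule ccontr)
      assume "v i \<noteq> 1"
      then have "1 < v i" using y(3) i(1) by fastforce
      from y(8)[OF i(1) this] obtain us B vs where
        blk: "proper_interval n (slot v i)" "w = us @ B @ vs" "set B = slot v i"
        unfolding factor_block_def w(1) by auto
      moreover have "converges_along (slot v i) c" using c(1) blk(1) unfolding convergent_family_def by blast
      ultimately show False using no_block_at_1n[of "slot v i" c n us B vs] i(2) c(2,3) w(1) unfolding X_def by blast
    qed
    have k1: "1 \<in> {1..k}" "k \<in> {1..k}" using y(1) by auto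
    have s1: "1 \<in> slot v 1" using y(3) k1(1) unfolding slot_def by auto
    have "offset v k + v k = n" using offset_Suc[of k v] offset_Suc_eq_sum[of v k] y(1,4) by simp
    then have sk: "n \<in> slot v k" using y(3) k1(2) unfolding slot_def by auto
    have v1: "v 1 = 1" and vk: "v k = 1" using small[OF k1(1)] small[OF k1(2)] s1 sk by blast+
    have p1: "p 1 = [1]" and pk: "p k = [n]"
    proof -
      have "slot v 1 = {1}" using v1 by (simp add: slot_def)
      then show "p 1 = [1]" using PiE_mem[OF y(6) k1(1)] by (simp add: words_on_singleton)
      have "slot v k = {n}" using vk \<open>offset v k + v k = n\<close> by (auto simp: slot_def)
      then show "p k = [n]" using PiE_mem[OF y(6) k1(2)] by (simp add: words_on_singleton)
    qed
    have w'k: "w' \<in> words_on {1..k}" using y(2) unfolding w'(1) by simp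
    have "w' \<in> one_n_words k"
    proof -
      obtain a b where ab: "w = a @ [1, n] @ b" "distinct w" using w(2) unfolding one_n_words_def words_on_def by auto
      have "1 \<in> set w'" using w'k k1(1) unfolding words_on_def by simp
      then obtain c d where cd: "w' = c @ 1 # d" by (meson split_list)
      have e: "w = concat (map p c) @ 1 # concat (map p d)" unfolding w'(2) cd using p1 by simp
      then have "1 \<notin> set (concat (map p c))" "1 \<notin> set (concat (map p d))" using ab(2) by auto
      moreover have "concat (map p c) @ 1 # concat (map p d) = a @ 1 # (n # b)" using e ab(1) by simp
      ultimately have nd: "concat (map p d) = n # b" using append_Cons_eq_iff by metis
      then obtain l d' where d: "d = l # d'" by (cases d) auto
      have l: "l \<in> {1..k}" using w'k cd d unfolding words_on_def by auto
      then have "p l \<noteq> []" using fillings_set[OF y(6) l] slot_nonempty[of v l] y(3) by auto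
      then have "n \<in> set (p l)" using nd unfolding d by (cases "p l") auto
      then have "l = k" using slot_disjoint[of l k n v] fillings_set[OF y(6) l] l sk y(1) by auto
      then show ?thesis using w'k cd d unfolding one_n_words_def by auto
    qed
    moreover have "special_convergent k w'"
      using special_convergent_iff[OF w'k] y(5) unfolding w'(1) by blast
    ultimately have "one_n_schemes k v y" "insertion_scheme n k v y"
      using one_n_insertion_scheme[OF _ _ y(3,4) v1 vk] w'(1) v1 vk unfolding one_n_schemes_def by auto
    then show "\<exists>k v y p. insertion_scheme n k v y \<and> one_n_schemes k v y \<and> p \<in> fillings k v \<and> xs = subst_letters p y"
      using y(6,7) by blast
  next
    fix k v y i assume y: "insertion_scheme n k v y" and i: "i \<in> {1..k}"
    have "1 \<le> v i" using y i unfolding insertion_scheme_def by blast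
    then show "convergent_shuffles (slot v i) \<subseteq> lc.span (slot_insertions v i)"
    proof (rule convergent_shuffles_slot_span)
      assume "1 < v i"
      then show "convergent_shuffles {1..v i} \<subseteq> lc.span (Lset (v i))"
        by (intro equalityD1 convergent_shuffles_eq_span_Lset) simp
    qed
  qed
  then have "lin_ext (\<lambda>xs. bvec (concat xs)) c \<in> lc.span (Wset n)"
  proof (rule lin_span_into[OF lin_lin_ext])
    fix s assume "s \<in> {insert_lc k v y \<sigma> | k v y \<sigma>.
      insertion_scheme n k v y \<and> one_n_schemes k v y \<and> (\<forall>i\<in>{1..k}. \<sigma> i \<in> slot_insertions v i)}"
    then obtain k v y \<sigma> where s: "s = insert_lc k v y \<sigma>" "insertion_scheme n k v y" "one_n_schemes k v y"
      "\<forall>i\<in>{1..k}. \<sigma> i \<in> slot_insertions v i" by blast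
    obtain w where w: "y = [w]" "w \<in> one_n_words k" "special_convergent k w" "v 1 = 1" "v k = 1"
      using s(3) unfolding one_n_schemes_def by blast
    have wk: "w \<in> words_on {1..k}" using w(2) unfolding one_n_words_def by simp
    have v: "\<forall>i\<in>{1..k}. 1 \<le> v i" "(\<Sum>i\<in>{1..k}. v i) = n" using s(2) unfolding insertion_scheme_def by auto
    obtain V where V: "\<forall>i\<in>{1..k}. \<sigma> i = replacement v V i \<and> (1 < v i \<longrightarrow> V i \<in> Lset (v i))"
      by (rule slot_insertions_choice[OF s(4)])
    have "supp (\<sigma> i) \<subseteq> words_on (slot v i)" if i: "i \<in> {1..k}" for i
    proof -
      have "replacement v V i \<in> convergent_shuffles (slot v i)"
        by (rule replacement_Lset_convergent) (use v(1) i V in auto)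
      then show ?thesis using V i unfolding convergent_shuffles_def by simp
    qed
    then have "lin_ext (\<lambda>xs. bvec (concat xs)) s = subst_word \<sigma> w"
      unfolding s(1) w(1) by (rule word_insert_lc[OF wk])
    also have "\<dots> = subst_word (replacement v V) w"
      using V wk unfolding words_on_def by (intro subst_word_cong) auto
    also have "\<dots> \<in> Wset n"
    proof -
      have "k = (\<Sum>i\<in>{1..k}. 1)" by simp
      also have "\<dots> \<le> n" unfolding v(2)[symmetric] using v(1) by (intro sum_mono) auto
      finally have "k \<le> n" .
      then show ?thesis unfolding Wset_eq using w v V by blast
    qed
    finally show "lin_ext (\<lambda>xs. bvec (concat xs)) s \<in> lc.span (Wset n)" by (rule lc.span_base)
  qed
  also have "lin_ext (\<lambda>xs. bvec (concat xs)) c = \<eta>"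
  proof (rule poly_mapping_eqI)
    fix z
    have "supp c \<subseteq> range (\<lambda>w. [w])" using kc unfolding X_def by blast
    from lin_ext_concat_singletons[OF this] show "coeff (lin_ext (\<lambda>xs. bvec (concat xs)) c) z = coeff \<eta> z"
      by (simp add: c1)
  qed
  finally show ?thesis unfolding Kspace_def .
qed

theorem theorem3p45:
  fixes n :: nat and \<eta> :: "nat list lc"
  assumes "\<eta> \<in> Wspace n"
  shows "convergent_polygon n (polygon_of \<eta>) \<longleftrightarrow> \<eta> \<in> Kspace n"
proof -
  have k1: "supp \<eta> \<subseteq> one_n_words n" using assms unfolding Wspace_def free_on_iff .
  then have kn: "supp \<eta> \<subseteq> words_on {1..n}" unfolding one_n_words_def by blast
  show ?thesis
    unfolding convergent_polygon_iff[OF kn]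
  proof
    assume conv: "\<forall>T. proper_interval n T \<longrightarrow> word_converges_along T \<eta>"
    show "\<eta> \<in> Kspace n"
    proof (cases "2 \<le> n")
      case True
      then show ?thesis using convergent_in_Kspace[OF k1] conv by blast
    next
      case False
      \<comment> \<open>there are no 1n-words\<close>
      then have "supp \<eta> = {}" using k1 one_n_words_ge_2 by blast
      then have "\<eta> = 0" by simp
      then show ?thesis unfolding Kspace_def by (simp add: lc.span_zero)
    qed
  next
    assume "\<eta> \<in> Kspace n"
    moreover have "lc.subspace {x. \<forall>T. proper_interval n T \<longrightarrow> word_converges_along T x}"
      unfolding lc.subspace_def word_converges_along_def
      by (auto simp: lookup_add distrib_right sum.distrib mult.assoc simp flip: sum_distrib_left)
    then have "Kspace n \<subseteq> {x. \<forall>T. proper_interval n T \<longrightarrow> word_converges_along T x}"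
      unfolding Kspace_def using Wset_convergent by (intro lc.span_minimal) auto
    ultimately show "\<forall>T. proper_interval n T \<longrightarrow> word_converges_along T \<eta>" by blast
  qed
qed

end
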